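(* There exists a displacement $y:\Lambda\to\mathbb{R}$ which is a globally stable equilibrium and has net Burgers vector $B[y]=1$.
   Context: Let $\mathsf R_6$ denote rotation of $\mathbb R^2$ through angle $\pi/3$, $a_1=(1,0)^T$, $a_i=\mathsf R_6^{i-1}a_1$ (indices mod 6), and $\Lambda:=(\tfrac12,\tfrac{\sqrt3}{6})^T+\{m a_1+n a_2: m,n\in\mathbb Z\}$ (a triangular lattice; the origin is the barycentre of one of its elementary triangles). The set of bonds is $\mathcal B=\{(\xi,\eta)\in\Lambda^2:|\xi-\eta|=1\}$ (ordered pairs); for $b=(\xi,\eta)$, $-b=(\eta,\xi)$ and for $y:\Lambda\to\mathbb R$, $Dy_b=y(\eta)-y(\xi)$. For a bond $b$, $|b|$ denotes the distance from the origin to the closed segment $b$. A cell is a triple $C=(\xi,\zeta,\eta)$ of lattice points with $(\xi,\zeta),(\zeta,\eta),(\eta,\xi)\in\mathcal B$; it is positively oriented if the vertices are in counterclockwise order, and $\partial C=(\xi,\zeta)+(\zeta,\eta)+(\eta,\xi)$. For $\alpha:\mathcal B\to\mathbb R$ and a formal sum of bonds $\Gamma=\sum_k b_k$, $\int_\Gamma\alpha=\sum_k\alpha_{b_k}$. For $y:\Lambda\to\mathbb R$, $[Dy]$ is the set of $\alpha:\mathcal B\to[-\tfrac12,\tfrac12]$ with $\alpha_{-b}=-\alpha_b$ and $Dy_b-\alpha_b\in\mathbb Z$ for all $b$. A dislocation core of $\alpha$ is a positively oriented cell $C$ with $\int_{\partial C}\alpha\neq0$; $\mathcal C^\pm[\alpha]$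 denotes the set of dislocation cores. If $y$ admits some $\alpha\in[Dy]$ with $\alpha_b\to0$ as $|b|\to\infty$, the net Burgers vector is $B[y]:=\sum_{C\in\mathcal C^\pm[\alpha]}\int_{\partial C}\alpha$ (this is finite and independent of the choice of $\alpha\in[Dy]$). The pair potential $\psi\in C(\mathbb R)\cap C^4(\mathbb R\setminus(\mathbb Z+\tfrac12))$ satisfies: ($\psi$1) $\psi$ is 1-periodic; ($\psi$2) $\psi$ and $\psi(\tfrac12+\cdot)$ are even; ($\psi$3) $\psi(r)=0$ iff $r\in\mathbb Z$; ($\psi$4) $\psi''(0)=\mu>0$; ($\psi$5) $\psi(x)\ge\tfrac12\psi''(0)x^2$ for all $x\in[-\tfrac12,\tfrac12]$. Let $\xi_0=(0,\sqrt3/3)^T$ and $\mathscr W_0=\{v:\Lambda\to\mathbb R: v(\xi_0)=0,\ \{b: Dv_b\ne0\}\text{ bounded}\}$. For $y$ and $u\in\mathscr W_0$, $E(y+u;y):=\sum_{b\in\mathcal B}[\psi(Dy_b+Du_b)-\psi(Dy_b)]$ (a finite sum). A displacement $y$ is a globally stable equilibrium if $E(y+u;y)\ge0$ for all $u\in\mathscr W_0$.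
   Formalization: The point ξ₀=(0,√3/3) is not in Λ, so the normalisation v(ξ₀)=0 is imposed at the lattice point (0,−√3/3) instead; and each positively oriented triangle is counted once in B[y], not once for each of its three cyclic labellings as a triple. *)

theory Defs
  imports "HOL-Analysis.Analysis"
begin

text \<open>Lattice points are indexed by integer coordinates (m,n); the actual position
  in the plane is  (1/2, sqrt 3/6) + m a1 + n a2  with a1 = (1,0), a2 = (1/2, sqrt 3/2).\<close>

type_synonym lpt = "int \<times> int"

definition pos :: "lpt \<Rightarrow> real \<times> real" where
  "pos p = (1/2 + real_of_int (fst p) + real_of_int (snd p) / 2,
            sqrt 3 / 6 + real_of_int (snd p) * sqrt 3 / 2)"

definition is_bond :: "lpt \<Rightarrow> lpt \<Rightarrow> bool" where
  "is_bond \<xi> \<eta> \<longleftrightarrow> dist (pos \<xi>) (pos \<eta>) = 1"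

definition bond_dist :: "lpt \<Rightarrow> lpt \<Rightarrow> real" where
  "bond_dist \<xi> \<eta> = infdist (0 :: real \<times> real) (closed_segment (pos \<xi>) (pos \<eta>))"

definition D :: "(lpt \<Rightarrow> real) \<Rightarrow> lpt \<Rightarrow> lpt \<Rightarrow> real" where
  "D y \<xi> \<eta> = y \<eta> - y \<xi>"

definition is_cell :: "lpt \<Rightarrow> lpt \<Rightarrow> lpt \<Rightarrow> bool" where
  "is_cell \<xi> \<zeta> \<eta> \<longleftrightarrow> is_bond \<xi> \<zeta> \<and> is_bond \<zeta> \<eta> \<and> is_bond \<eta> \<xi>"

definition pos_oriented :: "lpt \<Rightarrow> lpt \<Rightarrow> lpt \<Rightarrow> bool" where
  "pos_oriented \<xi> \<zeta> \<eta> \<longleftrightarrow>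
     (fst (pos \<zeta>) - fst (pos \<xi>)) * (snd (pos \<eta>) - snd (pos \<xi>))
   - (snd (pos \<zeta>) - snd (pos \<xi>)) * (fst (pos \<eta>) - fst (pos \<xi>)) > 0"

definition circ :: "(lpt \<Rightarrow> lpt \<Rightarrow> real) \<Rightarrow> lpt \<Rightarrow> lpt \<Rightarrow> lpt \<Rightarrow> real" where
  "circ \<alpha> \<xi> \<zeta> \<eta> = \<alpha> \<xi> \<zeta> + \<alpha> \<zeta> \<eta> + \<alpha> \<eta> \<xi>"

definition Dclass :: "(lpt \<Rightarrow> real) \<Rightarrow> (lpt \<Rightarrow> lpt \<Rightarrow> real) set" where
  "Dclass y = {\<alpha>. \<forall>\<xi> \<eta>. is_bond \<xi> \<eta> \<longrightarrow>
      \<alpha> \<xi> \<eta> \<in> {-1/2..1/2} \<and> \<alpha> \<eta> \<xi> = - \<alpha> \<xi> \<eta> \<and> D y \<xi> \<eta> - \<alpha> \<xi> \<eta> \<in> \<int>}"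

definition decays :: "(lpt \<Rightarrow> lpt \<Rightarrow> real) \<Rightarrow> bool" where
  "decays \<alpha> \<longleftrightarrow> (\<forall>\<epsilon>>0. \<exists>R. \<forall>\<xi> \<eta>. is_bond \<xi> \<eta> \<and> bond_dist \<xi> \<eta> > R \<longrightarrow> \<bar>\<alpha> \<xi> \<eta>\<bar> < \<epsilon>)"

text \<open>Dislocation cores, identified as geometric triangles (vertex sets), so that the
  cyclic relabellings of one positively oriented cell are counted once.\<close>
definition cores :: "(lpt \<Rightarrow> lpt \<Rightarrow> real) \<Rightarrow> lpt set set" where
  "cores \<alpha> = {{\<xi>, \<zeta>, \<eta>} | \<xi> \<zeta> \<eta>.
      is_cell \<xi> \<zeta> \<eta> \<and> pos_oriented \<xi> \<zeta> \<eta> \<and> circ \<alpha> \<xi> \<zeta> \<eta> \<noteq> 0}"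

text \<open>Circulation around a triangle, computed from any positively oriented labelling
  (it is independent of the cyclic labelling chosen).\<close>
definition tri_circ :: "(lpt \<Rightarrow> lpt \<Rightarrow> real) \<Rightarrow> lpt set \<Rightarrow> real" where
  "tri_circ \<alpha> T = (case (SOME C. case C of (\<xi>, \<zeta>, \<eta>) \<Rightarrow>
        T = {\<xi>, \<zeta>, \<eta>} \<and> is_cell \<xi> \<zeta> \<eta> \<and> pos_oriented \<xi> \<zeta> \<eta>)
      of (\<xi>, \<zeta>, \<eta>) \<Rightarrow> circ \<alpha> \<xi> \<zeta> \<eta>)"

definition has_burgers :: "(lpt \<Rightarrow> real) \<Rightarrow> real \<Rightarrow> bool" where
  "has_burgers y B \<longleftrightarrow> (\<exists>\<alpha>. \<alpha> \<in> Dclass y \<and> decays \<alpha> \<and> finite (cores \<alpha>) \<and>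
      (\<Sum>T\<in>cores \<alpha>. tri_circ \<alpha> T) = B)"

text \<open>xi_0: the lattice point (0, -sqrt 3/3), i.e. index (0,-1).\<close>
definition xi0 :: lpt where "xi0 = (0, -1)"

definition W0 :: "(lpt \<Rightarrow> real) set" where
  "W0 = {v. v xi0 = 0 \<and>
      (\<exists>R. \<forall>\<xi> \<eta>. is_bond \<xi> \<eta> \<and> D v \<xi> \<eta> \<noteq> 0 \<longrightarrow> bond_dist \<xi> \<eta> \<le> R)}"

text \<open>E(y+u; y): finite sum over the (bounded, hence finite) set of bonds where Du \<noteq> 0;
  all other summands vanish.\<close>
definition energy_diff :: "(real \<Rightarrow> real) \<Rightarrow> (lpt \<Rightarrow> real) \<Rightarrow> (lpt \<Rightarrow> real) \<Rightarrow> real" where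
  "energy_diff \<psi> y u = (\<Sum>b\<in>{(\<xi>, \<eta>). is_bond \<xi> \<eta> \<and> D u \<xi> \<eta> \<noteq> 0}.
      \<psi> (D y (fst b) (snd b) + D u (fst b) (snd b)) - \<psi> (D y (fst b) (snd b)))"

definition globally_stable :: "(real \<Rightarrow> real) \<Rightarrow> (lpt \<Rightarrow> real) \<Rightarrow> bool" where
  "globally_stable \<psi> y \<longleftrightarrow> (\<forall>u\<in>W0. energy_diff \<psi> y u \<ge> 0)"

definition C4_on :: "real set \<Rightarrow> (real \<Rightarrow> real) \<Rightarrow> bool" where
  "C4_on S f \<longleftrightarrow> open S \<and>
     (\<forall>k<4. \<forall>x\<in>S. ((deriv ^^ k) f has_real_derivative (deriv ^^ Suc k) f x) (at x)) \<and>
     continuous_on S ((deriv ^^ 4) f)"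

end

theory Submission
  imports Defs "HOL-Complex_Analysis.Great_Picard"
begin

text \<open>
  Minimise the energy relative to the angle function of a single dislocation, with a penalty
  \<open>\<epsilon>\<close> for every bond that is changed. The penalised functional is trivially bounded below, and its
  near minimisers are stable up to an error of order \<open>\<epsilon>\<close>. The point is to show that, after a lattice
  translation, their bond strains differ from those of the single dislocation by a form that is
  bounded in the square-summable norm uniformly in \<open>\<epsilon>\<close>: a pointwise limit is then globally stable,
  and a square-summable perturbation changes neither the decay nor the net Burgers vector.

  For the uniform bound write the strain as the single dislocation at \<open>p\<close> plus a form \<open>\<gamma>\<close>.
  By (\<open>\<psi>\<close>5) and summation by parts the energy excess is at least half the squared norm of \<open>\<gamma>\<close> minus
  \<open>\<Sum> b\<^sub>T log |T - p|\<close>, where the charges \<open>b\<^sub>T\<close> of the cores are integers with sum 1. Single linkage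
  clusters of the cores at dyadic scales form a tree, and one can descend it through clusters of
  positive charge to find \<open>p\<close>. A scale at which the clusters are small compared with their
  separation contributes with the good sign; the number of other scales is at most linear in the
  number of well separated cores, and their contribution is absorbed by Cauchy--Schwarz. Finally, a
  comparison argument shows that near a core of a near minimiser the energy in a box of size \<open>r\<close>
  is at least of order \<open>log r\<close>, so that well separated cores cost more than they can gain.
\<close>

section \<open>Integer parts and square-summable functions\<close>

definition wrap :: "real \<Rightarrow> real" where
  "wrap t = t - of_int (round t)"

lemma abs_wrap_le: "\<bar>wrap t\<bar> \<le> 1/2"
  unfolding wrap_def using of_int_round_abs_le[of t] by (simp add: abs_minus_commute)

lemma diff_wrap_Ints: "t - wrap t \<in> \<int>"
  by (simp add: wrap_def)

lemma wrap_eqI: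
  assumes "t - a \<in> \<int>" "\<bar>a\<bar> < 1/2" shows "wrap t = a"
proof -
  obtain k where "t - a = of_int k" using assms(1) by (auto elim: Ints_cases)
  moreover from this have "round t = k"
    using assms(2) by (intro round_unique') (auto simp: abs_if split: if_splits)
  ultimately show ?thesis by (simp add: wrap_def)
qed

lemma young_inequality_8: "x * y \<le> x\<^sup>2 / 8 + 2 * y\<^sup>2" for x y :: real
  using zero_le_power2[of "x - 4 * y"] by (simp add: power2_eq_square algebra_simps)

lemma exists_pow2_ge: "\<exists>M. C \<le> (2::real) ^ M"
  using real_arch_pow[of 2 C] less_imp_le by auto

definition l2_bounded :: "('a \<Rightarrow> real) \<Rightarrow> real \<Rightarrow> bool" where
  "l2_bounded f G \<longleftrightarrow> (\<forall>S. finite S \<longrightarrow> (\<Sum>x\<in>S. (f x)\<^sup>2) \<le> G)"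

lemma l2_boundedD: "l2_bounded f G \<Longrightarrow> finite S \<Longrightarrow> (\<Sum>x\<in>S. (f x)\<^sup>2) \<le> G"
  by (simp add: l2_bounded_def)

lemma l2_bounded_nonneg: "l2_bounded f G \<Longrightarrow> 0 \<le> G"
  using l2_boundedD[of f G "{}"] by simp

lemma l2_bounded_imp_finite_ge:
  assumes "l2_bounded f G" "\<delta> > 0" shows "finite {x. \<delta> \<le> \<bar>f x\<bar>}"
proof (rule finite_if_finite_subsets_card_bdd[THEN conjunct1])
  fix S assume large: "S \<subseteq> {x. \<delta> \<le> \<bar>f x\<bar>}" "finite S"
  have "real (card S) * \<delta>\<^sup>2 = (\<Sum>x\<in>S. \<delta>\<^sup>2)" by simp
  also have "\<dots> \<le> (\<Sum>x\<in>S. (f x)\<^sup>2)"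
    using large assms(2) by (intro sum_mono abs_le_square_iff[THEN iffD1]) auto
  also have "\<dots> \<le> G" using assms(1) large(2) by (rule l2_boundedD)
  finally have "real (card S) \<le> G / \<delta>\<^sup>2" using assms(2) by (simp add: field_simps)
  then show "card S \<le> nat \<lceil>G / \<delta>\<^sup>2\<rceil>" by linarith
qed

lemma l2_bounded_tendsto:
  assumes "\<And>n. l2_bounded (f n) G" "\<And>x. (\<lambda>n. f n x) \<longlonglongrightarrow> g x"
  shows "l2_bounded g G"
  unfolding l2_bounded_def
proof (intro allI impI)
  fix S :: "'a set" assume "finite S"
  then have "\<forall>\<^sub>F n in sequentially. (\<Sum>x\<in>S. (f n x)\<^sup>2) \<le> G" using assms(1) by (simp add: l2_boundedD)
  moreover have "(\<lambda>n. \<Sum>x\<in>S. (f n x)\<^sup>2) \<longlonglongrightarrow> (\<Sum>x\<in>S. (g x)\<^sup>2)"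
    by (intro tendsto_intros assms(2))
  ultimately show "(\<Sum>x\<in>S. (g x)\<^sup>2) \<le> G" by (intro tendsto_upperbound) auto
qed

section \<open>Hierarchical clustering of charges\<close>

definition separated :: "('a \<Rightarrow> 'b::metric_space) \<Rightarrow> real \<Rightarrow> 'a set set \<Rightarrow> bool" where
  "separated c l P \<longleftrightarrow> (\<forall>A\<in>P. \<forall>B\<in>P. A \<noteq> B \<longrightarrow> (\<forall>x\<in>A. \<forall>y\<in>B. l < dist (c x) (c y)))"

definition spread :: "('a \<Rightarrow> 'b::metric_space) \<Rightarrow> 'a set set \<Rightarrow> real" where
  "spread c P = (\<Sum>A\<in>P. diameter (c ` A))"

definition isolates_charge ::
    "('a \<Rightarrow> 'b::metric_space) \<Rightarrow> ('a \<Rightarrow> real) \<Rightarrow> 'a set \<Rightarrow> 'b \<Rightarrow> real \<Rightarrow> real \<Rightarrow> bool" where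
  "isolates_charge c b X z r R \<longleftrightarrow>
     (\<exists>A\<subseteq>X. 0 < sum b A \<and> (\<forall>x\<in>A. dist (c x) z \<le> r) \<and> (\<forall>x\<in>X - A. R < dist (c x) z))"

lemma dist_le_diameter_image:
  "finite A \<Longrightarrow> x \<in> A \<Longrightarrow> y \<in> A \<Longrightarrow> dist (c x) (c y) \<le> diameter (c ` A)"
  by (intro diameter_bounded_bound finite_imp_bounded) auto

lemma diameter_image_nonneg: "finite A \<Longrightarrow> 0 \<le> diameter (c ` A)"
  by (simp add: diameter_ge_0 finite_imp_bounded)

lemma finite_partition_element:
  assumes "finite X" "partition_on X P" "A \<in> P" shows "finite A"
  using assms finite_subset[of A X] by (auto simp: partition_on_def)

lemma spread_nonneg:
  assumes "finite X" "partition_on X P" shows "0 \<le> spread c P"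
  unfolding spread_def using finite_partition_element[OF assms]
  by (intro sum_nonneg diameter_image_nonneg)

lemma diameter_image_le:
  assumes "A \<noteq> {}" "\<And>x y. x \<in> A \<Longrightarrow> y \<in> A \<Longrightarrow> dist (c x) (c y) \<le> d"
  shows "diameter (c ` A) \<le> d"
  unfolding diameter_def using assms by (auto intro!: cSUP_least)

lemma diameter_image_Un_le:
  assumes finite_AB: "finite A" "finite B" and link: "x \<in> A" "y \<in> B" "dist (c x) (c y) \<le> l"
  shows "diameter (c ` (A \<union> B)) \<le> diameter (c ` A) + diameter (c ` B) + l"
proof (rule diameter_image_le)
  have across: "dist (c u) (c v) \<le> diameter (c ` A) + diameter (c ` B) + l"
    if "u \<in> A" "v \<in> B" for u v
    using dist_triangle[of "c u" "c v" "c x"] dist_triangle[of "c x" "c v" "c y"]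
      dist_le_diameter_image[of A u x c] dist_le_diameter_image[of B y v c] that assms by linarith
  have "0 \<le> l" using link(3) zero_le_dist order_trans by blast
  then show "dist (c u) (c v) \<le> diameter (c ` A) + diameter (c ` B) + l"
    if "u \<in> A \<union> B" "v \<in> A \<union> B" for u v
    using that across[of u v] across[of v u] dist_le_diameter_image[of A u v c]
      dist_le_diameter_image[of B u v c] diameter_image_nonneg[of A c] diameter_image_nonneg[of B c]
        finite_AB
    by (auto simp: dist_commute)
qed (use link in auto)

lemma merge_two_clusters:
  assumes partition: "finite X" "partition_on X P" and clusters: "A \<in> P" "B \<in> P" "A \<noteq> B"
    and link: "x \<in> A" "y \<in> B" "dist (c x) (c y) \<le> l"
  shows "\<exists>Q. refines X P Q \<and> card P = Suc (card Q) \<and> spread c Q \<le> spread c P + l"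
proof (intro exI conjI)
  define R where "R = P - {A, B}"
  define Q where "Q = insert (A \<union> B) R"
  have disjoint: "C \<inter> D = {}" if "C \<in> P" "D \<in> P" "C \<noteq> D" for C D
    using that partition(2) by (auto simp: partition_on_def disjoint_def)
  have P_eq: "P = insert A (insert B R)" "A \<notin> insert B R" "B \<notin> R" "finite R"
    using clusters finite_elements[OF partition] by (auto simp: R_def)
  have union_notin: "A \<union> B \<notin> R"
    using disjoint[of "A \<union> B" A] clusters(1) link(1) by (auto simp: R_def)
  have "partition_on X Q"
  proof (rule partition_onI)
    show "\<Union> Q = X" using partition(2) P_eq unfolding Q_def partition_on_def by auto
    show "{} \<notin> Q" using link partition(2) by (auto simp: Q_def R_def partition_on_def)
    have "disjnt (A \<union> B) C" if "C \<in> R" for C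
      using disjoint[of A C] disjoint[of B C] that clusters by (auto simp: R_def disjnt_def)
    moreover have "disjnt C D" if "C \<in> R" "D \<in> R" "C \<noteq> D" for C D
      using disjoint that by (simp add: R_def disjnt_def)
    ultimately show "disjnt C D" if "C \<in> Q" "D \<in> Q" "C \<noteq> D" for C D
      using that unfolding Q_def by (metis disjnt_sym insertE)
  qed
  then show "refines X P Q"
    using partition(2) P_eq(1) unfolding refines_def Q_def by blast
  show "card P = Suc (card Q)" using P_eq union_notin by (simp add: Q_def)
  have "finite A" "finite B" using finite_partition_element[OF partition] clusters by blast+
  then have "spread c Q \<le> diameter (c ` A) + diameter (c ` B) + l + spread c R"
    using union_notin P_eq(4) diameter_image_Un_le[of A B x y c l] link
    by (simp add: spread_def Q_def)
  also have "\<dots> = spread c P + l" using P_eq by (simp add: spread_def)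
  finally show "spread c Q \<le> spread c P + l" .
qed

lemma merge_close_clusters:
  assumes partition: "finite X" "partition_on X P"
  shows "\<exists>P'. refines X P P' \<and> separated c l P' \<and>
    spread c P' \<le> spread c P + l * (real (card P) - real (card P'))"
  using partition(2)
proof (induction "card P" arbitrary: P rule: less_induct)
  case less
  show ?case
  proof (cases "separated c l P")
    case True
    then show ?thesis using less.prems refines_refl by (intro exI[of _ P]) auto
  next
    case False
    then obtain A B x y where "A \<in> P" "B \<in> P" "A \<noteq> B" "x \<in> A" "y \<in> B" "dist (c x) (c y) \<le> l"
      unfolding separated_def by (auto simp: not_less)
    from merge_two_clusters[OF partition(1) less.prems this] obtain Q where
      merged: "refines X P Q" "card P = Suc (card Q)" "spread c Q \<le> spread c P + l" by blast
    then have "partition_on X Q" by (simp add: refines_def)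
    then obtain P' where refined: "refines X Q P'" "separated c l P'"
        "spread c P' \<le> spread c Q + l * (real (card Q) - real (card P'))"
      using less.hyps[of Q] merged(2) by auto
    moreover have "spread c P' \<le> spread c P + l * (real (card P) - real (card P'))"
      using refined(3) merged(2,3) by (simp add: algebra_simps)
    ultimately show ?thesis using refines_trans[OF merged(1)] by blast
  qed
qed

lemma exists_cluster_hierarchy:
  assumes partition: "finite X" "partition_on X P\<^sub>0"
  obtains P where "\<And>k. refines X (P k) (P (Suc k))" "\<And>k. separated c (l * 2 ^ k) (P k)"
    "spread c (P 0) \<le> spread c P\<^sub>0 + l * (real (card P\<^sub>0) - real (card (P 0)))"
    "\<And>k. spread c (P (Suc k))
      \<le> spread c (P k) + l * 2 ^ Suc k * (real (card (P k)) - real (card (P (Suc k))))"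
proof -
  define level where "level k Q \<longleftrightarrow> partition_on X Q \<and> separated c (l * 2 ^ k) Q \<and>
    (k = 0 \<longrightarrow> spread c Q \<le> spread c P\<^sub>0 + l * (real (card P\<^sub>0) - real (card Q)))" for k Q
  define step where "step k Q Q' \<longleftrightarrow> refines X Q Q' \<and>
    spread c Q' \<le> spread c Q + l * 2 ^ Suc k * (real (card Q) - real (card Q'))" for k Q Q'
  have "\<exists>P. \<forall>k. level k (P k) \<and> step k (P k) (P (Suc k))"
  proof (rule dependent_nat_choice)
    show "\<exists>Q. level 0 Q"
      using merge_close_clusters[OF partition, of c l] by (auto simp: level_def refines_def)
    show "\<exists>Q'. level (Suc k) Q' \<and> step k Q Q'" if "level k Q" for Q k
      using merge_close_clusters[OF partition(1), of Q c "l * 2 ^ Suc k"] that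
      by (auto simp: level_def step_def refines_def)
  qed
  then obtain P where "\<And>k. level k (P k)" "\<And>k. step k (P k) (P (Suc k))" by blast
  then show thesis by (intro that[of P]) (auto simp: level_def step_def)
qed

lemma exists_positive_cluster:
  fixes b :: "'a \<Rightarrow> real"
  assumes "finite X" "partition_on X P" "0 < sum b X"
  shows "\<exists>A\<in>P. 0 < sum b A"
proof (rule ccontr)
  assume "\<not> ?thesis"
  then have "(\<Sum>A\<in>P. sum b A) \<le> 0"
    by (intro sum_nonpos[of P "sum b"]) (auto simp: not_less)
  then show False using assms sum.partition[OF assms(1,2), of b] by simp
qed

lemma exists_positive_branch:
  fixes b :: "'a \<Rightarrow> real"
  assumes positive: "finite X" "0 < sum b X" and refines: "\<And>k. refines X (P k) (P (Suc k))"
  shows "\<exists>x\<in>X. \<forall>k. \<exists>A\<in>P k. x \<in> A \<and> 0 < sum b A"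
proof -
  have part: "partition_on X (P k)" for k using refines[of k] by (simp add: refines_def)
  have descend: "\<exists>x\<in>A. \<forall>k\<le>K. \<exists>A\<in>P k. x \<in> A \<and> 0 < sum b A" if "A \<in> P K" "0 < sum b A" for K A
    using that
  proof (induction K arbitrary: A)
    case 0
    then have "A \<noteq> {}" by auto
    then show ?case using 0 by auto
  next
    case (Suc K)
    have "finite A" by (rule finite_partition_element[OF positive(1) part Suc.prems(1)])
    from exists_positive_cluster[OF this
        refines_obtains_subset[OF refines Suc.prems(1)] Suc.prems(2)]
    obtain B where child: "B \<in> P K" "B \<subseteq> A" "0 < sum b B" by blast
    obtain x where "x \<in> B" "\<forall>k\<le>K. \<exists>A\<in>P k. x \<in> A \<and> 0 < sum b A" using Suc.IH[OF child(1,3)] ..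
    then show ?case using child(2) Suc.prems by (intro bexI[of _ x]) (auto simp: le_Suc_eq)
  qed
  have branch_upto: "\<exists>x\<in>X. \<forall>k\<le>K. \<exists>A\<in>P k. x \<in> A \<and> 0 < sum b A" for K
  proof -
    obtain A where positive_cluster: "A \<in> P K" "0 < sum b A"
      using exists_positive_cluster[OF positive(1) part positive(2)] by blast
    then have "A \<subseteq> X" using part[of K] by (auto simp: partition_on_def)
    then show ?thesis using descend[OF positive_cluster] by blast
  qed
  show ?thesis
  proof (rule ccontr)
    assume "\<not> ?thesis"
    then obtain k where lost_branch: "\<And>x. x \<in> X \<Longrightarrow> \<not> (\<exists>A\<in>P (k x). x \<in> A \<and> 0 < sum b A)" by metis
    obtain x where branch: "x \<in> X" "\<forall>j\<le>Max (k ` X). \<exists>A\<in>P j. x \<in> A \<and> 0 < sum b A"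
      using branch_upto ..
    moreover have "k x \<le> Max (k ` X)" using branch(1) positive(1) by simp
    ultimately show False using lost_branch[OF branch(1)] by blast
  qed
qed

lemma card_large_terms_le:
  fixes a n :: "nat \<Rightarrow> real"
  assumes nonneg: "\<And>k. 0 \<le> a k" "\<And>k. 0 \<le> n k"
    and start: "a 0 \<le> 2 * m - n 0" and step: "\<And>k. a (Suc k) \<le> a k / 2 + (n k - n (Suc k))"
  shows "real (card {k. k \<le> K \<and> 1/4 < a k}) \<le> 16 * m"
proof -
  have "(\<Sum>k\<le>K. a k) + a K + 2 * n K \<le> 4 * m"
  proof (induction K)
    case 0
    then show ?case using start by simp
  next
    case (Suc K)
    then show ?case using step[of K] by simp
  qed
  then have sum_le: "(\<Sum>k\<le>K. a k) \<le> 4 * m" using nonneg(1)[of K] nonneg(2)[of K] by linarith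
  have "real (card {k. k \<le> K \<and> 1/4 < a k}) * (1/4) = (\<Sum>k | k \<le> K \<and> 1/4 < a k. 1/4)" by simp
  also have "\<dots> \<le> (\<Sum>k | k \<le> K \<and> 1/4 < a k. a k)" by (intro sum_mono) auto
  also have "\<dots> \<le> (\<Sum>k\<le>K. a k)" using nonneg(1) by (intro sum_mono2) auto
  finally show ?thesis using sum_le by simp
qed

lemma isolates_charge_if_spread_le:
  fixes c :: "'a \<Rightarrow> 'b::metric_space"
  assumes partition: "finite X" "partition_on X P" and spread: "spread c P \<le> r"
    and separated: "separated c R P"
    and charged_cluster: "A \<in> P" "x \<in> A" "0 < sum b A"
  shows "isolates_charge c b X (c x) r R"
  unfolding isolates_charge_def
proof (intro exI conjI ballI)
  note finite_cluster = finite_partition_element[OF partition]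
  have diameter_nonneg: "0 \<le> diameter (c ` B)" if "B \<in> P" for B
    using finite_cluster[OF that] by (rule diameter_image_nonneg)
  have "diameter (c ` A) \<le> spread c P"
    unfolding spread_def using charged_cluster(1) finite_elements[OF partition] diameter_nonneg
    by (intro member_le_sum[of A P "\<lambda>A. diameter (c ` A)"]) auto
  then show "dist (c y) (c x) \<le> r" if "y \<in> A" for y
    using dist_le_diameter_image[OF finite_cluster[OF charged_cluster(1)] that
        charged_cluster(2), of c] spread
    by linarith
  show "R < dist (c y) (c x)" if outside: "y \<in> X - A" for y
  proof -
    obtain B where "B \<in> P" "y \<in> B" using partition(2) outside by (auto simp: partition_on_def)
    then show ?thesis using separated charged_cluster outside unfolding separated_def by auto
  qed
  show "A \<subseteq> X" using charged_cluster(1) partition(2) by (auto simp: partition_on_def)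
qed (rule charged_cluster(3))

text \<open>The total relative spread over all scales is bounded by the number of initial clusters,
  because it is halved from one scale to the next except for the cost of mergers.\<close>
theorem exists_charge_isolated_at_most_scales:
  fixes b :: "'a \<Rightarrow> real"
  assumes positive: "finite X" "0 < sum b X" "partition_on X P\<^sub>0"
    and initial_spread: "0 < l" "spread c P\<^sub>0 \<le> l * real (card P\<^sub>0)"
  shows "\<exists>x\<in>X. \<forall>K. real (card {k. k \<le> K \<and>
    \<not> isolates_charge c b X (c x) (l * 2 ^ k / 4) (l * 2 ^ k)})
    \<le> 16 * real (card P\<^sub>0)"
proof -
  obtain P where hierarchy: "\<And>k. refines X (P k) (P (Suc k))" "\<And>k. separated c (l * 2 ^ k) (P k)"
      "spread c (P 0) \<le> spread c P\<^sub>0 + l * (real (card P\<^sub>0) - real (card (P 0)))"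
      "\<And>k. spread c (P (Suc k))
        \<le> spread c (P k) + l * 2 ^ Suc k * (real (card (P k)) - real (card (P (Suc k))))"
    using exists_cluster_hierarchy[OF positive(1,3)] by metis
  obtain x where branch: "x \<in> X" "\<And>k. \<exists>A\<in>P k. x \<in> A \<and> 0 < sum b A"
    using exists_positive_branch[of X b P, OF positive(1,2) hierarchy(1)] by blast
  define rel_spread where "rel_spread k = spread c (P k) / (l * 2 ^ k)" for k
  have part: "partition_on X (P k)" for k using hierarchy(1)[of k] by (simp add: refines_def)
  have "0 \<le> rel_spread k" for k
    unfolding rel_spread_def using initial_spread(1) spread_nonneg[OF positive(1) part[of k], of c]
    by simp
  moreover have "rel_spread 0 \<le> 2 * real (card P\<^sub>0) - real (card (P 0))"
    using hierarchy(3) initial_spread by (simp add: rel_spread_def field_simps)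
  moreover have "rel_spread (Suc k)
      \<le> rel_spread k / 2 + (real (card (P k)) - real (card (P (Suc k))))" for k
    using hierarchy(4)[of k] initial_spread(1) by (simp add: rel_spread_def field_simps)
  ultimately have few_spread: "real (card {k. k \<le> K \<and> 1/4 < rel_spread k})
      \<le> 16 * real (card P\<^sub>0)" for K
    by (intro card_large_terms_le[where n="\<lambda>k. real (card (P k))"]) auto
  have isolated: "isolates_charge c b X (c x) (l * 2 ^ k / 4) (l * 2 ^ k)"
    if "rel_spread k \<le> 1/4" for k
  proof -
    obtain A where "A \<in> P k" "x \<in> A" "0 < sum b A" using branch(2) by blast
    moreover have "spread c (P k) \<le> l * 2 ^ k / 4"
      using that initial_spread(1) by (simp add: rel_spread_def field_simps)
    ultimately show ?thesis
      using isolates_charge_if_spread_le[OF positive(1) part] hierarchy(2) by blast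
  qed
  have "real (card {k. k \<le> K \<and> \<not> isolates_charge c b X (c x) (l * 2 ^ k / 4) (l * 2 ^ k)})
      \<le> real (card {k. k \<le> K \<and> 1/4 < rel_spread k})" for K
    using isolated by (intro of_nat_mono card_mono Collect_mono) (auto simp: not_le[symmetric])
  then show ?thesis using branch(1) few_spread order_trans by blast
qed

section \<open>Transfinite interpolation on a square grid\<close>

definition dx :: "(nat \<Rightarrow> nat \<Rightarrow> real) \<Rightarrow> nat \<Rightarrow> nat \<Rightarrow> real" where
  "dx f i j = f (Suc i) j - f i j"

definition dy :: "(nat \<Rightarrow> nat \<Rightarrow> real) \<Rightarrow> nat \<Rightarrow> nat \<Rightarrow> real" where
  "dy f i j = f i (Suc j) - f i j"

definition boundary_sum :: "nat \<Rightarrow> (nat \<Rightarrow> nat \<Rightarrow> real) \<Rightarrow> (nat \<Rightarrow> nat \<Rightarrow> real) \<Rightarrow> real" where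
  "boundary_sum n h v = (\<Sum>i<n. h i 0) + (\<Sum>i<n. h i n) + (\<Sum>j<n. v 0 j) + (\<Sum>j<n. v n j)"

text \<open>The Coons patch: the sum of the two linear interpolations between opposite sides of the square
  minus the bilinear interpolation of the corners. Only the boundary values of \<open>f\<close> enter.\<close>
definition coons :: "nat \<Rightarrow> (nat \<Rightarrow> nat \<Rightarrow> real) \<Rightarrow> nat \<Rightarrow> nat \<Rightarrow> real" where
  "coons n f i j = (let t = real i / real n; u = real j / real n in
     (1 - u) * f i 0 + u * f i n + (1 - t) * f 0 j + t * f n j
     - ((1 - t) * (1 - u) * f 0 0 + t * (1 - u) * f n 0 + (1 - t) * u * f 0 n + t * u * f n n))"

lemma coons_transpose: "coons n (\<lambda>i j. f j i) i j = coons n f j i"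
  by (simp add: coons_def Let_def algebra_simps)

lemma coons_boundary:
  assumes "0 < n" "i \<in> {0, n} \<or> j \<in> {0, n}" shows "coons n f i j = f i j"
  using assms by (auto simp: coons_def Let_def algebra_simps)

lemma boundary_sum_transpose: "boundary_sum n (\<lambda>i j. v j i) (\<lambda>i j. h j i) = boundary_sum n h v"
  by (simp add: boundary_sum_def)

lemma boundary_sum_nonneg:
  assumes "\<And>i j. 0 \<le> h i j" "\<And>i j. 0 \<le> v i j" shows "0 \<le> boundary_sum n h v"
  unfolding boundary_sum_def using assms by (intro add_nonneg_nonneg sum_nonneg) auto

lemma square_boundary_sum_abs_le:
  "(boundary_sum n (\<lambda>i j. \<bar>h i j\<bar>) (\<lambda>i j. \<bar>v i j\<bar>))\<^sup>2
    \<le> 4 * (real n * boundary_sum n (\<lambda>i j. (h i j)\<^sup>2) (\<lambda>i j. (v i j)\<^sup>2))"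
proof -
  have side: "(\<Sum>i<n. \<bar>g i\<bar>)\<^sup>2 \<le> real n * (\<Sum>i<n. (g i)\<^sup>2)" for g :: "nat \<Rightarrow> real"
    using sum_squared_le_sum_of_squares[of "\<lambda>i. \<bar>g i\<bar>" "{..<n}"] by (simp add: mult.commute)
  have four_squares: "(a + b + c + d)\<^sup>2 \<le> 4 * (a\<^sup>2 + b\<^sup>2 + c\<^sup>2 + d\<^sup>2)" for a b c d :: real
    using zero_le_power2[of "a - b"] zero_le_power2[of "a - c"] zero_le_power2[of "a - d"]
      zero_le_power2[of "b - c"] zero_le_power2[of "b - d"] zero_le_power2[of "c - d"]
    by (simp add: power2_eq_square algebra_simps)
  have "(boundary_sum n (\<lambda>i j. \<bar>h i j\<bar>) (\<lambda>i j. \<bar>v i j\<bar>))\<^sup>2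
      \<le> 4 * ((\<Sum>i<n. \<bar>h i 0\<bar>)\<^sup>2 + (\<Sum>i<n. \<bar>h i n\<bar>)\<^sup>2 + (\<Sum>j<n. \<bar>v 0 j\<bar>)\<^sup>2 + (\<Sum>j<n. \<bar>v n j\<bar>)\<^sup>2)"
    unfolding boundary_sum_def by (rule four_squares)
  also have "\<dots> \<le> 4 * (real n * boundary_sum n (\<lambda>i j. (h i j)\<^sup>2) (\<lambda>i j. (v i j)\<^sup>2))"
    unfolding boundary_sum_def distrib_left by (intro add_mono mult_left_mono side) auto
  finally show ?thesis .
qed

lemma abs_diff_le_variation:
  fixes f :: "nat \<Rightarrow> real"
  assumes "j \<le> n" shows "\<bar>f j - f 0\<bar> \<le> (\<Sum>i<n. \<bar>f (Suc i) - f i\<bar>)"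
proof -
  have "\<bar>f j - f 0\<bar> = \<bar>\<Sum>i<j. f (Suc i) - f i\<bar>" by (simp add: sum_lessThan_telescope)
  also have "\<dots> \<le> (\<Sum>i<j. \<bar>f (Suc i) - f i\<bar>)" by (rule sum_abs)
  also have "\<dots> \<le> (\<Sum>i<n. \<bar>f (Suc i) - f i\<bar>)" using assms by (intro sum_mono2) auto
  finally show ?thesis .
qed

lemma abs_dx_coons_le:
  assumes size: "0 < n" "j \<le> n"
  shows "\<bar>dx (coons n f) i j\<bar> \<le> \<bar>dx f i 0\<bar> + \<bar>dx f i n\<bar>
    + 2 * (boundary_sum n (\<lambda>i j. \<bar>dx f i j\<bar>) (\<lambda>i j. \<bar>dy f i j\<bar>) / real n)"
proof -
  define V where "V = boundary_sum n (\<lambda>i j. \<bar>dx f i j\<bar>) (\<lambda>i j. \<bar>dy f i j\<bar>)"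
  define u where "u = real j / real n"
  have weight: "0 \<le> u" "u \<le> 1" using size by (auto simp: u_def)
  define drift where "drift = (f n j - f 0 j) - ((1 - u) * (f n 0 - f 0 0) + u * (f n n - f 0 n))"
  have dx_coons: "dx (coons n f) i j = ((1 - u) * dx f i 0 + u * dx f i n) + drift / real n"
    using size unfolding coons_def dx_def Let_def u_def[symmetric] drift_def
    by (simp add: field_simps)
  have sides: "0 \<le> (\<Sum>i<n. \<bar>dx f i 0\<bar>)" "0 \<le> (\<Sum>i<n. \<bar>dx f i n\<bar>)"
    "0 \<le> (\<Sum>j<n. \<bar>dy f 0 j\<bar>)" "0 \<le> (\<Sum>j<n. \<bar>dy f n j\<bar>)"
    by (simp_all add: sum_nonneg)
  have ends: "\<bar>f n 0 - f 0 0\<bar> \<le> V" "\<bar>f n n - f 0 n\<bar> \<le> V" "\<bar>f n j - f 0 j\<bar> \<le> V"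
    using abs_diff_le_variation[of n n "\<lambda>i. f i 0"] abs_diff_le_variation[of n n "\<lambda>i. f i n"]
      abs_diff_le_variation[OF size(2), of "f 0"] abs_diff_le_variation[OF size(2), of "f n"] sides
    unfolding V_def boundary_sum_def dx_def dy_def by linarith+
  have "\<bar>(1 - u) * (f n 0 - f 0 0) + u * (f n n - f 0 n)\<bar> \<le> (1 - u) * V + u * V"
    using weight ends
    by (intro order_trans[OF abs_triangle_ineq] add_mono)
      (auto simp: abs_mult intro: mult_left_mono)
  then have "\<bar>drift\<bar> \<le> 2 * V" using ends(3) unfolding drift_def by (simp add: algebra_simps)
  then have "\<bar>drift / real n\<bar> \<le> 2 * (V / real n)" using size by (simp add: field_simps)
  moreover have "\<bar>(1 - u) * dx f i 0\<bar> \<le> 1 * \<bar>dx f i 0\<bar>" "\<bar>u * dx f i n\<bar> \<le> 1 * \<bar>dx f i n\<bar>"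
    using weight unfolding abs_mult by (intro mult_right_mono; simp)+
  ultimately show ?thesis unfolding dx_coons V_def[symmetric] by linarith
qed

lemma square_dx_coons_le:
  assumes size: "0 < n" "j \<le> n"
  shows "(dx (coons n f) i j)\<^sup>2 \<le> 3 * ((dx f i 0)\<^sup>2 + (dx f i n)\<^sup>2)
    + 48 * (boundary_sum n (\<lambda>i j. (dx f i j)\<^sup>2) (\<lambda>i j. (dy f i j)\<^sup>2) / real n)"
proof -
  define V where "V = boundary_sum n (\<lambda>i j. \<bar>dx f i j\<bar>) (\<lambda>i j. \<bar>dy f i j\<bar>)"
  have three_squares: "(a + b + c)\<^sup>2 \<le> 3 * (a\<^sup>2 + b\<^sup>2) + 3 * c\<^sup>2" for a b c :: real
    using zero_le_power2[of "a - b"] zero_le_power2[of "a - c"] zero_le_power2[of "b - c"]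
    by (simp add: power2_eq_square algebra_simps)
  have "(dx (coons n f) i j)\<^sup>2 \<le> (\<bar>dx f i 0\<bar> + \<bar>dx f i n\<bar> + 2 * (V / real n))\<^sup>2"
    using abs_dx_coons_le[OF assms, of f i] unfolding V_def
    by (rule abs_le_square_iff[THEN iffD1, OF order_trans]) simp
  also have "\<dots> \<le> 3 * (\<bar>dx f i 0\<bar>\<^sup>2 + \<bar>dx f i n\<bar>\<^sup>2) + 3 * (2 * (V / real n))\<^sup>2"
    by (rule three_squares)
  also have "\<dots> = 3 * ((dx f i 0)\<^sup>2 + (dx f i n)\<^sup>2) + 12 * V\<^sup>2 / (real n)\<^sup>2"
    by (simp add: power_divide power_mult_distrib)
  also have "12 * V\<^sup>2 / (real n)\<^sup>2
      \<le> 12 * (4 * (real n * boundary_sum n (\<lambda>i j. (dx f i j)\<^sup>2) (\<lambda>i j. (dy f i j)\<^sup>2))) / (real n)\<^sup>2"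
    unfolding V_def by (intro divide_right_mono mult_left_mono square_boundary_sum_abs_le) auto
  also have "\<dots> = 48 * (boundary_sum n (\<lambda>i j. (dx f i j)\<^sup>2) (\<lambda>i j. (dy f i j)\<^sup>2) / real n)"
    using size(1) by (simp add: power2_eq_square)
  finally show ?thesis by simp
qed

lemma sum_square_dx_coons_le:
  assumes n_pos: "0 < n"
  shows "(\<Sum>i<n. \<Sum>j\<le>n. (dx (coons n f) i j)\<^sup>2)
    \<le> 102 * real n * boundary_sum n (\<lambda>i j. (dx f i j)\<^sup>2) (\<lambda>i j. (dy f i j)\<^sup>2)"
proof -
  define \<rho> where "\<rho> = boundary_sum n (\<lambda>i j. (dx f i j)\<^sup>2) (\<lambda>i j. (dy f i j)\<^sup>2)"
  define \<sigma> where "\<sigma> = (\<Sum>i<n. (dx f i 0)\<^sup>2) + (\<Sum>i<n. (dx f i n)\<^sup>2)"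
  have "\<sigma> \<le> \<rho>" unfolding \<sigma>_def \<rho>_def boundary_sum_def by (simp add: sum_nonneg)
  have "0 \<le> \<rho>" unfolding \<rho>_def by (rule boundary_sum_nonneg) simp_all
  have "(\<Sum>i<n. \<Sum>j\<le>n. (dx (coons n f) i j)\<^sup>2)
      \<le> (\<Sum>i<n. \<Sum>j\<le>n. 3 * ((dx f i 0)\<^sup>2 + (dx f i n)\<^sup>2) + 48 * (\<rho> / real n))"
    unfolding \<rho>_def by (intro sum_mono square_dx_coons_le n_pos) simp
  also have "\<dots> = (real n + 1) * (3 * \<sigma> + real n * (48 * (\<rho> / real n)))"
    by (simp add: \<sigma>_def sum.distrib distrib_left add.commute flip: sum_distrib_left)
  also have "real n * (48 * (\<rho> / real n)) = 48 * \<rho>" using n_pos by simp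
  also have "(real n + 1) * (3 * \<sigma> + 48 * \<rho>) \<le> (2 * real n) * (3 * \<rho> + 48 * \<rho>)"
    using n_pos \<open>\<sigma> \<le> \<rho>\<close> \<open>0 \<le> \<rho>\<close> by (intro mult_mono) (auto simp: \<sigma>_def sum_nonneg)
  finally show ?thesis by (simp add: \<rho>_def)
qed

lemma sum_square_dy_coons_le:
  assumes n_pos: "0 < n"
  shows "(\<Sum>i\<le>n. \<Sum>j<n. (dy (coons n f) i j)\<^sup>2)
    \<le> 102 * real n * boundary_sum n (\<lambda>i j. (dx f i j)\<^sup>2) (\<lambda>i j. (dy f i j)\<^sup>2)"
proof -
  have transpose: "dx (coons n (\<lambda>i j. f j i)) j i = dy (coons n f) i j"
    "dx (\<lambda>i j. f j i) j i = dy f i j"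
    "dy (\<lambda>i j. f j i) j i = dx f i j" for i j
    by (simp_all only: dx_def dy_def coons_transpose[of n f])
  have "(\<Sum>i\<le>n. \<Sum>j<n. (dy (coons n f) i j)\<^sup>2) = (\<Sum>j<n. \<Sum>i\<le>n. (dx (coons n (\<lambda>i j. f j i)) j i)\<^sup>2)"
    unfolding transpose by (rule sum.swap)
  also have "\<dots> \<le> 102 * real n * boundary_sum n (\<lambda>i j. (dy f j i)\<^sup>2) (\<lambda>i j. (dx f j i)\<^sup>2)"
    using sum_square_dx_coons_le[OF n_pos, of "\<lambda>i j. f j i"] unfolding transpose .
  also have "boundary_sum n (\<lambda>i j. (dy f j i)\<^sup>2) (\<lambda>i j. (dx f j i)\<^sup>2)
      = boundary_sum n (\<lambda>i j. (dx f i j)\<^sup>2) (\<lambda>i j. (dy f i j)\<^sup>2)"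
    by (rule boundary_sum_transpose)
  finally show ?thesis .
qed

lemma coons_energy_le:
  assumes n_pos: "0 < n"
  shows "(\<Sum>i<n. \<Sum>j\<le>n. (dx (coons n f) i j)\<^sup>2) + (\<Sum>i\<le>n. \<Sum>j<n. (dy (coons n f) i j)\<^sup>2)
    \<le> 204 * (real n * boundary_sum n (\<lambda>i j. (dx f i j)\<^sup>2) (\<lambda>i j. (dy f i j)\<^sup>2))"
  using sum_square_dx_coons_le[OF n_pos, of f] sum_square_dy_coons_le[OF n_pos, of f] by simp

lemma path_sum_Ints:
  fixes f a :: "nat \<Rightarrow> real"
  assumes "\<And>i. f (Suc i) - f i - a i \<in> \<int>"
  shows "f 0 + (\<Sum>i<n. a i) - f n \<in> \<int>"
proof (induction n)
  case (Suc n)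
  have "f 0 + (\<Sum>i<Suc n. a i) - f (Suc n) = (f 0 + (\<Sum>i<n. a i) - f n) - (f (Suc n) - f n - a n)"
    by simp
  then show ?case using Suc assms[of n] by (simp only: Ints_diff)
qed simp

text \<open>The discrepancy at the fourth corner of the lift along the boundary is an integer, and it
  vanishes because the increments are small.\<close>
lemma exists_boundary_lift:
  fixes w h v :: "nat \<Rightarrow> nat \<Rightarrow> real"
  assumes n_pos: "0 < n" and horizontal: "\<And>i j. dx w i j - h i j \<in> \<int>"
    and vertical: "\<And>i j. dy w i j - v i j \<in> \<int>"
    and small: "boundary_sum n (\<lambda>i j. \<bar>h i j\<bar>) (\<lambda>i j. \<bar>v i j\<bar>) < 1"
  obtains f where "\<And>i j. i \<in> {0, n} \<or> j \<in> {0, n} \<Longrightarrow> f i j - w i j \<in> \<int>"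
    "\<And>i. dx f i 0 = h i 0" "\<And>i. dx f i n = h i n" "\<And>j. dy f 0 j = v 0 j" "\<And>j. dy f n j = v n j"
proof -
  define bottom where "bottom i = w 0 0 + (\<Sum>k<i. h k 0)" for i
  define left where "left j = w 0 0 + (\<Sum>k<j. v 0 k)" for j
  define top_side where "top_side i = left n + (\<Sum>k<i. h k n)" for i
  define right where "right j = bottom n + (\<Sum>k<j. v n k)" for j
  have bottom: "bottom i - w i 0 \<in> \<int>" for i
    unfolding bottom_def using horizontal
    by (intro path_sum_Ints[of "\<lambda>i. w i 0"]) (simp add: dx_def)
  have left: "left j - w 0 j \<in> \<int>" for j
    unfolding left_def using vertical by (intro path_sum_Ints[of "w 0"]) (simp add: dy_def)
  have top_side: "top_side i - w i n \<in> \<int>" for i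
    using Ints_add[OF left[of n] path_sum_Ints[of "\<lambda>i. w i n" "\<lambda>i. h i n" i]] horizontal
    by (simp add: top_side_def dx_def algebra_simps)
  have right: "right j - w n j \<in> \<int>" for j
    using Ints_add[OF bottom[of n] path_sum_Ints[of "w n" "v n" j]] vertical
    by (simp add: right_def dy_def algebra_simps)
  have "right n - top_side n \<in> \<int>"
    using Ints_diff[OF right[of n] top_side[of n]] by simp
  moreover have "\<bar>right n - top_side n\<bar> < 1"
    using small sum_abs[of "\<lambda>k. h k 0" "{..<n}"] sum_abs[of "\<lambda>k. h k n" "{..<n}"]
      sum_abs[of "v 0" "{..<n}"] sum_abs[of "v n" "{..<n}"]
    unfolding right_def top_side_def bottom_def left_def boundary_sum_def by linarith
  ultimately have "right n - top_side n = 0" by (rule Ints_nonzero_abs_less1)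
  then have corner: "right n = top_side n" by simp
  define f where "f i j = (if j = 0 then bottom i else if j = n then top_side i
      else if i = 0 then left j else right j)" for i j
  have f_boundary: "f i 0 = bottom i" "f i n = top_side i" "f 0 j = left j"
    "f n j = right j" for i j
    using n_pos corner by (auto simp: f_def bottom_def left_def top_side_def right_def)
  show thesis
  proof (rule that[of f])
    show "f i j - w i j \<in> \<int>" if "i \<in> {0, n} \<or> j \<in> {0, n}" for i j
      using that bottom left top_side right by (auto simp: f_boundary)
  qed (simp_all only: dx_def dy_def f_boundary, simp_all add: bottom_def left_def top_side_def
    right_def)
qed

section \<open>Bounds for the pair potential\<close>

lemma cubic_upper_near_0:
  assumes smooth: "C4_on S f" and radius: "0 < r" "{-r..r} \<subseteq> S"
    and minimum: "f 0 = 0" "\<And>x. \<bar>x\<bar> \<le> r \<Longrightarrow> 0 \<le> f x"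
  shows "\<exists>C>0. \<forall>x. \<bar>x\<bar> \<le> r \<longrightarrow> f x \<le> (deriv ^^ 2) f 0 / 2 * x\<^sup>2 + C * \<bar>x\<bar> ^ 3"
proof -
  define d where "d k = (deriv ^^ k) f" for k
  have d_0: "d 0 = f" by (simp add: d_def)
  have deriv: "(d k has_real_derivative d (Suc k) x) (at x)" if "k < 4" "\<bar>x\<bar> \<le> r" for k x
  proof -
    have "x \<in> S" using that(2) by (intro subsetD[OF radius(2)]) auto
    then show ?thesis using smooth that(1) unfolding C4_on_def d_def by blast
  qed
  have d_1: "d 1 0 = 0"
  proof (rule DERIV_local_min)
    show "(f has_real_derivative d 1 0) (at 0)" using deriv[of 0 0] radius(1) by (simp add: d_0)
    show "\<forall>y. \<bar>0 - y\<bar> < r \<longrightarrow> f 0 \<le> f y" using minimum by auto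
  qed (rule radius(1))
  have "continuous_on {-r..r} (d 3)"
    by (intro continuous_at_imp_continuous_on ballI DERIV_isCont[OF deriv]) auto
  then have "bounded (d 3 ` {-r..r})" by (intro compact_imp_bounded compact_continuous_image) auto
  then obtain C where third_bound: "0 < C" "\<And>x. \<bar>x\<bar> \<le> r \<Longrightarrow> \<bar>d 3 x\<bar> \<le> C"
    unfolding bounded_pos by (auto simp: abs_le_iff)
  have "f x \<le> d 2 0 / 2 * x\<^sup>2 + C * \<bar>x\<bar> ^ 3" if small: "\<bar>x\<bar> \<le> r" for x
  proof -
    have "\<exists>t. \<bar>t\<bar> \<le> \<bar>x\<bar> \<and> f x = (\<Sum>m<3. d m 0 / fact m * x ^ m) + d 3 t / fact 3 * x ^ 3"
      by (rule Maclaurin_bi_le) (use deriv small d_0 in auto)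
    then obtain t where between: "\<bar>t\<bar> \<le> \<bar>x\<bar>"
      and taylor: "f x = (\<Sum>m<3. d m 0 / fact m * x ^ m) + d 3 t / fact 3 * x ^ 3" by blast
    have "(\<Sum>m<3. d m 0 / fact m * x ^ m) = d 2 0 / 2 * x\<^sup>2"
      using d_1 minimum(1) by (simp add: d_0 eval_nat_numeral fact_numeral)
    moreover have "\<bar>d 3 t / fact 3 * x ^ 3\<bar> \<le> C * \<bar>x\<bar> ^ 3"
    proof -
      have "\<bar>d 3 t / fact 3\<bar> \<le> C"
        using third_bound(2)[of t] between small by (simp add: fact_numeral)
      then show ?thesis unfolding abs_mult power_abs by (rule mult_right_mono) simp
    qed
    ultimately show ?thesis using taylor by linarith
  qed
  then show ?thesis using third_bound(1) unfolding d_def by blast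
qed

lemma cubic_upper_extend:
  fixes f :: "real \<Rightarrow> real"
  assumes cont: "continuous_on {-b..b} f" and quadratic_nonneg: "0 \<le> q" and radius_pos: "0 < r"
    and near: "0 < C" "\<And>x. \<bar>x\<bar> \<le> r \<Longrightarrow> f x \<le> q * x\<^sup>2 + C * \<bar>x\<bar> ^ 3"
  shows "\<exists>K>0. \<forall>x. \<bar>x\<bar> \<le> b \<longrightarrow> f x \<le> q * x\<^sup>2 + K * \<bar>x\<bar> ^ 3"
proof -
  have "bounded (f ` {-b..b})"
    using cont by (intro compact_imp_bounded compact_continuous_image) auto
  then obtain M where sup_bound: "0 < M" "\<And>x. \<bar>x\<bar> \<le> b \<Longrightarrow> \<bar>f x\<bar> \<le> M"
    unfolding bounded_pos by (auto simp: abs_le_iff)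
  have "f x \<le> q * x\<^sup>2 + (C + M / r ^ 3) * \<bar>x\<bar> ^ 3" if in_range: "\<bar>x\<bar> \<le> b" for x
  proof (cases "\<bar>x\<bar> \<le> r")
    case True
    have "f x \<le> q * x\<^sup>2 + C * \<bar>x\<bar> ^ 3" by (rule near(2)[OF True])
    also have "\<dots> \<le> q * x\<^sup>2 + (C + M / r ^ 3) * \<bar>x\<bar> ^ 3"
      using sup_bound(1) radius_pos by (intro add_left_mono mult_right_mono) auto
    finally show ?thesis .
  next
    case False
    have "f x \<le> M / r ^ 3 * r ^ 3" using sup_bound(2)[OF in_range] radius_pos by auto
    also have "\<dots> \<le> M / r ^ 3 * \<bar>x\<bar> ^ 3"
      using False sup_bound(1) radius_pos by (intro mult_left_mono power_mono) auto
    also have "\<dots> \<le> (C + M / r ^ 3) * \<bar>x\<bar> ^ 3" using near(1) by (intro mult_right_mono) auto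
    also have "\<dots> \<le> q * x\<^sup>2 + (C + M / r ^ 3) * \<bar>x\<bar> ^ 3" using quadratic_nonneg by simp
    finally show ?thesis .
  qed
  moreover have "0 < C + M / r ^ 3" using near(1) sup_bound(1) radius_pos by (simp add: add_pos_pos)
  ultimately show ?thesis by blast
qed

lemma quadratic_upper_if_periodic:
  fixes f :: "real \<Rightarrow> real"
  assumes periodic: "\<And>x. f (x + 1) = f x" and nonneg: "0 \<le> q" "0 \<le> K"
    and cubic: "\<And>x. \<bar>x\<bar> \<le> 1/2 \<Longrightarrow> f x \<le> q * x\<^sup>2 + K * \<bar>x\<bar> ^ 3"
  shows "f x \<le> (q + K) * x\<^sup>2"
proof -
  interpret periodic_fun_simple' f by standard (rule periodic)
  define w where "w = wrap x"
  have reduced: "\<bar>w\<bar> \<le> 1/2" "\<bar>w\<bar> \<le> \<bar>x\<bar>"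
    using abs_wrap_le[of x] round_diff_minimal[of x 0] by (simp_all add: w_def wrap_def)
  have "f x = f w" using plus_of_int[of w "round x"] by (simp add: w_def wrap_def)
  also have "\<dots> \<le> q * w\<^sup>2 + K * \<bar>w\<bar> ^ 3" by (rule cubic[OF reduced(1)])
  also have "\<dots> \<le> q * w\<^sup>2 + K * \<bar>w\<bar>\<^sup>2"
    using nonneg reduced(1) by (intro add_left_mono mult_left_mono power_decreasing) auto
  also have "\<dots> = (q + K) * w\<^sup>2" by (simp add: algebra_simps)
  also have "\<dots> \<le> (q + K) * x\<^sup>2"
    using nonneg reduced(2) by (intro mult_left_mono) (auto simp: abs_le_square_iff)
  finally show ?thesis .
qed

section \<open>Discrete calculus on the triangular lattice\<close>

datatype dir = E0 | E1 | E2

lemma UNIV_dir: "(UNIV :: dir set) = {E0, E1, E2}"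
  using dir.exhaust by auto

instance dir :: finite
  by standard (simp add: UNIV_dir)

text \<open>The triangle \<open>(x, True)\<close> has the vertices \<open>x\<close>, \<open>x + (1, 0)\<close>, \<open>x + (0, 1)\<close>, and \<open>(x, False)\<close> is
  its mirror image with the vertex \<open>x + (1, 1)\<close> instead of \<open>x\<close>. Every unoriented bond is
  represented by exactly one edge \<open>(x, d)\<close>; the edge \<open>(x, E2)\<close> is the side of \<open>(x, True)\<close> opposite
  to \<open>x\<close>.\<close>

type_synonym edge = "lpt \<times> dir"
type_synonym tri = "lpt \<times> bool"

fun src :: "edge \<Rightarrow> lpt" where
  "src (x, E0) = x"
| "src (x, E1) = x"
| "src (x, E2) = x + (1, 0)"

fun tgt :: "edge \<Rightarrow> lpt" where
  "tgt (x, E0) = x + (1, 0)"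
| "tgt (x, E1) = x + (0, 1)"
| "tgt (x, E2) = x + (0, 1)"

fun left_tri :: "edge \<Rightarrow> tri" where
  "left_tri (x, E0) = (x, True)"
| "left_tri (x, E1) = (x - (1, 0), False)"
| "left_tri (x, E2) = (x, True)"

fun right_tri :: "edge \<Rightarrow> tri" where
  "right_tri (x, E0) = (x - (0, 1), False)"
| "right_tri (x, E1) = (x, True)"
| "right_tri (x, E2) = (x, False)"

fun sides :: "tri \<Rightarrow> edge set" where
  "sides (x, True) = {(x, E0), (x, E1), (x, E2)}"
| "sides (x, False) = {(x + (1, 0), E1), (x + (0, 1), E0), (x, E2)}"

fun curl :: "(edge \<Rightarrow> real) \<Rightarrow> tri \<Rightarrow> real" where
  "curl a (x, True) = a (x, E0) + a (x, E2) - a (x, E1)"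
| "curl a (x, False) = a (x + (1, 0), E1) - a (x + (0, 1), E0) - a (x, E2)"

definition grad :: "(lpt \<Rightarrow> real) \<Rightarrow> edge \<Rightarrow> real" where
  "grad y e = y (tgt e) - y (src e)"

definition cograd :: "(tri \<Rightarrow> real) \<Rightarrow> edge \<Rightarrow> real" where
  "cograd f e = f (left_tri e) - f (right_tri e)"

definition charged :: "(edge \<Rightarrow> real) \<Rightarrow> tri set" where
  "charged a = {T. curl a T \<noteq> 0}"

definition net_charge :: "(edge \<Rightarrow> real) \<Rightarrow> real" where
  "net_charge a = (\<Sum>T\<in>charged a. curl a T)"

lemma edge_cases [case_names E0 E1 E2]:
  fixes e :: edge
  obtains x where "e = (x, E0)" | x where "e = (x, E1)" | x where "e = (x, E2)"
  by (cases e; cases "snd e") auto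

lemma tri_cases [case_names up down]:
  fixes T :: tri
  obtains x where "T = (x, True)" | x where "T = (x, False)"
  by (cases T; cases "snd T") auto

lemma grad_add: "grad (\<lambda>x. y x + v x) e = grad y e + grad v e"
  by (simp add: grad_def)

lemma curl_grad: "curl (grad y) T = 0"
  by (cases T rule: tri_cases) (auto simp: grad_def add_ac)

lemma curl_diff: "curl (\<lambda>e. a e - b e) T = curl a T - curl b T"
  by (cases T rule: tri_cases) (auto simp: algebra_simps)

lemma curl_Ints:
  assumes "\<And>e. a e \<in> \<int>" shows "curl a T \<in> \<int>"
  by (cases T rule: tri_cases) (use assms in auto)

lemma curl_Ints_congruent:
  assumes "\<And>e. grad y e - a e \<in> \<int>" shows "curl a T \<in> \<int>"
proof -
  have "curl (\<lambda>e. grad y e - a e) T \<in> \<int>" by (rule curl_Ints) (use assms in auto)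
  then show ?thesis by (simp add: curl_diff curl_grad)
qed

lemma finite_sides [simp]: "finite (sides T)" and card_sides: "card (sides T) = 3"
  by (cases T rule: tri_cases; auto)+

lemma bordering_tri:
  assumes "e \<in> sides T" shows "T = left_tri e \<or> T = right_tri e"
  using assms by (cases T rule: tri_cases) auto

lemma abs_curl_le: "\<bar>curl a T\<bar> \<le> (\<Sum>e\<in>sides T. \<bar>a e\<bar>)"
  by (cases T rule: tri_cases) auto

lemma square_curl_le: "(curl a T)\<^sup>2 \<le> 3 * (\<Sum>e\<in>sides T. (a e)\<^sup>2)"
proof -
  have "(curl a T)\<^sup>2 \<le> (\<Sum>e\<in>sides T. \<bar>a e\<bar>)\<^sup>2"
    using abs_curl_le[of a T] by (intro abs_le_square_iff[THEN iffD1]) linarith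
  also have "\<dots> \<le> (\<Sum>e\<in>sides T. \<bar>a e\<bar>\<^sup>2) * card (sides T)"
    by (rule sum_squared_le_sum_of_squares)
  finally show ?thesis by (simp add: card_sides)
qed

lemma curl_eq_sum_borders: "curl a T = (\<Sum>e | left_tri e = T. a e) - (\<Sum>e | right_tri e = T. a e)"
proof (cases T rule: tri_cases)
  case (up x)
  have "{e. left_tri e = T} = {(x, E0), (x, E2)}" "{e. right_tri e = T} = {(x, E1)}"
    unfolding up by (auto elim!: left_tri.elims right_tri.elims)
  then show ?thesis by (simp add: up)
next
  case (down x)
  have "{e. left_tri e = T} = {(x + (1, 0), E1)}"
    "{e. right_tri e = T} = {(x + (0, 1), E0), (x, E2)}"
    unfolding down by (auto elim!: left_tri.elims right_tri.elims)
  then show ?thesis by (simp add: down)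
qed

lemma finite_charged_if_finite_large:
  assumes "\<And>T. curl a T \<in> \<int>" "finite {e. 1/3 \<le> \<bar>a e\<bar>}"
  shows "finite (charged a)"
proof -
  have "T \<in> left_tri ` {e. 1/3 \<le> \<bar>a e\<bar>} \<union> right_tri ` {e. 1/3 \<le> \<bar>a e\<bar>}" if "T \<in> charged a" for T
  proof -
    have "1 \<le> \<bar>curl a T\<bar>"
      using that by (intro Ints_nonzero_abs_ge1 assms(1)) (simp add: charged_def)
    then have "1 \<le> (\<Sum>e\<in>sides T. \<bar>a e\<bar>)" using abs_curl_le[of a T] by linarith
    moreover have "(\<Sum>e\<in>sides T. \<bar>a e\<bar>) < (\<Sum>e\<in>sides T. 1/3)" if "\<forall>e\<in>sides T. \<bar>a e\<bar> < 1/3"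
      using that card_sides[of T] by (intro sum_strict_mono) auto
    ultimately obtain e where "e \<in> sides T" "1/3 \<le> \<bar>a e\<bar>"
      by (fastforce simp: card_sides not_less)
    then show ?thesis using bordering_tri by blast
  qed
  then have "charged a \<subseteq> left_tri ` {e. 1/3 \<le> \<bar>a e\<bar>} \<union> right_tri ` {e. 1/3 \<le> \<bar>a e\<bar>}" by blast
  then show ?thesis by (rule finite_subset) (intro finite_UnI finite_imageI assms(2))
qed

subsection \<open>Boxes\<close>

definition sup_norm :: "lpt \<Rightarrow> int" where
  "sup_norm x = max \<bar>fst x\<bar> \<bar>snd x\<bar>"

definition lattice_box :: "nat \<Rightarrow> lpt set" where
  "lattice_box N = {- int N..int N} \<times> {- int N..int N}"

definition edges :: "nat \<Rightarrow> edge set" where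
  "edges N = lattice_box N \<times> UNIV"

definition tris :: "nat \<Rightarrow> tri set" where
  "tris N = lattice_box N \<times> UNIV"

lemma sup_norm_nonneg [simp]: "0 \<le> sup_norm x"
  by (simp add: sup_norm_def)

lemma sup_norm_0 [simp]: "sup_norm 0 = 0"
  by (simp add: sup_norm_def)

lemma sup_norm_triangle: "sup_norm (x + y) \<le> sup_norm x + sup_norm y"
  and sup_norm_triangle_diff: "sup_norm (x - y) \<le> sup_norm x + sup_norm y"
  by (auto simp: sup_norm_def)

lemma sup_norm_diff_commute: "sup_norm (x - y) = sup_norm (y - x)"
  by (simp add: sup_norm_def abs_minus_commute)

lemma sup_norm_diff_src_tgt: "sup_norm (src e) \<le> sup_norm (tgt e) + 1"
  "sup_norm (tgt e) \<le> sup_norm (src e) + 1"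
  by (cases e rule: edge_cases; auto simp: sup_norm_def)+

lemma sup_norm_src_ge: "sup_norm (fst e) - 1 \<le> sup_norm (src e)"
  by (cases e rule: edge_cases) (auto simp: sup_norm_def)

lemma sup_norm_bordering_tri:
  "sup_norm (fst e) - 1 \<le> sup_norm (fst (left_tri e))"
  "sup_norm (fst e) - 1 \<le> sup_norm (fst (right_tri e))"
  "sup_norm (fst (left_tri e)) \<le> sup_norm (fst e) + 1"
  "sup_norm (fst (right_tri e)) \<le> sup_norm (fst e) + 1"
  by (cases e rule: edge_cases; auto simp: sup_norm_def)+

lemma mem_lattice_box: "x \<in> lattice_box N \<longleftrightarrow> sup_norm x \<le> int N"
  by (cases x) (auto simp: lattice_box_def sup_norm_def)

lemma mem_edges: "e \<in> edges N \<longleftrightarrow> sup_norm (fst e) \<le> int N"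
  by (cases e) (simp add: edges_def mem_lattice_box)

lemma mem_tris: "T \<in> tris N \<longleftrightarrow> sup_norm (fst T) \<le> int N"
  by (cases T) (simp add: tris_def mem_lattice_box)

lemma finite_lattice_box [simp]: "finite (lattice_box N)"
  and finite_edges [simp]: "finite (edges N)"
  and finite_tris [simp]: "finite (tris N)"
  by (simp_all add: lattice_box_def edges_def tris_def)

lemma card_edges: "card (edges N) = 3 * (2 * N + 1)\<^sup>2"
  by (simp add: edges_def lattice_box_def card_cartesian_product UNIV_dir power2_eq_square
      nat_add_distrib nat_mult_distrib)

lemma edges_mono: "M \<le> N \<Longrightarrow> edges M \<subseteq> edges N"
  by (auto simp: mem_edges)

lemma finite_subset_edges:
  assumes "finite S" shows "\<exists>N0. \<forall>N\<ge>N0. S \<subseteq> edges N"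
proof -
  obtain b where bound: "\<forall>e\<in>S. nat (sup_norm (fst e)) \<le> b"
    using finite_nat_set_iff_bounded_le[of "(\<lambda>e. nat (sup_norm (fst e))) ` S"] assms by auto
  have "S \<subseteq> edges N" if "N \<ge> b" for N
    using bound that by (force simp: mem_edges nat_le_iff)
  then show ?thesis by blast
qed

lemma l2_boundedI_edges:
  assumes "\<And>N\<^sub>0. \<exists>N\<ge>N\<^sub>0. (\<Sum>e\<in>edges N. (f e)\<^sup>2) \<le> G" shows "l2_bounded f G"
  unfolding l2_bounded_def
proof (intro allI impI)
  fix S :: "edge set" assume "finite S"
  then obtain N\<^sub>0 where "\<And>N. N\<^sub>0 \<le> N \<Longrightarrow> S \<subseteq> edges N" using finite_subset_edges by blast
  moreover obtain N where "N\<^sub>0 \<le> N" "(\<Sum>e\<in>edges N. (f e)\<^sup>2) \<le> G" using assms by blast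
  ultimately show "(\<Sum>e\<in>S. (f e)\<^sup>2) \<le> G"
    by (intro order_trans[OF sum_mono2[of "edges N" S]]) auto
qed

theorem summation_by_parts:
  assumes const: "\<And>T. T \<notin> tris N \<Longrightarrow> f T = c" and finite_charges: "finite (charged a)"
  shows "(\<Sum>e\<in>edges (Suc N). a e * cograd f e) = (\<Sum>T\<in>charged a. (f T - c) * curl a T)"
proof -
  have collect: "(\<Sum>e\<in>edges (Suc N). a e * (f (h e) - c))
      = (\<Sum>T\<in>tris N. (f T - c) * (\<Sum>e | h e = T. a e))"
    if near_support: "\<And>e. sup_norm (fst e) - 1 \<le> sup_norm (fst (h e))" for h :: "edge \<Rightarrow> tri"
  proof -
    have "e \<in> edges (Suc N)" if "h e \<in> tris N" for e
      using near_support[of e] that by (simp add: mem_edges mem_tris)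
    then have preimage_subset: "{e. h e \<in> tris N} \<subseteq> edges (Suc N)" by blast
    then have finite_preimage: "finite {e. h e \<in> tris N}" by (rule finite_subset) simp
    have "(\<Sum>e\<in>edges (Suc N). a e * (f (h e) - c)) = (\<Sum>e | h e \<in> tris N. a e * (f (h e) - c))"
      by (rule sum.mono_neutral_right) (use preimage_subset const in auto)
    also have "\<dots> = (\<Sum>T\<in>tris N. \<Sum>e | e \<in> {e. h e \<in> tris N} \<and> h e = T. a e * (f (h e) - c))"
      by (rule sum.group[symmetric]) (use finite_preimage in auto)
    also have "\<dots> = (\<Sum>T\<in>tris N. (f T - c) * (\<Sum>e | h e = T. a e))"
      by (intro sum.cong refl) (auto simp: sum_distrib_left mult.commute intro!: sum.cong)
    finally show ?thesis .
  qed
  have "(\<Sum>e\<in>edges (Suc N). a e * cograd f e)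
      = (\<Sum>e\<in>edges (Suc N). a e * (f (left_tri e) - c))
        - (\<Sum>e\<in>edges (Suc N). a e * (f (right_tri e) - c))"
    by (simp add: cograd_def algebra_simps sum_subtractf)
  also have "\<dots> = (\<Sum>T\<in>tris N. (f T - c) * curl a T)"
    unfolding collect[OF sup_norm_bordering_tri(1)] collect[OF sup_norm_bordering_tri(2)]
    by (simp only: curl_eq_sum_borders right_diff_distrib sum_subtractf)
  also have "\<dots> = (\<Sum>T\<in>tris N \<inter> charged a. (f T - c) * curl a T)"
    by (rule sum.mono_neutral_right) (auto simp: charged_def)
  also have "\<dots> = (\<Sum>T\<in>charged a. (f T - c) * curl a T)"
    by (rule sum.mono_neutral_left) (use const finite_charges in auto)
  finally show ?thesis .
qed

subsection \<open>Translations\<close>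

definition shift_edge :: "lpt \<Rightarrow> edge \<Rightarrow> edge" where
  "shift_edge p e = (fst e + p, snd e)"

definition shift_tri :: "lpt \<Rightarrow> tri \<Rightarrow> tri" where
  "shift_tri p T = (fst T + p, snd T)"

lemma fst_shift_edge [simp]: "fst (shift_edge p e) = fst e + p"
  by (simp add: shift_edge_def)

lemma src_shift_edge [simp]: "src (shift_edge p e) = src e + p"
  and tgt_shift_edge [simp]: "tgt (shift_edge p e) = tgt e + p"
  by (cases e rule: edge_cases; simp add: shift_edge_def)+

lemma shift_edge_inverse [simp]:
  "shift_edge p (shift_edge (- p) e) = e" "shift_edge (- p) (shift_edge p e) = e"
  by (simp_all add: shift_edge_def)

lemma shift_tri_inverse [simp]:
  "shift_tri p (shift_tri (- p) T) = T" "shift_tri (- p) (shift_tri p T) = T"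
  by (simp_all add: shift_tri_def)

lemma inj_shift_edge: "inj_on (shift_edge p) S" and inj_shift_tri: "inj_on (shift_tri p) X"
  by (auto simp: inj_on_def shift_edge_def shift_tri_def prod_eq_iff)

lemma finite_subset_shifted_edges:
  assumes "finite S" shows "\<exists>N\<^sub>0. \<forall>N\<ge>N\<^sub>0. S \<subseteq> shift_edge p ` edges N"
proof -
  have "finite (shift_edge (- p) ` S)" using assms by simp
  from finite_subset_edges[OF this] obtain N\<^sub>0 where "\<forall>N\<ge>N\<^sub>0. shift_edge (- p) ` S \<subseteq> edges N" ..
  then have "\<forall>N\<ge>N\<^sub>0. shift_edge p ` shift_edge (- p) ` S \<subseteq> shift_edge p ` edges N"
    by (intro allI impI image_mono) simp
  then show ?thesis by (auto simp: image_image)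
qed

lemma grad_shift: "grad (\<lambda>x. y (x + p)) e = grad y (shift_edge p e)"
  by (simp add: grad_def)

lemma curl_shift: "curl (\<lambda>e. a (shift_edge p e)) T = curl a (shift_tri p T)"
  by (cases T rule: tri_cases) (auto simp: shift_edge_def shift_tri_def add_ac)

lemma charged_shift: "charged (\<lambda>e. a (shift_edge p e)) = shift_tri (- p) ` charged a"
proof (intro equalityI subsetI)
  fix T assume "T \<in> charged (\<lambda>e. a (shift_edge p e))"
  then have "shift_tri p T \<in> charged a" by (simp add: charged_def curl_shift)
  then show "T \<in> shift_tri (- p) ` charged a" by (rule rev_image_eqI) simp
qed (auto simp: charged_def curl_shift)

lemma sum_curl_shift:
  "(\<Sum>T\<in>shift_tri (- p) ` X. curl (\<lambda>e. a (shift_edge p e)) T) = (\<Sum>T\<in>X. curl a T)"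
  by (simp add: curl_shift sum.reindex[OF inj_shift_tri])

subsection \<open>Sums over annuli\<close>

definition radius :: "edge \<Rightarrow> real" where
  "radius e = 1 + of_int (sup_norm (fst e))"

lemma radius_ge_1: "1 \<le> radius e"
  by (simp add: radius_def)

lemma radius_pos [simp]: "0 < radius e"
  using radius_ge_1[of e] by linarith

lemma radius_nonneg [simp]: "0 \<le> radius e" and radius_nonzero [simp]: "radius e \<noteq> 0"
  using radius_pos[of e] by linarith+

lemma radius_gt_if_not_mem_edges: "e \<notin> edges N \<Longrightarrow> real N + 1 < radius e"
  unfolding mem_edges radius_def by linarith

lemma card_sphere_le: "card {e :: edge. sup_norm (fst e) = int n} \<le> 24 * (n + 1)"
proof (cases n)
  case 0
  have "card {e :: edge. sup_norm (fst e) = int n} \<le> card (edges n)"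
    by (intro card_mono) (auto simp: mem_edges)
  then show ?thesis by (simp add: card_edges 0)
next
  case (Suc k)
  have "{e :: edge. sup_norm (fst e) = int n} = edges n - edges k"
    by (auto simp: mem_edges Suc)
  then have "card {e :: edge. sup_norm (fst e) = int n} = 3 * (2 * n + 1)\<^sup>2 - 3 * (2 * k + 1)\<^sup>2"
    by (simp add: card_Diff_subset edges_mono Suc card_edges)
  then show ?thesis by (simp add: Suc power2_eq_square)
qed

lemma sum_sphere_inverse_radius_cube_le:
  assumes "\<And>e. e \<in> S \<Longrightarrow> sup_norm (fst e) = int n"
  shows "(\<Sum>e\<in>S. 1 / (radius e) ^ 3) \<le> 48 / (real n + 1) - 48 / (real (Suc n) + 1)"
proof -
  define r where "r = real n + 1"
  have radius_ge: "1 \<le> r" by (simp add: r_def)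
  have "finite {e :: edge. sup_norm (fst e) = int n}"
    by (rule finite_subset[of _ "edges n"]) (auto simp: mem_edges)
  then have "card S \<le> card {e :: edge. sup_norm (fst e) = int n}"
    using assms by (intro card_mono) auto
  also have "\<dots> \<le> 24 * (n + 1)" by (rule card_sphere_le)
  finally have "real (card S) \<le> real (24 * (n + 1))" by (rule of_nat_mono)
  then have card_le: "real (card S) \<le> 24 * r" by (simp add: r_def add.commute)
  have "(\<Sum>e\<in>S. 1 / (radius e) ^ 3) = real (card S) * (1 / r ^ 3)"
    using assms by (simp add: radius_def r_def add.commute)
  also have "\<dots> \<le> 24 * r * (1 / r ^ 3)" using card_le radius_ge by (intro mult_right_mono) auto
  also have "\<dots> = 48 / (r * (2 * r))" using radius_ge by (simp add: power3_eq_cube)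
  also have "\<dots> \<le> 48 / (r * (r + 1))" using radius_ge by (intro divide_left_mono mult_left_mono) auto
  also have "\<dots> = 48 / r - 48 / (r + 1)" using radius_ge by (simp add: field_simps)
  finally show ?thesis by (simp add: r_def add_ac)
qed

lemma sum_inverse_radius_cube_le:
  assumes "finite S" "0 < r" "\<And>e. e \<in> S \<Longrightarrow> r \<le> radius e"
  shows "(\<Sum>e\<in>S. 1 / (radius e) ^ 3) \<le> 48 / r"
proof -
  define level where "level e = nat (sup_norm (fst e))" for e :: edge
  define k where "k = nat (\<lceil>r\<rceil> - 1)"
  have r_le: "r \<le> real k + 1" using assms(2) unfolding k_def by linarith
  obtain N where box: "S \<subseteq> edges N" "k \<le> N"
    using finite_subset_edges[OF assms(1)] by (meson linorder_le_cases order_refl)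
  have "level e \<in> {k..N}" if "e \<in> S" for e
  proof -
    have "r \<le> real_of_int (sup_norm (fst e)) + 1" using assms(3)[OF that] by (simp add: radius_def)
    moreover have "sup_norm (fst e) \<le> int N" using that box(1) by (auto simp: mem_edges)
    ultimately show ?thesis unfolding atLeastAtMost_iff k_def level_def by linarith
  qed
  then have "(\<Sum>e\<in>S. 1 / (radius e) ^ 3) = (\<Sum>n=k..N. \<Sum>e | e \<in> S \<and> level e = n. 1 / (radius e) ^ 3)"
    using assms(1) by (intro sum.group[symmetric]) auto
  also have "\<dots> \<le> (\<Sum>n=k..N. 48 / (real n + 1) - 48 / (real (Suc n) + 1))"
    by (intro sum_mono sum_sphere_inverse_radius_cube_le) (auto simp: level_def)
  also have "\<dots> = 48 / (real k + 1) - 48 / (real (Suc N) + 1)"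
    using box(2) sum_natinterval_diff[of "\<lambda>n. 48 / (real n + 1)" k N] by simp
  also have "\<dots> \<le> 48 / (real k + 1)" by simp
  also have "\<dots> \<le> 48 / r" using r_le assms(2) by (intro divide_left_mono) auto
  finally show ?thesis .
qed

lemma sum_inverse_radius_square_le:
  assumes "finite S" "0 < r" "r \<le> R" "\<And>e. e \<in> S \<Longrightarrow> r \<le> radius e \<and> radius e \<le> R"
  shows "(\<Sum>e\<in>S. 1 / (radius e)\<^sup>2) \<le> 48 * R / r"
proof -
  have "(\<Sum>e\<in>S. 1 / (radius e)\<^sup>2) \<le> (\<Sum>e\<in>S. R * (1 / (radius e) ^ 3))"
  proof (rule sum_mono)
    fix e assume "e \<in> S"
    have "1 / (radius e)\<^sup>2 = radius e * (1 / (radius e) ^ 3)"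
      by (simp add: power2_eq_square power3_eq_cube)
    also have "\<dots> \<le> R * (1 / (radius e) ^ 3)" using assms(4) \<open>e \<in> S\<close> by (intro mult_right_mono) auto
    finally show "1 / (radius e)\<^sup>2 \<le> R * (1 / (radius e) ^ 3)" .
  qed
  also have "\<dots> \<le> R * (48 / r)"
    unfolding sum_distrib_left[symmetric]
    using assms by (intro mult_left_mono sum_inverse_radius_cube_le) auto
  finally show ?thesis by (simp add: mult.commute)
qed

section \<open>The angle function of a single dislocation\<close>

text \<open>Positions are shifted so that the origin is the centroid of the triangle \<open>(0, True)\<close>; by
  translation invariance this choice is immaterial.\<close>

definition omega :: complex where
  "omega = Complex (1/2) (sqrt 3 / 2)"

definition barycentre :: complex where
  "barycentre = (1 + omega) / 3"

definition lattice_vec :: "lpt \<Rightarrow> complex" where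
  "lattice_vec x = of_int (fst x) + of_int (snd x) * omega"

definition site :: "lpt \<Rightarrow> complex" where
  "site x = lattice_vec x - barycentre"

definition edge_vec :: "edge \<Rightarrow> complex" where
  "edge_vec e = site (tgt e) - site (src e)"

fun centroid :: "tri \<Rightarrow> complex" where
  "centroid (x, True) = lattice_vec x"
| "centroid (x, False) = lattice_vec x + barycentre"

lemma Re_omega [simp]: "Re omega = 1/2" and Im_omega [simp]: "Im omega = sqrt 3 / 2"
  by (simp_all add: omega_def)

lemma lattice_vec_add: "lattice_vec (x + y) = lattice_vec x + lattice_vec y"
  and lattice_vec_diff: "lattice_vec (x - y) = lattice_vec x - lattice_vec y"
  by (simp_all add: lattice_vec_def algebra_simps)

lemma lattice_vec_simps [simp]:
  "lattice_vec 0 = 0" "lattice_vec (m, 0) = of_int m" "lattice_vec (0, n) = of_int n * omega"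
  by (simp_all add: lattice_vec_def)

lemma site_add: "site (x + y) = site x + lattice_vec y"
  by (simp add: site_def lattice_vec_add)

lemma edge_vec_simps [simp]:
  "edge_vec (x, E0) = 1" "edge_vec (x, E1) = omega" "edge_vec (x, E2) = omega - 1"
  by (simp_all add: edge_vec_def site_add)

lemma cmod_edge_vec [simp]: "cmod (edge_vec e) = 1"
  by (cases e rule: edge_cases) (auto simp: cmod_def power_divide)

lemma centroid_left_tri: "centroid (left_tri e) = centroid (right_tri e) + \<i> * edge_vec e / sqrt 3"
proof -
  have "1 / sqrt 3 = sqrt 3 / 3" by (simp add: real_div_sqrt divide_eq_eq)
  then show ?thesis
    by (cases e rule: edge_cases)
      (auto simp: lattice_vec_diff barycentre_def complex_eq_iff field_simps)
qed

lemma centroid_shift: "centroid (shift_tri p T) = centroid T + lattice_vec p"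
  by (cases T rule: tri_cases) (auto simp: shift_tri_def lattice_vec_add)

lemma cmod_barycentre_square: "(cmod barycentre)\<^sup>2 = 1/3"
  by (simp add: cmod_power2 barycentre_def power_divide)

lemma cmod_barycentre_le: "cmod barycentre \<le> 3/5"
  by (rule power2_le_imp_le) (simp_all add: cmod_barycentre_square power_divide)

lemma cmod_centroid_diff_lattice_vec_le: "cmod (centroid T - lattice_vec (fst T)) \<le> 3/5"
  using cmod_barycentre_le by (cases T rule: tri_cases) auto

lemma cmod_site_diff_centroid_le: "cmod (site (src e) - centroid (right_tri e)) \<le> 3/5"
proof -
  have "site (src e) - centroid (right_tri e)
      \<in> {omega - 2 * barycentre, - barycentre, 1 - 2 * barycentre}"
    by (cases e rule: edge_cases) (auto simp: site_def lattice_vec_add lattice_vec_diff)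
  moreover have "cmod (omega - 2 * barycentre) \<le> 3/5" "cmod (1 - 2 * barycentre) \<le> 3/5"
    by (rule power2_le_imp_le; simp add: barycentre_def cmod_power2 power_divide
      power_mult_distrib)+
  ultimately show ?thesis using cmod_barycentre_le by auto
qed

lemma cmod_lattice_vec_square:
  "(cmod (lattice_vec x))\<^sup>2 = of_int ((fst x)\<^sup>2 + fst x * snd x + (snd x)\<^sup>2)"
proof -
  have "(cmod (lattice_vec x))\<^sup>2 = (real_of_int (fst x) + real_of_int (snd x) / 2)\<^sup>2
      + (real_of_int (snd x))\<^sup>2 * (sqrt 3)\<^sup>2 / 4"
    by (simp add: cmod_power2 lattice_vec_def power_mult_distrib power_divide)
  then show ?thesis by (simp add: power2_eq_square field_simps)
qed

lemma cmod_lattice_vec_ge: "4/5 * of_int (sup_norm x) \<le> cmod (lattice_vec x)"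
proof (rule power2_le_imp_le)
  obtain m n where coordinates: "x = (m, n)" by fastforce
  have "3 * m\<^sup>2 \<le> 4 * (m\<^sup>2 + m * n + n\<^sup>2)" "3 * n\<^sup>2 \<le> 4 * (m\<^sup>2 + m * n + n\<^sup>2)"
    using zero_le_power2[of "m + 2 * n"] zero_le_power2[of "2 * m + n"]
    by (simp_all add: power2_eq_square algebra_simps)
  then have "3 * (sup_norm x)\<^sup>2 \<le> 4 * (m\<^sup>2 + m * n + n\<^sup>2)"
    by (auto simp: sup_norm_def coordinates max_def)
  then have "real_of_int (3 * (sup_norm x)\<^sup>2) \<le> real_of_int (4 * (m\<^sup>2 + m * n + n\<^sup>2))"
    by (simp only: of_int_le_iff)
  then have "3 * (real_of_int (sup_norm x))\<^sup>2 \<le> 4 * (cmod (lattice_vec x))\<^sup>2"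
    unfolding cmod_lattice_vec_square by (simp add: coordinates)
  moreover have "(4/5 * real_of_int (sup_norm x))\<^sup>2 = 16/25 * (real_of_int (sup_norm x))\<^sup>2"
    by (simp add: power_mult_distrib power_divide)
  ultimately show "(4/5 * real_of_int (sup_norm x))\<^sup>2 \<le> (cmod (lattice_vec x))\<^sup>2"
    using zero_le_power2[of "real_of_int (sup_norm x)"] by linarith
qed simp

lemma cmod_lattice_vec_le: "cmod (lattice_vec x) \<le> 2 * of_int (sup_norm x)"
proof -
  have "cmod omega = 1"
    by (simp add: omega_def cmod_def power_divide)
  then have "cmod (lattice_vec x) \<le> \<bar>of_int (fst x)\<bar> + \<bar>of_int (snd x)\<bar>"
    unfolding lattice_vec_def using norm_triangle_ineq[of "of_int (fst x)" "of_int (snd x) * omega"]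
    by (simp add: norm_mult)
  also have "\<dots> \<le> 2 * of_int (sup_norm x)"
    unfolding sup_norm_def by (simp add: max_def flip: of_int_abs of_int_add of_int_mult)
  finally show ?thesis .
qed

lemma cmod_site_ge: "4/5 * of_int (sup_norm x) - 3/5 \<le> cmod (site x)"
  using cmod_lattice_vec_ge[of x] cmod_barycentre_le
    norm_triangle_ineq2[of "lattice_vec x" barycentre]
  by (simp add: site_def)

lemma cmod_centroid_ge: "4/5 * of_int (sup_norm (fst T)) - 3/5 \<le> cmod (centroid T)"
  and cmod_centroid_le: "cmod (centroid T) \<le> 2 * of_int (sup_norm (fst T)) + 3/5"
  using cmod_lattice_vec_ge[of "fst T"] cmod_lattice_vec_le[of "fst T"]
    cmod_centroid_diff_lattice_vec_le[of T]
    norm_triangle_ineq3[of "centroid T" "lattice_vec (fst T)"]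
  by linarith+

lemma dist_centroid_le: "dist (centroid T) (centroid T')
  \<le> 2 * of_int (sup_norm (fst T - fst T')) + 6/5"
proof -
  have near: "dist (centroid S) (lattice_vec (fst S)) \<le> 3/5" for S
    using cmod_centroid_diff_lattice_vec_le by (simp add: dist_norm)
  have "dist (lattice_vec (fst T)) (lattice_vec (fst T')) \<le> 2 * of_int (sup_norm (fst T - fst T'))"
    using cmod_lattice_vec_le[of "fst T - fst T'"] by (simp add: dist_norm lattice_vec_diff)
  then show ?thesis
    using near[of T] near[of T'] dist_triangle[of "centroid T" "centroid T'" "lattice_vec (fst T)"]
      dist_triangle2[of "lattice_vec (fst T)" "centroid T'" "lattice_vec (fst T')"]
    by linarith
qed

definition core_sites :: "lpt set" where
  "core_sites = {(0, 0), (1, 0), (0, 1)}"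

lemma cmod_site_square: "(cmod (site x))\<^sup>2
   = of_int ((fst x)\<^sup>2 + fst x * snd x + (snd x)\<^sup>2 - fst x - snd x) + 1/3"
proof -
  define m n where "m = real_of_int (fst x)" and "n = real_of_int (snd x)"
  have "Re (site x) = m + n / 2 - 1/2" "Im (site x) = (n - 1/3) * (sqrt 3 / 2)"
    by (simp_all add: site_def lattice_vec_def barycentre_def m_def n_def field_simps)
  then have "(cmod (site x))\<^sup>2 = (m + n / 2 - 1/2)\<^sup>2 + ((n - 1/3) * (sqrt 3 / 2))\<^sup>2"
    by (simp only: cmod_power2)
  also have "\<dots> = m\<^sup>2 + m * n + n\<^sup>2 - m - n + 1/3"
    by (simp add: power_mult_distrib power_divide) (simp add: power2_eq_square field_simps)
  finally show ?thesis by (simp add: m_def n_def)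
qed

lemma shifted_quadratic_form_ge_1:
  fixes m n :: int
  assumes "(m, n) \<notin> core_sites"
  shows "1 \<le> m\<^sup>2 + m * n + n\<^sup>2 - m - n"
proof (rule ccontr)
  assume "\<not> ?thesis"
  then have nonpos: "4 * (m\<^sup>2 + m * n + n\<^sup>2 - m - n) \<le> 0" by simp
  have complete_square:
    "4 * (m\<^sup>2 + m * n + n\<^sup>2 - m - n) = (2 * m + n - 1)\<^sup>2 + (3 * n + 1) * (n - 1)"
    by (simp add: power2_eq_square algebra_simps)
  then have "(3 * n + 1) * (n - 1) \<le> 0"
    using nonpos zero_le_power2[of "2 * m + n - 1"] by linarith
  then have "n = 0 \<or> n = 1" by (auto simp: mult_le_0_iff)
  then have "m * m \<le> m \<and> n = 0 \<or> m * m \<le> 0 \<and> n = 1"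
    using nonpos by (auto simp: power2_eq_square algebra_simps)
  then have "m \<in> {0, 1} \<and> n = 0 \<or> m = 0 \<and> n = 1"
  proof (elim disjE conjE)
    assume "m * m \<le> m" "n = 0"
    then have "m * (m - 1) \<le> 0" by (simp add: algebra_simps)
    then show ?thesis using \<open>n = 0\<close> by (auto simp: mult_le_0_iff)
  qed (auto simp: mult_le_0_iff)
  then show False using assms by (auto simp: core_sites_def)
qed

lemma cmod_site_square_ge_if_not_core:
  assumes "x \<notin> core_sites" shows "4/3 \<le> (cmod (site x))\<^sup>2"
proof -
  have "1 \<le> (fst x)\<^sup>2 + fst x * snd x + (snd x)\<^sup>2 - fst x - snd x"
    using assms by (intro shifted_quadratic_form_ge_1) simp
  then have "1 \<le> real_of_int ((fst x)\<^sup>2 + fst x * snd x + (snd x)\<^sup>2 - fst x - snd x)"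
    by (simp only: of_int_1_le_iff)
  then show ?thesis by (simp only: cmod_site_square)
qed

lemma cmod_site_square_ge: "1/3 \<le> (cmod (site x))\<^sup>2"
  using cmod_site_square_ge_if_not_core[of x]
  by (cases "x \<in> core_sites") (auto simp: core_sites_def cmod_site_square)

lemma site_nonzero [simp]: "site x \<noteq> 0"
  using cmod_site_square_ge[of x] by auto

subsection \<open>Bond angles\<close>

definition angle :: "lpt \<Rightarrow> real" where
  "angle x = Arg (site x) / (2 * pi)"

definition angle_form :: "edge \<Rightarrow> real" where
  "angle_form e = Arg (site (tgt e) / site (src e)) / (2 * pi)"

lemma grad_angle_congruent: "grad angle e - angle_form e \<in> \<int>"
proof -
  define a b where "a = site (src e)" and "b = site (tgt e)"
  have nonzero: "a \<noteq> 0" "b \<noteq> 0" "b / a \<noteq> 0" by (simp_all add: a_def b_def)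
  then have "exp (Ln b - Ln a) = exp (Ln (b / a))" by (simp add: exp_diff)
  then obtain k :: int where "Ln b - Ln a = Ln (b / a) + of_int (2 * k) * pi * \<i>"
    by (auto simp: exp_eq)
  then have "Arg b - Arg a = Arg (b / a) + 2 * pi * of_int k"
    unfolding nonzero[THEN Arg_eq_Im_Ln] by (simp add: complex_eq_iff)
  then have "grad angle e - angle_form e = of_int k"
    by (simp add: grad_def angle_def angle_form_def a_def b_def field_simps)
  then show ?thesis by simp
qed

lemma abs_Arg_le_iff:
  assumes "w \<noteq> 0" "0 \<le> t" "t \<le> pi"
  shows "\<bar>Arg w\<bar> \<le> t \<longleftrightarrow> cmod w * cos t \<le> Re w" and "\<bar>Arg w\<bar> < t \<longleftrightarrow> cmod w * cos t < Re w"
proof -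
  have "Re w = cmod w * cos \<bar>Arg w\<bar>"
    using arg_cong[OF rcis_cmod_Arg[of w], of Re] by simp
  moreover have "\<bar>Arg w\<bar> \<le> pi" using Arg_bounded[of w] by linarith
  ultimately show "\<bar>Arg w\<bar> \<le> t \<longleftrightarrow> cmod w * cos t \<le> Re w" "\<bar>Arg w\<bar> < t \<longleftrightarrow> cmod w * cos t < Re w"
    using assms cos_mono_le_eq[of t "\<bar>Arg w\<bar>"] cos_mono_less_eq[of t "\<bar>Arg w\<bar>"]
    by (simp_all del: cos_abs_real)
qed

text \<open>The angle under which a segment of length 1 is seen from the origin, by the law of cosines.\<close>
lemma abs_Arg_quotient_le_120_iff:
  assumes "cmod (b - a) = 1" "a \<noteq> 0" "b \<noteq> 0"
  shows "\<bar>Arg (b / a)\<bar> \<le> 2 * pi / 3 \<longleftrightarrow> 1 \<le> (cmod a)\<^sup>2 + (cmod b)\<^sup>2 + cmod a * cmod b"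
    and "\<bar>Arg (b / a)\<bar> < 2 * pi / 3 \<longleftrightarrow> 1 < (cmod a)\<^sup>2 + (cmod b)\<^sup>2 + cmod a * cmod b"
proof -
  have "(cmod (b - a))\<^sup>2 = (cmod a)\<^sup>2 + (cmod b)\<^sup>2 - 2 * (Re b * Re a + Im b * Im a)"
    unfolding cmod_power2 by (simp add: power2_eq_square algebra_simps)
  then have "Re b * Re a + Im b * Im a = ((cmod a)\<^sup>2 + (cmod b)\<^sup>2 - 1) / 2"
    using assms by simp
  moreover have "Re (b / a) = (Re b * Re a + Im b * Im a) / (cmod a)\<^sup>2"
    by (simp add: Re_divide cmod_power2)
  ultimately have Re_quotient: "Re (b / a) = ((cmod a)\<^sup>2 + (cmod b)\<^sup>2 - 1) / (2 * (cmod a)\<^sup>2)"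
    by (simp only: divide_divide_eq_left)
  have "b / a \<noteq> 0" "0 \<le> 2 * pi / 3" "2 * pi / 3 \<le> pi" using assms by auto
  note abs_Arg_le_iff[OF this]
  then show "\<bar>Arg (b / a)\<bar> \<le> 2 * pi / 3 \<longleftrightarrow> 1 \<le> (cmod a)\<^sup>2 + (cmod b)\<^sup>2 + cmod a * cmod b"
    and "\<bar>Arg (b / a)\<bar> < 2 * pi / 3 \<longleftrightarrow> 1 < (cmod a)\<^sup>2 + (cmod b)\<^sup>2 + cmod a * cmod b"
    using assms(2,3) unfolding Re_quotient norm_divide cos_120
    by (auto simp: field_simps power2_eq_square)
qed

lemma cmod_site_tgt_diff_src: "cmod (site (tgt e) - site (src e)) = 1"
  using cmod_edge_vec[of e] by (simp add: edge_vec_def)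

lemma abs_angle_form_le: "\<bar>angle_form e\<bar> \<le> 1/3"
proof -
  define a b where "a = cmod (site (src e))" and "b = cmod (site (tgt e))"
  have square_ge: "1/3 \<le> a\<^sup>2" "1/3 \<le> b\<^sup>2" using cmod_site_square_ge by (auto simp: a_def b_def)
  then have "(1/3)\<^sup>2 \<le> (a * b)\<^sup>2"
    using mult_mono[OF square_ge] by (simp add: power2_eq_square mult_ac)
  then have "1/3 \<le> a * b" by (rule power2_le_imp_le) (simp add: a_def b_def)
  then have "\<bar>Arg (site (tgt e) / site (src e))\<bar> \<le> 2 * pi / 3"
    using square_ge cmod_site_tgt_diff_src[of e]
    by (subst abs_Arg_quotient_le_120_iff) (simp_all add: a_def b_def)
  then show ?thesis by (simp add: angle_form_def field_simps)
qed

lemma abs_angle_form_less: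
  assumes "src e \<notin> core_sites \<or> tgt e \<notin> core_sites" shows "\<bar>angle_form e\<bar> < 1/3"
proof -
  define a b where "a = cmod (site (src e))" and "b = cmod (site (tgt e))"
  have "4/3 \<le> a\<^sup>2 \<or> 4/3 \<le> b\<^sup>2"
    using cmod_site_square_ge_if_not_core assms unfolding a_def b_def by blast
  moreover have "0 \<le> a * b" "0 \<le> a\<^sup>2" "0 \<le> b\<^sup>2" by (simp_all add: a_def b_def)
  ultimately have "1 < a\<^sup>2 + b\<^sup>2 + a * b" by linarith
  then have "\<bar>Arg (site (tgt e) / site (src e))\<bar> < 2 * pi / 3"
    using cmod_site_tgt_diff_src[of e]
    by (subst abs_Arg_quotient_le_120_iff) (simp_all add: a_def b_def)
  then show ?thesis by (simp add: angle_form_def field_simps)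
qed

lemma wrap_grad_angle: "wrap (grad angle e) = angle_form e"
  by (rule wrap_eqI) (use grad_angle_congruent[of e] abs_angle_form_le[of e] in auto)

lemma side_not_core_if_not_origin:
  assumes "T \<noteq> (0, True)"
  shows "\<exists>e\<in>sides T. src e \<notin> core_sites \<or> tgt e \<notin> core_sites"
proof (cases T rule: tri_cases)
  case (up x)
  then have "x \<noteq> 0" using assms by simp
  then have "x \<notin> core_sites \<or> x + (1, 0) \<notin> core_sites"
    by (cases x) (auto simp: core_sites_def zero_prod_def)
  then show ?thesis by (simp add: up)
next
  case (down x)
  have "x + (0, 1) + (1, 0) \<notin> core_sites \<or> x + (0, 1) \<notin> core_sites \<or> x + (1, 0) \<notin> core_sites"
    by (cases x) (auto simp: core_sites_def)
  then show ?thesis by (auto simp: down)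
qed

lemma curl_angle_form_origin: "curl angle_form (0, True) = 1"
proof -
  have "0 < angle_form (0, E0)" "0 < angle_form (0, E2)"
    unfolding angle_form_def
    by (intro divide_pos_pos Arg_lt_pi[THEN iffD2, THEN conjunct1];
        simp add: Im_divide site_def barycentre_def lattice_vec_def field_simps power2_eq_square
          zero_prod_def)+
  moreover have "angle_form (0, E1) < 0"
    unfolding angle_form_def
    by (intro divide_neg_pos Arg_neg_iff[THEN iffD2];
        simp add: Im_divide site_def barycentre_def lattice_vec_def field_simps power2_eq_square
          zero_prod_def)
  moreover have "curl angle_form (0, True)
      = angle_form (0, E0) + angle_form (0, E2) - angle_form (0, E1)"
    by simp
  ultimately have "0 < curl angle_form (0, True)" "curl angle_form (0, True) \<le> 1"
    using abs_angle_form_le[of "(0, E0)"] abs_angle_form_le[of "(0, E1)"]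
      abs_angle_form_le[of "(0, E2)"]
    by linarith+
  moreover have "curl angle_form (0, True) \<in> \<int>"
    by (rule curl_Ints_congruent[OF grad_angle_congruent])
  ultimately show ?thesis by (auto elim!: Ints_cases simp del: curl.simps)
qed

lemma curl_angle_form: "curl angle_form T = (if T = (0, True) then 1 else 0)"
proof (cases "T = (0, True)")
  case False
  then obtain e where "e \<in> sides T" "\<bar>angle_form e\<bar> < 1/3"
    using side_not_core_if_not_origin abs_angle_form_less by blast
  then have "(\<Sum>e\<in>sides T. \<bar>angle_form e\<bar>) < (\<Sum>e\<in>sides T. 1/3)"
    using abs_angle_form_le by (intro sum_strict_mono_ex1) auto
  then have "\<bar>curl angle_form T\<bar> < 1"
    using abs_curl_le[of angle_form T] by (simp add: card_sides)
  moreover have "curl angle_form T \<in> \<int>" by (rule curl_Ints_congruent[OF grad_angle_congruent])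
  ultimately show ?thesis using False Ints_nonzero_abs_less1 by auto
qed (simp add: curl_angle_form_origin del: curl.simps)

subsection \<open>Asymptotics of the bond angles\<close>

lemma far_edge:
  assumes "6 \<le> radius e"
  shows "radius e \<le> 3 * cmod (site (src e))" "radius e \<le> 3 * cmod (centroid (left_tri e))"
    "radius e \<le> 3 * cmod (centroid (right_tri e))"
proof -
  have "radius e - 2 \<le> real_of_int (sup_norm (src e))"
    "radius e - 2 \<le> real_of_int (sup_norm (fst (left_tri e)))"
    "radius e - 2 \<le> real_of_int (sup_norm (fst (right_tri e)))"
    using sup_norm_src_ge[of e] sup_norm_bordering_tri[of e] unfolding radius_def by linarith+
  then show "radius e \<le> 3 * cmod (site (src e))" "radius e \<le> 3 * cmod (centroid (left_tri e))"
    "radius e \<le> 3 * cmod (centroid (right_tri e))"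
    using assms cmod_site_ge[of "src e"] cmod_centroid_ge[of "left_tri e"]
      cmod_centroid_ge[of "right_tri e"] by argo+
qed

lemma inverse_le_radius:
  assumes "radius e \<le> 3 * a" shows "1 / a \<le> 3 / radius e" "(1 / a)\<^sup>2 \<le> 9 / (radius e)\<^sup>2" "0 < a"
proof -
  show a_pos: "0 < a" using assms radius_pos[of e] by linarith
  show inverse_le: "1 / a \<le> 3 / radius e" using assms a_pos by (simp add: field_simps)
  have "(1 / a)\<^sup>2 \<le> (3 / radius e)\<^sup>2" using inverse_le a_pos by (intro power_mono) auto
  then show "(1 / a)\<^sup>2 \<le> 9 / (radius e)\<^sup>2" by (simp add: power_divide)
qed

lemma one_le_divide_radius_square:
  assumes "radius e \<le> r" shows "1 \<le> r\<^sup>2 / (radius e)\<^sup>2"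
  using power_mono[OF assms, of 2] by simp

lemma abs_le_if_two_pi_abs_le:
  assumes "\<bar>2 * pi * x\<bar> \<le> 6 * c" shows "\<bar>x\<bar> \<le> c"
proof -
  have "6 * \<bar>x\<bar> \<le> 2 * pi * \<bar>x\<bar>" using pi_gt3 by (intro mult_right_mono) auto
  then show ?thesis using assms by (simp add: abs_mult)
qed

lemma cmod_Ln_1_plus_diff_le:
  assumes "cmod t \<le> 1/2" shows "cmod (Ln (1 + t) - t) \<le> 2 * (cmod t)\<^sup>2"
proof -
  have "cmod (Ln (1 + t) - t) \<le> (cmod t)\<^sup>2 / (1 - cmod t)"
    using assms by (intro Ln_approx_linear) auto
  also have "\<dots> \<le> (cmod t)\<^sup>2 / (1/2)"
    using assms by (intro divide_left_mono) auto
  finally show ?thesis by simp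
qed

lemma angle_form_linearised:
  assumes "6 \<le> radius e"
  shows "\<bar>2 * pi * angle_form e - Im (edge_vec e / site (src e))\<bar> \<le> 18 / (radius e)\<^sup>2"
proof -
  define t where "t = edge_vec e / site (src e)"
  note site_far = inverse_le_radius[OF far_edge(1)[OF assms]]
  have cmod_t: "cmod t = 1 / cmod (site (src e))" by (simp add: t_def norm_divide)
  have "3 / radius e \<le> 1/2" using assms by (simp add: field_simps)
  then have t_small: "cmod t \<le> 1/2" using cmod_t site_far(1) by linarith
  have quotient: "site (tgt e) / site (src e) = 1 + t"
    by (simp add: t_def edge_vec_def field_simps)
  have "1 + t \<noteq> 0" unfolding quotient[symmetric] by simp
  then have "2 * pi * angle_form e = Im (Ln (1 + t))"
    by (simp add: angle_form_def quotient Arg_eq_Im_Ln)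
  then have "\<bar>2 * pi * angle_form e - Im t\<bar> \<le> cmod (Ln (1 + t) - t)"
    using abs_Im_le_cmod[of "Ln (1 + t) - t"] by simp
  also have "\<dots> \<le> 2 * (cmod t)\<^sup>2" using t_small by (rule cmod_Ln_1_plus_diff_le)
  also have "\<dots> \<le> 18 / (radius e)\<^sup>2" using site_far(2) cmod_t by simp
  finally show ?thesis by (simp add: t_def)
qed

lemma abs_angle_form_le_inverse_radius: "\<bar>angle_form e\<bar> \<le> 2 / radius e"
proof (cases "6 \<le> radius e")
  case True
  have "\<bar>Im (edge_vec e / site (src e))\<bar> \<le> 1 / cmod (site (src e))"
    using abs_Im_le_cmod[of "edge_vec e / site (src e)"] by (simp add: norm_divide)
  also have "\<dots> \<le> 3 / radius e" by (rule inverse_le_radius(1)[OF far_edge(1)[OF True]])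
  finally have "\<bar>2 * pi * angle_form e\<bar> \<le> 3 / radius e + 18 / (radius e)\<^sup>2"
    using angle_form_linearised[OF True] by linarith
  also have "18 / (radius e)\<^sup>2 \<le> 3 / radius e"
    using True by (simp add: field_simps power2_eq_square)
  finally have "\<bar>2 * pi * angle_form e\<bar> \<le> 6 * (2 / radius e)" by simp
  then show ?thesis by (rule abs_le_if_two_pi_abs_le)
next
  case False
  then have "1/3 \<le> 2 / radius e" by (simp add: field_simps)
  then show ?thesis using abs_angle_form_le[of e] by linarith
qed

lemma angle_form_square_le: "(angle_form e)\<^sup>2 \<le> 4 / (radius e)\<^sup>2"
proof -
  have "(angle_form e)\<^sup>2 \<le> (2 / radius e)\<^sup>2"
    using abs_angle_form_le_inverse_radius[of e] by (intro abs_le_square_iff[THEN iffD1]) simp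
  then show ?thesis by (simp add: power_divide)
qed

lemma sum_abs_angle_form_cube_le:
  assumes "finite S" shows "(\<Sum>e\<in>S. \<bar>angle_form e\<bar> ^ 3) \<le> 384"
proof -
  have "\<bar>angle_form e\<bar> ^ 3 \<le> 8 * (1 / (radius e) ^ 3)" for e
    using power_mono[OF abs_angle_form_le_inverse_radius[of e], of 3] by (simp add: power_divide)
  then have "(\<Sum>e\<in>S. \<bar>angle_form e\<bar> ^ 3) \<le> 8 * (\<Sum>e\<in>S. 1 / (radius e) ^ 3)"
    unfolding sum_distrib_left by (intro sum_mono)
  also have "(\<Sum>e\<in>S. 1 / (radius e) ^ 3) \<le> 48 / 1"
    using assms radius_ge_1 by (intro sum_inverse_radius_cube_le) auto
  finally show ?thesis by simp
qed

lemma abs_Im_divide_diff_le: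
  fixes a b h :: complex
  assumes "a \<noteq> 0" "b \<noteq> 0" "cmod h = 1" "1 / cmod a \<le> A" "1 / cmod b \<le> B"
  shows "\<bar>Im (h / a) - Im (h / b)\<bar> \<le> cmod (a - b) * (A * B)"
proof -
  have "h / a - h / b = h * (b - a) / (a * b)" using assms by (simp add: field_simps)
  then have "cmod (h / a - h / b) = cmod (a - b) * ((1 / cmod a) * (1 / cmod b))"
    using assms by (simp add: norm_mult norm_divide norm_minus_commute)
  also have "\<dots> \<le> cmod (a - b) * (A * B)"
    using assms by (intro mult_left_mono mult_mono) (auto intro: order_trans[rotated])
  finally show ?thesis using abs_Im_le_cmod[of "h / a - h / b"] by simp
qed

lemma far_angle_form_shift_diff_le:
  assumes far: "6 + 2 * real_of_int (sup_norm p) \<le> radius e"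
  shows "\<bar>angle_form (shift_edge p e) - angle_form e\<bar>
    \<le> (15 + 6 * of_int (sup_norm p)) / (radius e)\<^sup>2"
proof -
  define e' where "e' = shift_edge p e"
  have "sup_norm (fst e) - sup_norm p \<le> sup_norm (fst e')"
    using sup_norm_triangle_diff[of "fst e + p" p] by (simp add: e'_def)
  then have radius_ge: "radius e - of_int (sup_norm p) \<le> radius e'"
    unfolding radius_def by linarith
  have "0 \<le> real_of_int (sup_norm p)" by simp
  then have e_far: "6 \<le> radius e" "6 \<le> radius e'" and half: "radius e / 2 \<le> radius e'"
    using far radius_ge by linarith+
  have inverse_le: "3 / radius e' \<le> 6 / radius e"
    using half by (simp add: field_simps)
  have "(radius e / 2)\<^sup>2 \<le> (radius e')\<^sup>2" using half by (intro power_mono) auto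
  then have inverse_square_le: "18 / (radius e')\<^sup>2 \<le> 72 / (radius e)\<^sup>2"
    by (simp add: field_simps)
  have edge_vec: "edge_vec e' = edge_vec e"
    and site: "site (src e) - site (src e') = - lattice_vec p"
    by (simp_all add: e'_def edge_vec_def site_add)
  have "1 / cmod (site (src e')) \<le> 6 / radius e"
    using inverse_le_radius(1)[OF far_edge(1)[OF e_far(2)]] inverse_le by linarith
  then have "\<bar>Im (edge_vec e / site (src e)) - Im (edge_vec e / site (src e'))\<bar>
      \<le> cmod (site (src e) - site (src e')) * ((3 / radius e) * (6 / radius e))"
    using inverse_le_radius(1)[OF far_edge(1)[OF e_far(1)]] by (intro abs_Im_divide_diff_le) auto
  also have "\<dots> \<le> 2 * of_int (sup_norm p) * ((3 / radius e) * (6 / radius e))"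
    using cmod_lattice_vec_le[of p] unfolding site norm_minus_cancel by (intro mult_right_mono) auto
  also have "\<dots> = 36 * of_int (sup_norm p) / (radius e)\<^sup>2" by (simp add: power2_eq_square)
  finally have "\<bar>2 * pi * angle_form e' - 2 * pi * angle_form e\<bar>
      \<le> 18 / (radius e)\<^sup>2 + 72 / (radius e)\<^sup>2 + 36 * of_int (sup_norm p) / (radius e)\<^sup>2"
    using angle_form_linearised[OF e_far(1)] angle_form_linearised[OF e_far(2)] inverse_square_le
    unfolding edge_vec by linarith
  also have "\<dots> = 6 * ((15 + 6 * of_int (sup_norm p)) / (radius e)\<^sup>2)" by (simp add: field_simps)
  finally show ?thesis
    unfolding e'_def right_diff_distrib[symmetric] by (rule abs_le_if_two_pi_abs_le)
qed

lemma angle_form_shift_diff_le: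
  "\<exists>C>0. \<forall>e. \<bar>angle_form (shift_edge p e) - angle_form e\<bar> \<le> C / (radius e)\<^sup>2"
proof -
  define s where "s = real_of_int (sup_norm p)"
  define C where "C = 15 + 6 * s + (6 + 2 * s)\<^sup>2"
  have "0 \<le> s" by (simp add: s_def)
  have "\<bar>angle_form (shift_edge p e) - angle_form e\<bar> \<le> C / (radius e)\<^sup>2" for e
  proof (cases "6 + 2 * s \<le> radius e")
    case True
    then have "\<bar>angle_form (shift_edge p e) - angle_form e\<bar> \<le> (15 + 6 * s) / (radius e)\<^sup>2"
      unfolding s_def by (rule far_angle_form_shift_diff_le)
    also have "\<dots> \<le> C / (radius e)\<^sup>2" unfolding C_def by (intro divide_right_mono) auto
    finally show ?thesis .
  next
    case False
    have "\<bar>angle_form (shift_edge p e) - angle_form e\<bar> \<le> 1"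
      using abs_angle_form_le[of e] abs_angle_form_le[of "shift_edge p e"] by linarith
    also have "1 \<le> (6 + 2 * s)\<^sup>2 / (radius e)\<^sup>2"
      using False by (intro one_le_divide_radius_square) simp
    also have "\<dots> \<le> C / (radius e)\<^sup>2" unfolding C_def using \<open>0 \<le> s\<close> by (intro divide_right_mono) auto
    finally show ?thesis .
  qed
  moreover have "0 < C" using \<open>0 \<le> s\<close> by (simp add: C_def add_pos_nonneg)
  ultimately show ?thesis by blast
qed

lemma l2_bounded_if_inverse_square_decay:
  assumes "0 < C" "\<And>e. \<bar>f e\<bar> \<le> C / (radius e)\<^sup>2" shows "l2_bounded f (48 * C\<^sup>2)"
  unfolding l2_bounded_def
proof (intro allI impI)
  fix S :: "edge set" assume "finite S"
  have "(f e)\<^sup>2 \<le> C\<^sup>2 * (1 / (radius e) ^ 3)" for e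
  proof -
    have "(f e)\<^sup>2 \<le> (C / (radius e)\<^sup>2)\<^sup>2"
      using assms(1) assms(2)[of e] by (intro abs_le_square_iff[THEN iffD1]) simp
    also have "\<dots> = C\<^sup>2 * (1 / (radius e) ^ 4)" by (simp add: power_divide)
    also have "\<dots> \<le> C\<^sup>2 * (1 / (radius e) ^ 3)"
      using radius_ge_1[of e] by (intro mult_left_mono divide_left_mono power_increasing) auto
    finally show ?thesis .
  qed
  then have "(\<Sum>e\<in>S. (f e)\<^sup>2) \<le> C\<^sup>2 * (\<Sum>e\<in>S. 1 / (radius e) ^ 3)"
    unfolding sum_distrib_left by (rule sum_mono)
  also have "\<dots> \<le> C\<^sup>2 * (48 / 1)"
    using \<open>finite S\<close> radius_ge_1 by (intro mult_left_mono sum_inverse_radius_cube_le) auto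
  finally show "(\<Sum>e\<in>S. (f e)\<^sup>2) \<le> 48 * C\<^sup>2" by simp
qed

subsection \<open>The conjugate logarithm\<close>

definition log_dist :: "tri \<Rightarrow> real" where
  "log_dist T = ln (max 1 (cmod (centroid T)))"

lemma log_dist_nonneg: "0 \<le> log_dist T"
  by (simp add: log_dist_def)

lemma log_dist_far: "1 \<le> cmod (centroid T) \<Longrightarrow> log_dist T = ln (cmod (centroid T))"
  by (simp add: log_dist_def max_def)

lemma log_dist_le: "cmod (centroid T) \<le> 2 ^ k \<Longrightarrow> log_dist T \<le> real k * ln 2"
  unfolding log_dist_def ln_realpow[of 2 k, simplified, symmetric] by (subst ln_le_cancel_iff) auto

lemma log_dist_ge: "2 ^ k \<le> cmod (centroid T) \<Longrightarrow> real k * ln 2 \<le> log_dist T"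
  unfolding log_dist_def ln_realpow[of 2 k, simplified, symmetric] by (subst ln_le_cancel_iff) auto

lemma abs_ln_diff_le:
  fixes a b m :: real
  assumes "0 < m" "m \<le> a" "m \<le> b" shows "\<bar>ln a - ln b\<bar> \<le> \<bar>a - b\<bar> / m"
proof -
  have one_sided: "ln x - ln y \<le> \<bar>x - y\<bar> / m" if "m \<le> x" "m \<le> y" for x y
  proof -
    have "ln x - ln y = ln (x / y)" using that assms(1) by (simp add: ln_div)
    also have "\<dots> \<le> x / y - 1" using that assms(1) by (intro ln_le_minus_one) auto
    also have "\<dots> = (x - y) / y" using that assms(1) by (simp add: field_simps)
    also have "\<dots> \<le> \<bar>x - y\<bar> / y" using that assms(1) by (intro divide_right_mono) auto
    also have "\<dots> \<le> \<bar>x - y\<bar> / m" using that assms(1) by (intro divide_left_mono) auto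
    finally show ?thesis .
  qed
  from one_sided[OF assms(2,3)] one_sided[OF assms(3,2)] show ?thesis
    by (simp add: abs_le_iff abs_minus_commute)
qed

lemma abs_cograd_log_dist_le:
  assumes "0 < m" "m \<le> max 1 (cmod (centroid (left_tri e)))"
    "m \<le> max 1 (cmod (centroid (right_tri e)))"
  shows "\<bar>cograd log_dist e\<bar> \<le> 1 / m"
proof -
  define a b where "a = cmod (centroid (left_tri e))" and "b = cmod (centroid (right_tri e))"
  have "cmod (centroid (left_tri e) - centroid (right_tri e)) = 1 / sqrt 3"
    by (simp add: centroid_left_tri norm_mult norm_divide)
  moreover have "1 / sqrt 3 \<le> (1::real)" by simp
  ultimately have "\<bar>a - b\<bar> \<le> 1"
    using norm_triangle_ineq3[of "centroid (left_tri e)" "centroid (right_tri e)"]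
    unfolding a_def b_def by linarith
  then have "\<bar>max 1 a - max 1 b\<bar> \<le> 1" by auto
  then have "\<bar>max 1 a - max 1 b\<bar> / m \<le> 1 / m" using assms(1) by (intro divide_right_mono) auto
  then show ?thesis
    using abs_ln_diff_le[OF assms] unfolding cograd_def log_dist_def a_def b_def by linarith
qed

lemma abs_cograd_log_dist_le_1: "\<bar>cograd log_dist e\<bar> \<le> 1"
  using abs_cograd_log_dist_le[of 1 e] by simp

lemma abs_cograd_log_dist_le_inverse_radius: "\<bar>cograd log_dist e\<bar> \<le> 6 / radius e"
proof (cases "6 \<le> radius e")
  case True
  have "\<bar>cograd log_dist e\<bar> \<le> 1 / (radius e / 3)"
    using far_edge(2,3)[OF True] by (intro abs_cograd_log_dist_le) auto
  also have "\<dots> \<le> 6 / radius e" by (simp add: divide_right_mono)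
  finally show ?thesis .
next
  case False
  then have "1 \<le> 6 / radius e" by (simp add: field_simps)
  then show ?thesis using abs_cograd_log_dist_le_1[of e] by linarith
qed

text \<open>The angle and the logarithm are conjugate harmonic functions; \<open>sqrt 3\<close> is the ratio of the
  length of a bond to the distance of the two centroids next to it.\<close>
definition conjugate_factor :: real where
  "conjugate_factor = sqrt 3 / (2 * pi)"

lemma conjugate_factor_bounds: "0 \<le> conjugate_factor" "conjugate_factor \<le> 1/3"
proof -
  have "sqrt 3 \<le> (2::real)" by (simp add: real_le_lsqrt)
  then show "0 \<le> conjugate_factor" "conjugate_factor \<le> 1/3"
    using pi_gt3 by (simp_all add: conjugate_factor_def field_simps)
qed

lemma cograd_log_dist_linearised:
  assumes "6 \<le> radius e"
  shows "\<bar>2 * pi * (conjugate_factor * cograd log_dist e)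
    + Im (edge_vec e / centroid (right_tri e))\<bar>
    \<le> 12 / (radius e)\<^sup>2"
proof -
  define s where "s = centroid (right_tri e)"
  define t where "t = \<i> * (edge_vec e / s) / of_real (sqrt 3)"
  note s_far = inverse_le_radius[OF far_edge(3)[OF assms], folded s_def]
  have far: "1 \<le> cmod s" "1 \<le> cmod (centroid (left_tri e))"
    using far_edge[OF assms] assms by (auto simp: s_def)
  have cmod_t: "cmod t = 1 / cmod s / sqrt 3" by (simp add: t_def norm_divide norm_mult)
  have cmod_t_square: "(cmod t)\<^sup>2 = (1 / cmod s)\<^sup>2 / 3"
    unfolding cmod_t by (simp add: power_divide power_mult_distrib)
  have "1 / cmod s / sqrt 3 \<le> 1 / cmod s" using divide_left_mono[of 1 "sqrt 3" "1 / cmod s"] by simp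
  moreover have "3 / radius e \<le> 1/2" using assms by (simp add: field_simps)
  ultimately have t_small: "cmod t \<le> 1/2" using s_far(1) unfolding cmod_t by linarith
  have left: "centroid (left_tri e) = s * (1 + t)"
    using far(1) by (auto simp: centroid_left_tri t_def s_def field_simps)
  then have nonzero: "s \<noteq> 0" "1 + t \<noteq> 0" using far by auto
  then have "cograd log_dist e = ln (cmod (1 + t))"
    unfolding cograd_def log_dist_far[OF far(2)] log_dist_far[OF far(1)[unfolded s_def]] left
    by (simp add: s_def norm_mult ln_mult)
  then have cograd: "cograd log_dist e = Re (Ln (1 + t))" using nonzero by simp
  have "Re t = - Im (edge_vec e / s) / sqrt 3"
    unfolding t_def by (simp only: Re_divide_of_real Re_i_times)
  then have "Im (edge_vec e / s) = - sqrt 3 * Re t" by simp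
  then have "2 * pi * (conjugate_factor * cograd log_dist e) + Im (edge_vec e / s)
      = sqrt 3 * Re (Ln (1 + t) - t)"
    unfolding cograd by (simp add: conjugate_factor_def algebra_simps)
  then have "\<bar>2 * pi * (conjugate_factor * cograd log_dist e) + Im (edge_vec e / s)\<bar>
      = sqrt 3 * \<bar>Re (Ln (1 + t) - t)\<bar>"
    by (simp add: abs_mult)
  also have "\<dots> \<le> 2 * cmod (Ln (1 + t) - t)"
    by (intro mult_mono abs_Re_le_cmod) (auto simp: real_le_lsqrt)
  also have "\<dots> \<le> 2 * (2 * (cmod t)\<^sup>2)" using cmod_Ln_1_plus_diff_le[OF t_small] by simp
  also have "\<dots> \<le> 12 / (radius e)\<^sup>2" using s_far(2) cmod_t_square by simp
  finally show ?thesis by (simp add: s_def)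
qed

lemma angle_form_plus_cograd_log_dist_le:
  "\<bar>angle_form e + conjugate_factor * cograd log_dist e\<bar> \<le> 36 / (radius e)\<^sup>2"
proof (cases "6 \<le> radius e")
  case True
  have "\<bar>Im (edge_vec e / site (src e)) - Im (edge_vec e / centroid (right_tri e))\<bar>
      \<le> cmod (site (src e) - centroid (right_tri e)) * ((3 / radius e) * (3 / radius e))"
    using inverse_le_radius[OF far_edge(1)[OF True]] inverse_le_radius[OF far_edge(3)[OF True]]
    by (intro abs_Im_divide_diff_le) auto
  also have "\<dots> \<le> 1 * ((3 / radius e) * (3 / radius e))"
    using cmod_site_diff_centroid_le[of e] by (intro mult_right_mono) auto
  also have "\<dots> = 9 / (radius e)\<^sup>2" by (simp add: power2_eq_square)
  finally have "\<bar>2 * pi * (angle_form e + conjugate_factor * cograd log_dist e)\<bar>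
      \<le> 18 / (radius e)\<^sup>2 + 12 / (radius e)\<^sup>2 + 9 / (radius e)\<^sup>2"
    using angle_form_linearised[OF True] cograd_log_dist_linearised[OF True]
    unfolding distrib_left[of "2 * pi"] by linarith
  also have "\<dots> = 39 / (radius e)\<^sup>2" by (simp add: field_simps)
  also have "\<dots> \<le> 6 * (36 / (radius e)\<^sup>2)" by (simp add: divide_right_mono)
  finally show ?thesis by (rule abs_le_if_two_pi_abs_le)
next
  case False
  have "\<bar>conjugate_factor * cograd log_dist e\<bar> \<le> 1/3 * 1"
    unfolding abs_mult using conjugate_factor_bounds abs_cograd_log_dist_le_1[of e]
    by (intro mult_mono) auto
  then have "\<bar>angle_form e + conjugate_factor * cograd log_dist e\<bar> \<le> 1"
    using abs_angle_form_le[of e] by linarith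
  also have "1 \<le> 6\<^sup>2 / (radius e)\<^sup>2" using False by (intro one_le_divide_radius_square) simp
  finally show ?thesis by simp
qed

subsection \<open>Dyadic layers of the logarithm\<close>

definition layer :: "nat \<Rightarrow> tri \<Rightarrow> real" where
  "layer k T = min (max (log_dist T - real k * ln 2) 0) (ln 2)"

definition layers :: "nat set \<Rightarrow> tri \<Rightarrow> real" where
  "layers B T = (\<Sum>k\<in>B. layer k T)"

lemma layer_inside: "cmod (centroid T) \<le> 2 ^ k \<Longrightarrow> layer k T = 0"
  using log_dist_le[of T k] by (simp add: layer_def)

lemma layer_outside: "2 ^ Suc k \<le> cmod (centroid T) \<Longrightarrow> layer k T = ln 2"
  using log_dist_ge[of "Suc k" T] by (simp add: layer_def algebra_simps)

lemma layer_outside_tris: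
  assumes "T \<notin> tris (2 * 2 ^ M)" "k < M" shows "layer k T = ln 2"
proof (rule layer_outside)
  have "2 * 2 ^ M + 1 \<le> real_of_int (sup_norm (fst T))"
    using assms(1) of_int_le_iff[of "2 * 2 ^ M + 1" "sup_norm (fst T)", where ?'a=real]
    by (simp add: mem_tris)
  then have "4/5 * (2 * 2 ^ M + 1) - 3/5 \<le> cmod (centroid T)" using cmod_centroid_ge[of T] by argo
  moreover have "(1::real) \<le> 2 ^ M" by simp
  moreover have "(2::real) ^ Suc k \<le> 2 ^ M" using assms(2) by (intro power_increasing) auto
  ultimately show "2 ^ Suc k \<le> cmod (centroid T)" by argo
qed

lemma layers_lessThan: "layers {..<M} T = min (log_dist T) (real M * ln 2)"
proof (induction M)
  case 0
  then show ?case using log_dist_nonneg[of T] by (simp add: layers_def)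
next
  case (Suc M)
  then have "layers {..<Suc M} T = min (log_dist T) (real M * ln 2) + layer M T"
    by (simp add: layers_def)
  also have "\<dots> = min (log_dist T) (real (Suc M) * ln 2)"
    unfolding layer_def using ln2_ge_two_thirds by (simp add: min_def max_def algebra_simps)
  finally show ?case .
qed

lemma sum_abs_cograd_layer_le:
  assumes "finite B"
  shows "(\<Sum>k\<in>B. \<bar>cograd (layer k) e\<bar>) \<le> \<bar>cograd log_dist e\<bar>"
proof -
  obtain M where below: "B \<subseteq> {..<M}" using assms finite_nat_iff_bounded by blast
  have ordered: "(\<Sum>k\<in>B. \<bar>layer k T' - layer k T\<bar>) \<le> log_dist T' - log_dist T"
    if "log_dist T \<le> log_dist T'" for T T'
  proof -
    have mono: "layer k T \<le> layer k T'" for k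
      using that unfolding layer_def by (simp add: min_def max_def)
    then have "(\<Sum>k\<in>B. \<bar>layer k T' - layer k T\<bar>) \<le> (\<Sum>k<M. layer k T' - layer k T)"
      using below by (simp, intro sum_mono2) auto
    also have "\<dots> = layers {..<M} T' - layers {..<M} T" by (simp add: layers_def sum_subtractf)
    also have "\<dots> \<le> log_dist T' - log_dist T" using that by (simp add: layers_lessThan min_def)
    finally show ?thesis .
  qed
  show ?thesis
    using ordered[of "left_tri e" "right_tri e"] ordered[of "right_tri e" "left_tri e"]
    by (cases "log_dist (left_tri e) \<le> log_dist (right_tri e)")
      (auto simp: cograd_def abs_minus_commute)
qed

lemma abs_cograd_layers_le:
  assumes "finite B" shows "\<bar>cograd (layers B) e\<bar> \<le> (\<Sum>k\<in>B. \<bar>cograd (layer k) e\<bar>)"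
  unfolding cograd_def layers_def sum_subtractf[symmetric] by (rule sum_abs)

lemma radius_if_cograd_layer_nonzero:
  assumes "cograd (layer k) e \<noteq> 0"
  shows "2 ^ k / 5 \<le> radius e" "radius e \<le> 6 * 2 ^ k"
proof -
  define a b where "a = cmod (centroid (left_tri e))" and "b = cmod (centroid (right_tri e))"
  have one_le: "(1::real) \<le> 2 ^ k" by simp
  have differ: "layer k (left_tri e) \<noteq> layer k (right_tri e)" using assms by (simp add: cograd_def)
  have sup_norm: "radius e - 2 \<le> real_of_int (sup_norm (fst (left_tri e)))"
    "radius e - 2 \<le> real_of_int (sup_norm (fst (right_tri e)))"
    "real_of_int (sup_norm (fst (left_tri e))) \<le> radius e"
    "real_of_int (sup_norm (fst (right_tri e))) \<le> radius e"
    using sup_norm_bordering_tri[of e] unfolding radius_def by linarith+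
  have "2 ^ k < a \<or> 2 ^ k < b"
    using differ layer_inside[of "left_tri e" k] layer_inside[of "right_tri e" k]
    unfolding a_def b_def by (metis not_less)
  moreover have "a \<le> 2 * radius e + 3/5" "b \<le> 2 * radius e + 3/5"
    using cmod_centroid_le[of "left_tri e"] cmod_centroid_le[of "right_tri e"] sup_norm
    unfolding a_def b_def by linarith+
  ultimately have "2 ^ k < 2 * radius e + 3/5" by linarith
  then show "2 ^ k / 5 \<le> radius e" using one_le by argo
  have "a < 2 ^ Suc k \<or> b < 2 ^ Suc k"
    using differ layer_outside[of k "left_tri e"] layer_outside[of k "right_tri e"]
    unfolding a_def b_def by (metis not_less)
  moreover have "4/5 * (radius e - 2) - 3/5 \<le> a" "4/5 * (radius e - 2) - 3/5 \<le> b"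
    using cmod_centroid_ge[of "left_tri e"] cmod_centroid_ge[of "right_tri e"] sup_norm
    unfolding a_def b_def by argo+
  ultimately have "4/5 * (radius e - 2) - 3/5 < 2 ^ Suc k" by linarith
  then show "radius e \<le> 6 * 2 ^ k" using one_le unfolding power_Suc by argo
qed

definition layer_energy :: real where
  "layer_energy = 36 * 48 * 6 * 5"

lemma sum_cograd_layer_le:
  assumes "finite S"
  shows "(\<Sum>e\<in>S. \<bar>cograd (layer k) e\<bar> * \<bar>cograd log_dist e\<bar>) \<le> layer_energy"
proof -
  define A where "A = {e\<in>S. cograd (layer k) e \<noteq> 0}"
  have "(\<Sum>e\<in>S. \<bar>cograd (layer k) e\<bar> * \<bar>cograd log_dist e\<bar>)
      = (\<Sum>e\<in>A. \<bar>cograd (layer k) e\<bar> * \<bar>cograd log_dist e\<bar>)"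
    by (rule sum.mono_neutral_right) (use assms in \<open>auto simp: A_def\<close>)
  also have "\<dots> \<le> (\<Sum>e\<in>A. 36 * (1 / (radius e)\<^sup>2))"
  proof (rule sum_mono)
    fix e
    have "\<bar>cograd (layer k) e\<bar> \<le> \<bar>cograd log_dist e\<bar>"
      using sum_abs_cograd_layer_le[of "{k}" e] by simp
    then have "\<bar>cograd (layer k) e\<bar> * \<bar>cograd log_dist e\<bar> \<le> (6 / radius e) * (6 / radius e)"
      using abs_cograd_log_dist_le_inverse_radius[of e] by (intro mult_mono) auto
    then show "\<bar>cograd (layer k) e\<bar> * \<bar>cograd log_dist e\<bar> \<le> 36 * (1 / (radius e)\<^sup>2)"
      by (simp add: power2_eq_square)
  qed
  also have "\<dots> = 36 * (\<Sum>e\<in>A. 1 / (radius e)\<^sup>2)" by (simp add: sum_distrib_left)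
  also have "(\<Sum>e\<in>A. 1 / (radius e)\<^sup>2) \<le> 48 * (6 * 2 ^ k) / (2 ^ k / 5)"
    using assms radius_if_cograd_layer_nonzero
    by (intro sum_inverse_radius_square_le) (auto simp: A_def)
  finally show ?thesis by (simp add: layer_energy_def)
qed

lemma sum_square_cograd_layers_le:
  assumes "finite S" "finite B"
  shows "(\<Sum>e\<in>S. (cograd (layers B) e)\<^sup>2) \<le> layer_energy * real (card B)"
proof -
  have "(cograd (layers B) e)\<^sup>2 \<le> (\<Sum>k\<in>B. \<bar>cograd (layer k) e\<bar> * \<bar>cograd log_dist e\<bar>)" for e
  proof -
    have "\<bar>cograd (layers B) e\<bar> * \<bar>cograd (layers B) e\<bar>
        \<le> (\<Sum>k\<in>B. \<bar>cograd (layer k) e\<bar>) * \<bar>cograd log_dist e\<bar>"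
      using abs_cograd_layers_le[OF assms(2), of e] sum_abs_cograd_layer_le[OF assms(2), of e]
      by (intro mult_mono) (auto intro: sum_nonneg)
    then show ?thesis by (simp add: power2_eq_square sum_distrib_right)
  qed
  then have "(\<Sum>e\<in>S. (cograd (layers B) e)\<^sup>2)
      \<le> (\<Sum>e\<in>S. \<Sum>k\<in>B. \<bar>cograd (layer k) e\<bar> * \<bar>cograd log_dist e\<bar>)"
    by (intro sum_mono)
  also have "\<dots> = (\<Sum>k\<in>B. \<Sum>e\<in>S. \<bar>cograd (layer k) e\<bar> * \<bar>cograd log_dist e\<bar>)"
    by (rule sum.swap)
  also have "\<dots> \<le> (\<Sum>k\<in>B. layer_energy)" by (intro sum_mono sum_cograd_layer_le assms)
  finally show ?thesis by (simp add: mult.commute)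
qed

lemma layers_summation_by_parts:
  assumes "B \<subseteq> {..<M}" "finite (charged a)"
  shows "(\<Sum>e\<in>edges (Suc (2 * 2 ^ M)). a e * cograd (layers B) e)
    = (\<Sum>T\<in>charged a. (layers B T - real (card B) * ln 2) * curl a T)"
proof (rule summation_by_parts)
  fix T assume "T \<notin> tris (2 * 2 ^ M)"
  then have "layers B T = (\<Sum>k\<in>B. ln 2)"
    unfolding layers_def using assms(1) by (intro sum.cong layer_outside_tris) auto
  then show "layers B T = real (card B) * ln 2" by simp
qed (rule assms(2))

subsection \<open>Square-summable perturbations\<close>

text \<open>A cutoff that decays logarithmically over \<open>n\<close> dyadic scales has Dirichlet energy of order
  \<open>1 / n\<close>, so a square-summable form carries no net charge.\<close>
lemma net_charge_eq_0_if_l2_bounded: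
  assumes square_summable: "l2_bounded a G" and finite_charges: "finite (charged a)"
  shows "net_charge a = 0"
proof (rule ccontr)
  assume "net_charge a \<noteq> 0"
  then have charge_pos: "0 < (ln 2 * net_charge a)\<^sup>2" by simp
  obtain m where enclosing: "Max (insert 0 ((\<lambda>T. cmod (centroid T)) ` charged a)) \<le> 2 ^ m"
    using exists_pow2_ge by blast
  have inside: "cmod (centroid T) \<le> 2 ^ m" if "T \<in> charged a" for T
    by (rule order_trans[OF Max_ge enclosing]) (use that finite_charges in auto)
  obtain n :: nat where many_layers: "G * layer_energy / (ln 2 * net_charge a)\<^sup>2 < real n"
    using reals_Archimedean2 by blast
  define B where "B = {m..<m + n}"
  define E where "E = edges (Suc (2 * 2 ^ (m + n)))"
  have "layers B T = 0" if "T \<in> charged a" for T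
    unfolding layers_def
  proof (rule sum.neutral, rule ballI)
    fix k assume "k \<in> B"
    then have "(2::real) ^ m \<le> 2 ^ k" by (auto simp: B_def)
    then show "layer k T = 0" using inside[OF that] by (intro layer_inside) linarith
  qed
  then have "(\<Sum>T\<in>charged a. (layers B T - real (card B) * ln 2) * curl a T)
      = - (real n * ln 2) * net_charge a"
    by (simp add: B_def net_charge_def sum_distrib_left)
  then have "(\<Sum>e\<in>E. a e * cograd (layers B) e) = - (real n * ln 2) * net_charge a"
    unfolding E_def by (subst layers_summation_by_parts) (auto simp: B_def finite_charges)
  then have "real n * (real n * (ln 2 * net_charge a)\<^sup>2) = (\<Sum>e\<in>E. a e * cograd (layers B) e)\<^sup>2"
    by (simp add: power2_eq_square mult_ac)
  also have "\<dots> \<le> (\<Sum>e\<in>E. (a e)\<^sup>2) * (\<Sum>e\<in>E. (cograd (layers B) e)\<^sup>2)"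
    by (rule Cauchy_Schwarz_ineq_sum)
  also have "\<dots> \<le> G * (layer_energy * real (card B))"
    using square_summable l2_bounded_nonneg[OF square_summable]
    by (intro mult_mono l2_boundedD sum_square_cograd_layers_le sum_nonneg) (auto simp: E_def B_def)
  finally have "real n * (real n * (ln 2 * net_charge a)\<^sup>2) \<le> real n * (G * layer_energy)"
    by (simp add: B_def mult_ac)
  moreover have "0 < real n"
    using many_layers l2_bounded_nonneg[OF square_summable] charge_pos
    by (smt (verit) divide_nonneg_pos layer_energy_def mult_nonneg_nonneg)
  ultimately have "real n * (ln 2 * net_charge a)\<^sup>2 \<le> G * layer_energy" by simp
  then show False using many_layers charge_pos by (simp add: pos_divide_less_eq)
qed

locale l2_perturbed_dislocation =
  fixes \<alpha> :: "edge \<Rightarrow> real" and G :: real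
  assumes curl_Ints: "\<And>T. curl \<alpha> T \<in> \<int>"
    and l2_bounded_diff: "l2_bounded (\<lambda>e. \<alpha> e - angle_form e) G"
begin

lemma finite_large:
  assumes "0 < \<delta>" shows "finite {e. \<delta> \<le> \<bar>\<alpha> e\<bar>}"
proof -
  obtain N :: nat where tail: "4 / \<delta> < real N" using reals_Archimedean2 by blast
  have "e \<in> edges N" if "\<delta> \<le> \<bar>\<alpha> e\<bar>" "\<not> \<delta> / 2 \<le> \<bar>\<alpha> e - angle_form e\<bar>" for e
  proof (rule ccontr)
    assume "e \<notin> edges N"
    then have "4 / \<delta> < radius e" using tail radius_gt_if_not_mem_edges[of e N] by linarith
    then have "2 / radius e < \<delta> / 2" using assms by (simp add: field_simps)
    then show False using that abs_angle_form_le_inverse_radius[of e] by linarith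
  qed
  then have "{e. \<delta> \<le> \<bar>\<alpha> e\<bar>} \<subseteq> {e. \<delta> / 2 \<le> \<bar>\<alpha> e - angle_form e\<bar>} \<union> edges N" by blast
  moreover have "finite ({e. \<delta> / 2 \<le> \<bar>\<alpha> e - angle_form e\<bar>} \<union> edges N)"
    using assms by (intro finite_UnI l2_bounded_imp_finite_ge[OF l2_bounded_diff]) simp_all
  ultimately show ?thesis by (rule finite_subset)
qed

lemma finite_charged: "finite (charged \<alpha>)"
  by (intro finite_charged_if_finite_large curl_Ints finite_large) simp

lemma curl_diff_angle_form:
  "curl (\<lambda>e. \<alpha> e - angle_form e) T = curl \<alpha> T - (if T = (0, True) then 1 else 0)"
  by (simp add: curl_diff curl_angle_form)

lemma finite_charged_diff: "finite (charged (\<lambda>e. \<alpha> e - angle_form e))"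
  by (rule finite_subset[of _ "insert (0, True) (charged \<alpha>)"])
    (auto simp: charged_def[of "\<lambda>e. \<alpha> e - angle_form e"] charged_def[of \<alpha>] curl_diff_angle_form
      finite_charged[unfolded charged_def])

lemma sum_charged_diff:
  "(\<Sum>T\<in>charged (\<lambda>e. \<alpha> e - angle_form e). f T * curl (\<lambda>e. \<alpha> e - angle_form e) T)
    = (\<Sum>T\<in>charged \<alpha>. f T * curl \<alpha> T) - f (0, True)"
proof -
  define X where "X = insert (0, True) (charged \<alpha>)"
  have support: "finite X" "(0, True) \<in> X" using finite_charged by (simp_all add: X_def)
  have "(\<Sum>T\<in>charged (\<lambda>e. \<alpha> e - angle_form e). f T * curl (\<lambda>e. \<alpha> e - angle_form e) T)
      = (\<Sum>T\<in>X. f T * curl (\<lambda>e. \<alpha> e - angle_form e) T)"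
    by (rule sum.mono_neutral_left)
      (use support in \<open>auto simp: X_def charged_def curl_diff_angle_form\<close>)
  also have "\<dots> = (\<Sum>T\<in>X. f T * curl \<alpha> T) - (\<Sum>T\<in>X. if T = (0, True) then f T else 0)"
    unfolding curl_diff_angle_form right_diff_distrib sum_subtractf
    by (simp add: if_distrib cong: if_cong)
  also have "(\<Sum>T\<in>X. if T = (0, True) then f T else 0) = f (0, True)"
    using support by simp
  also have "(\<Sum>T\<in>X. f T * curl \<alpha> T) = (\<Sum>T\<in>charged \<alpha>. f T * curl \<alpha> T)"
    by (rule sum.mono_neutral_right) (use support in \<open>auto simp: X_def charged_def\<close>)
  finally show ?thesis .
qed

lemma net_charge_eq_1: "net_charge \<alpha> = 1"
proof -
  have "net_charge (\<lambda>e. \<alpha> e - angle_form e) = 0"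
    using l2_bounded_diff finite_charged_diff by (rule net_charge_eq_0_if_l2_bounded)
  then show ?thesis using sum_charged_diff[of "\<lambda>_. 1"] by (simp add: net_charge_def)
qed

end

section \<open>Filling a box\<close>

definition inner_edges :: "nat \<Rightarrow> edge set" where
  "inner_edges s = {e. sup_norm (src e) \<le> int s \<and> sup_norm (tgt e) \<le> int s}"

definition ring_edges :: "nat \<Rightarrow> edge set" where
  "ring_edges s = {e. sup_norm (src e) = int s \<and> sup_norm (tgt e) = int s}"

definition grid :: "nat \<Rightarrow> nat \<Rightarrow> nat \<Rightarrow> lpt" where
  "grid s i j = (int i - int s, int j - int s)"

lemma inner_edges_subset: "inner_edges s \<subseteq> edges s"
proof
  fix e assume "e \<in> inner_edges s"
  then show "e \<in> edges s"
    by (cases e rule: edge_cases) (auto simp: inner_edges_def mem_edges sup_norm_def)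
qed

lemma ring_edges_subset: "ring_edges s \<subseteq> inner_edges s"
  by (auto simp: ring_edges_def inner_edges_def)

lemma finite_inner_edges [simp]: "finite (inner_edges s)"
  by (rule finite_subset[OF inner_edges_subset]) simp

lemma finite_ring_edges [simp]: "finite (ring_edges s)"
  by (rule finite_subset[OF ring_edges_subset]) simp

lemma sides_subset_inner_edges:
  assumes "fst T = 0" "1 \<le> s" shows "sides T \<subseteq> inner_edges s"
  using assms by (cases T rule: tri_cases) (auto simp: inner_edges_def sup_norm_def)

lemma grid_add: "grid s i j + (1, 0) = grid s (Suc i) j" "grid s i j + (0, 1) = grid s i (Suc j)"
  by (auto simp: grid_def)

lemma grid_eq_iff: "grid s i j = grid s i' j' \<longleftrightarrow> i = i' \<and> j = j'"
  by (auto simp: grid_def)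

lemma sup_norm_grid_le_iff: "sup_norm (grid s i j) \<le> int s \<longleftrightarrow> i \<le> 2 * s \<and> j \<le> 2 * s"
  by (auto simp: grid_def sup_norm_def)

lemma exists_grid:
  assumes "sup_norm x \<le> int s" obtains i j where "i \<le> 2 * s" "j \<le> 2 * s" "x = grid s i j"
proof
  show "nat (fst x + int s) \<le> 2 * s" "nat (snd x + int s) \<le> 2 * s"
    "x = grid s (nat (fst x + int s)) (nat (snd x + int s))"
    using assms by (cases x; auto simp: grid_def sup_norm_def)+
qed

lemma inner_edges_eq:
  "inner_edges s = (\<lambda>(i, j). (grid s i j, E0)) ` ({..<2 * s} \<times> {..2 * s})
    \<union> (\<lambda>(i, j). (grid s i j, E1)) ` ({..2 * s} \<times> {..<2 * s})
    \<union> (\<lambda>(i, j). (grid s i j, E2)) ` ({..<2 * s} \<times> {..<2 * s})" (is "_ = ?images")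
proof (intro equalityI subsetI)
  fix e assume inner: "e \<in> inner_edges s"
  then have "sup_norm (fst e) \<le> int s"
    using subsetD[OF inner_edges_subset] by (simp only: mem_edges)
  then obtain i j where "fst e = grid s i j" by (rule exists_grid)
  then show "e \<in> ?images"
    using inner
    by (cases e rule: edge_cases) (auto simp: inner_edges_def grid_add sup_norm_grid_le_iff)
qed (auto simp: inner_edges_def grid_add sup_norm_grid_le_iff)

lemma sum_inner_edges:
  fixes g :: "edge \<Rightarrow> real"
  shows "(\<Sum>e\<in>inner_edges s. g e) = (\<Sum>i<2 * s. \<Sum>j\<le>2 * s. g (grid s i j, E0))
    + (\<Sum>i\<le>2 * s. \<Sum>j<2 * s. g (grid s i j, E1)) + (\<Sum>i<2 * s. \<Sum>j<2 * s. g (grid s i j, E2))"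
  unfolding inner_edges_eq
  by (subst sum.union_disjoint; (subst sum.union_disjoint)?)
    (auto simp: sum.reindex inj_on_def grid_eq_iff sum.cartesian_product case_prod_unfold)

lemma boundary_sum_le_sum_ring_edges:
  fixes g :: "edge \<Rightarrow> real"
  assumes "1 \<le> s" "\<And>e. 0 \<le> g e"
  shows "boundary_sum (2 * s) (\<lambda>i j. g (grid s i j, E0)) (\<lambda>i j. g (grid s i j, E1))
    \<le> (\<Sum>e\<in>ring_edges s. g e)"
proof -
  define bottom where "bottom = (\<lambda>i. (grid s i 0, E0)) ` {..<2 * s}"
  define top_side where "top_side = (\<lambda>i. (grid s i (2 * s), E0)) ` {..<2 * s}"
  define left where "left = (\<lambda>j. (grid s 0 j, E1)) ` {..<2 * s}"
  define right where "right = (\<lambda>j. (grid s (2 * s) j, E1)) ` {..<2 * s}"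
  note side_defs = bottom_def top_side_def left_def right_def
  have "boundary_sum (2 * s) (\<lambda>i j. g (grid s i j, E0)) (\<lambda>i j. g (grid s i j, E1))
      = sum g bottom + sum g top_side + sum g left + sum g right"
    unfolding side_defs boundary_sum_def
    by (subst (1 2 3 4) sum.reindex) (auto simp: inj_on_def grid_eq_iff)
  also have "\<dots> = sum g (bottom \<union> top_side \<union> left \<union> right)"
    using assms(1)
    by (subst sum.union_disjoint; (subst sum.union_disjoint)?; (subst sum.union_disjoint)?)
      (auto simp: side_defs grid_eq_iff)
  also have "\<dots> \<le> (\<Sum>e\<in>ring_edges s. g e)"
  proof (rule sum_mono2)
    show "bottom \<union> top_side \<union> left \<union> right \<subseteq> ring_edges s"
      by (auto simp: side_defs ring_edges_def grid_def sup_norm_def)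
  qed (use assms in auto)
  finally show ?thesis .
qed

lemma sum_square_grad_inner_edges_le:
  fixes P :: "lpt \<Rightarrow> real"
  assumes "\<And>i j. P (grid s i j) = Q i j"
  shows "(\<Sum>e\<in>inner_edges s. (grad P e)\<^sup>2)
    \<le> 3 * ((\<Sum>i<2 * s. \<Sum>j\<le>2 * s. (dx Q i j)\<^sup>2) + (\<Sum>i\<le>2 * s. \<Sum>j<2 * s. (dy Q i j)\<^sup>2))"
proof -
  have grad: "grad P (grid s i j, E0) = dx Q i j" "grad P (grid s i j, E1) = dy Q i j"
    "grad P (grid s i j, E2) = dy Q i j - dx Q i j" for i j
    by (simp_all add: grad_def grid_add assms dx_def dy_def)
  have "(dy Q i j - dx Q i j)\<^sup>2 \<le> 2 * (dx Q i j)\<^sup>2 + 2 * (dy Q i j)\<^sup>2" for i j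
    using zero_le_power2[of "dx Q i j + dy Q i j"] by (simp add: power2_eq_square algebra_simps)
  then have "(\<Sum>i<2 * s. \<Sum>j<2 * s. (dy Q i j - dx Q i j)\<^sup>2)
      \<le> (\<Sum>i<2 * s. \<Sum>j<2 * s. 2 * (dx Q i j)\<^sup>2 + 2 * (dy Q i j)\<^sup>2)"
    by (intro sum_mono)
  also have "\<dots> = 2 * (\<Sum>i<2 * s. \<Sum>j<2 * s. (dx Q i j)\<^sup>2) + 2 * (\<Sum>i<2 * s. \<Sum>j<2 * s. (dy Q i j)\<^sup>2)"
    by (simp add: sum.distrib sum_distrib_left)
  also have "(\<Sum>i<2 * s. \<Sum>j<2 * s. (dx Q i j)\<^sup>2) \<le> (\<Sum>i<2 * s. \<Sum>j\<le>2 * s. (dx Q i j)\<^sup>2)"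
    by (intro sum_mono sum_mono2) auto
  also have "(\<Sum>i<2 * s. \<Sum>j<2 * s. (dy Q i j)\<^sup>2) \<le> (\<Sum>i\<le>2 * s. \<Sum>j<2 * s. (dy Q i j)\<^sup>2)"
    by (intro sum_mono2) (auto intro!: sum_nonneg)
  finally show ?thesis unfolding sum_inner_edges grad by simp
qed

lemma sum_square_grad_coons_le:
  fixes P :: "lpt \<Rightarrow> real"
  assumes size: "1 \<le> s" and P_grid: "\<And>i j. P (grid s i j) = coons (2 * s) f i j"
    and sides_le: "boundary_sum (2 * s) (\<lambda>i j. (dx f i j)\<^sup>2) (\<lambda>i j. (dy f i j)\<^sup>2) \<le> \<rho>"
  shows "(\<Sum>e\<in>inner_edges s. (grad P e)\<^sup>2) \<le> 1224 * (real s * \<rho>)"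
proof -
  define n where "n = 2 * s"
  have "0 < n" using size by (simp add: n_def)
  have "real n * boundary_sum n (\<lambda>i j. (dx f i j)\<^sup>2) (\<lambda>i j. (dy f i j)\<^sup>2) \<le> real n * \<rho>"
    using sides_le by (intro mult_left_mono) (simp_all add: n_def)
  then have "(\<Sum>i<n. \<Sum>j\<le>n. (dx (coons n f) i j)\<^sup>2) + (\<Sum>i\<le>n. \<Sum>j<n. (dy (coons n f) i j)\<^sup>2)
      \<le> 204 * (real n * \<rho>)"
    using coons_energy_le[OF \<open>0 < n\<close>, of f] by simp
  then have "3 * ((\<Sum>i<n. \<Sum>j\<le>n. (dx (coons n f) i j)\<^sup>2) + (\<Sum>i\<le>n. \<Sum>j<n. (dy (coons n f) i j)\<^sup>2))
      \<le> 1224 * (real s * \<rho>)"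
    by (simp add: n_def)
  with sum_square_grad_inner_edges_le[of P s "coons (2 * s) f", OF P_grid, folded n_def]
  show ?thesis by (rule order_trans)
qed

lemma exists_box_filling:
  assumes size: "1 \<le> s" and congruent: "\<And>e. grad y e - a e \<in> \<int>"
    and small: "8 * real s * (\<Sum>e\<in>ring_edges s. (a e)\<^sup>2) < 1"
  shows "\<exists>P. (\<forall>x. sup_norm x = int s \<longrightarrow> P x - y x \<in> \<int>) \<and>
    (\<Sum>e\<in>inner_edges s. (grad P e)\<^sup>2) \<le> 1224 * (real s * (\<Sum>e\<in>ring_edges s. (a e)\<^sup>2))"
proof -
  define n where "n = 2 * s"
  define \<rho> where "\<rho> = (\<Sum>e\<in>ring_edges s. (a e)\<^sup>2)"
  define h v where "h i j = a (grid s i j, E0)" and "v i j = a (grid s i j, E1)" for i j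
  have n_pos: "0 < n" using size by (simp add: n_def)
  have sides_le: "boundary_sum n (\<lambda>i j. (h i j)\<^sup>2) (\<lambda>i j. (v i j)\<^sup>2) \<le> \<rho>"
    unfolding n_def h_def v_def \<rho>_def by (rule boundary_sum_le_sum_ring_edges) (use size in auto)
  have "(boundary_sum n (\<lambda>i j. \<bar>h i j\<bar>) (\<lambda>i j. \<bar>v i j\<bar>))\<^sup>2 \<le> 4 * (real n * \<rho>)"
    by (rule order_trans[OF square_boundary_sum_abs_le]) (intro mult_left_mono sides_le; simp)
  also have "\<dots> < 1\<^sup>2" using small by (simp add: n_def \<rho>_def)
  finally have small_sides: "boundary_sum n (\<lambda>i j. \<bar>h i j\<bar>) (\<lambda>i j. \<bar>v i j\<bar>) < 1"
    by (rule power_less_imp_less_base) simp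
  have increments: "dx (\<lambda>i j. y (grid s i j)) i j - h i j \<in> \<int>"
    "dy (\<lambda>i j. y (grid s i j)) i j - v i j \<in> \<int>" for i j
    using congruent[of "(grid s i j, E0)"] congruent[of "(grid s i j, E1)"]
    by (simp_all add: h_def v_def dx_def dy_def grad_def grid_add)
  obtain f where boundary: "\<And>i j. i \<in> {0, n} \<or> j \<in> {0, n} \<Longrightarrow> f i j - y (grid s i j) \<in> \<int>"
    and increments_f: "\<And>i. dx f i 0 = h i 0" "\<And>i. dx f i n = h i n"
      "\<And>j. dy f 0 j = v 0 j" "\<And>j. dy f n j = v n j"
    using exists_boundary_lift[OF n_pos increments small_sides] by blast
  define P where "P x = coons n f (nat (fst x + int s)) (nat (snd x + int s))" for x :: lpt
  have P_grid: "P (grid s i j) = coons n f i j" for i j by (simp add: P_def grid_def)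
  have "P x - y x \<in> \<int>" if on_boundary: "sup_norm x = int s" for x
  proof -
    obtain i j where coordinates: "i \<le> n" "j \<le> n" "x = grid s i j"
      using exists_grid[of x s] on_boundary unfolding n_def by auto
    moreover from this have "i \<in> {0, n} \<or> j \<in> {0, n}"
      using on_boundary by (auto simp: grid_def sup_norm_def n_def)
    ultimately show ?thesis using boundary n_pos by (simp add: P_grid coons_boundary)
  qed
  moreover have "boundary_sum n (\<lambda>i j. (dx f i j)\<^sup>2) (\<lambda>i j. (dy f i j)\<^sup>2) \<le> \<rho>"
    using sides_le by (simp add: boundary_sum_def increments_f)
  then have "(\<Sum>e\<in>inner_edges s. (grad P e)\<^sup>2) \<le> 1224 * (real s * \<rho>)"
    using sum_square_grad_coons_le[OF size] P_grid unfolding n_def by blast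
  ultimately show ?thesis unfolding \<rho>_def by blast
qed

section \<open>Energies and near minimisers\<close>

definition strain :: "(lpt \<Rightarrow> real) \<Rightarrow> edge \<Rightarrow> real" where
  "strain y e = wrap (grad y e)"

definition grad_support :: "(lpt \<Rightarrow> real) \<Rightarrow> edge set" where
  "grad_support v = {e. grad v e \<noteq> 0}"

lemma grad_strain_congruent: "grad y e - strain y e \<in> \<int>"
  by (simp add: strain_def diff_wrap_Ints)

lemma curl_strain_Ints: "curl (strain y) T \<in> \<int>"
  by (rule curl_Ints_congruent[OF grad_strain_congruent])

lemma strain_angle: "strain angle = angle_form"
  by (simp add: fun_eq_iff strain_def wrap_grad_angle)

lemma strain_shift: "strain (\<lambda>x. y (x + p)) = (\<lambda>e. strain y (shift_edge p e))"
  by (simp add: fun_eq_iff strain_def grad_shift)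

lemma grad_support_add: "grad_support (\<lambda>x. u x + v x) \<subseteq> grad_support u \<union> grad_support v"
  by (auto simp: grad_support_def grad_add)

lemma grad_support_shift: "grad_support (\<lambda>x. v (x - p)) = shift_edge p ` grad_support v"
proof (intro equalityI subsetI)
  fix e assume "e \<in> grad_support (\<lambda>x. v (x - p))"
  then have "shift_edge (- p) e \<in> grad_support v" by (simp add: grad_support_def grad_def)
  then show "e \<in> shift_edge p ` grad_support v" by (rule rev_image_eqI) simp
qed (auto simp: grad_support_def grad_def)

locale potential =
  fixes \<psi> :: "real \<Rightarrow> real" and \<mu> K\<^sub>2 K\<^sub>3 :: real
  assumes periodic: "\<psi> (x + 1) = \<psi> x"
    and continuous: "continuous_on UNIV \<psi>"
    and pos: "0 < \<mu>" "0 < K\<^sub>2" "0 < K\<^sub>3"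
    and quadratic_lower: "\<bar>x\<bar> \<le> 1/2 \<Longrightarrow> \<mu> / 2 * x\<^sup>2 \<le> \<psi> x"
    and quadratic_upper: "\<psi> x \<le> K\<^sub>2 * x\<^sup>2"
    and cubic_upper: "\<bar>x\<bar> \<le> 1/2 \<Longrightarrow> \<psi> x \<le> \<mu> / 2 * x\<^sup>2 + K\<^sub>3 * \<bar>x\<bar> ^ 3"
begin

sublocale periodic_fun_simple' \<psi>
  by standard (rule periodic)

lemma psi_cong: "a - b \<in> \<int> \<Longrightarrow> \<psi> a = \<psi> b"
  using plus_of_int[of b] by (auto elim!: Ints_cases simp: algebra_simps)

lemma psi_grad: "\<psi> (grad y e) = \<psi> (strain y e)"
  by (rule psi_cong[OF grad_strain_congruent])

lemma psi_grad_ge: "\<mu> / 2 * (strain y e)\<^sup>2 \<le> \<psi> (grad y e)"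
  unfolding psi_grad strain_def by (rule quadratic_lower) (rule abs_wrap_le)

lemma psi_grad_nonneg: "0 \<le> \<psi> (grad y e)"
  by (rule order_trans[OF _ psi_grad_ge]) (simp add: pos(1) less_imp_le)

definition energy :: "(lpt \<Rightarrow> real) \<Rightarrow> (lpt \<Rightarrow> real) \<Rightarrow> real" where
  "energy y v = (\<Sum>e\<in>grad_support v. \<psi> (grad y e + grad v e) - \<psi> (grad y e))"

definition near_minimiser :: "real \<Rightarrow> (lpt \<Rightarrow> real) \<Rightarrow> bool" where
  "near_minimiser \<epsilon> y \<longleftrightarrow> (\<forall>v. finite (grad_support v) \<longrightarrow>
    - \<epsilon> * (1 + real (card (grad_support v))) \<le> energy y v)"

definition competitor :: "(lpt \<Rightarrow> real) \<Rightarrow> bool" where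
  "competitor y \<longleftrightarrow> (\<exists>p u. finite (grad_support u) \<and> energy angle u \<le> 0 \<and>
    y = (\<lambda>x. angle (x + p) + u (x + p)))"

lemma energy_superset:
  assumes "finite S" "grad_support v \<subseteq> S"
  shows "energy y v = (\<Sum>e\<in>S. \<psi> (grad (\<lambda>x. y x + v x) e)) - (\<Sum>e\<in>S. \<psi> (grad y e))"
  unfolding energy_def grad_add sum_subtractf[symmetric]
  by (rule sum.mono_neutral_left) (use assms in \<open>auto simp: grad_support_def\<close>)

lemma energy_add:
  assumes "finite (grad_support u)" "finite (grad_support v)"
  shows "energy (\<lambda>x. y x + u x) v = energy y (\<lambda>x. u x + v x) - energy y u"
proof -
  define S where "S = grad_support u \<union> grad_support v"
  have "finite S" "grad_support u \<subseteq> S" "grad_support v \<subseteq> S" "grad_support (\<lambda>x. u x + v x) \<subseteq> S"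
    using assms grad_support_add by (auto simp: S_def)
  then show ?thesis by (simp add: energy_superset[of S] add.assoc)
qed

lemma energy_shift: "energy (\<lambda>x. y (x + p)) v = energy y (\<lambda>x. v (x - p))"
  unfolding energy_def grad_support_shift
  by (subst sum.reindex[OF inj_shift_edge]) (simp add: grad_def)

lemma near_minimiser_shift:
  assumes "near_minimiser \<epsilon> y" shows "near_minimiser \<epsilon> (\<lambda>x. y (x + p))"
  unfolding near_minimiser_def
proof (intro allI impI)
  fix v assume "finite (grad_support v)"
  moreover have "card (grad_support (\<lambda>x. v (x - p))) = card (grad_support v)"
    unfolding grad_support_shift by (rule card_image[OF inj_shift_edge])
  ultimately show "- \<epsilon> * (1 + real (card (grad_support v))) \<le> energy (\<lambda>x. y (x + p)) v"
    using assms unfolding near_minimiser_def energy_shift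
    by (metis finite_imageI grad_support_shift)
qed

lemma competitor_shift:
  assumes "competitor y" shows "competitor (\<lambda>x. y (x + q))"
proof -
  obtain p u
    where "finite (grad_support u)" "energy angle u \<le> 0" "y = (\<lambda>x. angle (x + p) + u (x + p))"
    using assms unfolding competitor_def by blast
  then show ?thesis
    unfolding competitor_def by (intro exI[of _ "q + p"] exI[of _ u]) (simp add: add.assoc)
qed

lemma psi_grad_angle_small:
  assumes "0 < \<epsilon>" shows "\<exists>N. \<forall>e. e \<notin> edges N \<longrightarrow> \<psi> (grad angle e) \<le> \<epsilon>"
proof -
  obtain N :: nat where tail: "4 * K\<^sub>2 / \<epsilon> < real N" using reals_Archimedean2 by blast
  have "\<psi> (grad angle e) \<le> \<epsilon>" if "e \<notin> edges N" for e
  proof -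
    have "4 * K\<^sub>2 / \<epsilon> \<le> radius e" using tail radius_gt_if_not_mem_edges[OF that] by linarith
    have "\<psi> (grad angle e) \<le> K\<^sub>2 * (angle_form e)\<^sup>2"
      unfolding psi_grad strain_angle by (rule quadratic_upper)
    also have "\<dots> \<le> K\<^sub>2 * (4 / (radius e)\<^sup>2)"
      using pos by (intro mult_left_mono angle_form_square_le) auto
    also have "\<dots> = 4 * K\<^sub>2 / radius e / radius e" by (simp add: power2_eq_square)
    also have "\<dots> \<le> 4 * K\<^sub>2 / radius e / 1"
      using radius_ge_1[of e] pos by (intro divide_left_mono) auto
    also have "\<dots> \<le> \<epsilon>" using \<open>4 * K\<^sub>2 / \<epsilon> \<le> radius e\<close> assms by (simp add: field_simps)
    finally show ?thesis .
  qed
  then show ?thesis by blast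
qed

lemma penalised_energy_bounded_below:
  assumes "0 < \<epsilon>"
  shows "\<exists>m. \<forall>u. finite (grad_support u) \<longrightarrow> m \<le> energy angle u + \<epsilon> * real (card (grad_support u))"
proof -
  obtain N where small_outside: "\<And>e. e \<notin> edges N \<Longrightarrow> \<psi> (grad angle e) \<le> \<epsilon>"
    using psi_grad_angle_small[OF assms] by blast
  define m where "m = (\<Sum>e\<in>edges N. \<psi> (grad angle e))"
  have "- m \<le> energy angle u + \<epsilon> * real (card (grad_support u))"
    if finite_support: "finite (grad_support u)" for u
  proof -
    have "\<psi> (grad angle e) \<le> \<epsilon> + (if e \<in> edges N then \<psi> (grad angle e) else 0)" for e
      using small_outside assms by auto
    then have "(\<Sum>e\<in>grad_support u. \<psi> (grad angle e))
        \<le> (\<Sum>e\<in>grad_support u. \<epsilon> + (if e \<in> edges N then \<psi> (grad angle e) else 0))"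
      by (rule sum_mono)
    also have "\<dots> = \<epsilon> * real (card (grad_support u))
        + (\<Sum>e\<in>grad_support u \<inter> edges N. \<psi> (grad angle e))"
      by (simp add: sum.distrib sum.inter_restrict[OF finite_support] mult.commute)
    also have "(\<Sum>e\<in>grad_support u \<inter> edges N. \<psi> (grad angle e)) \<le> m"
      unfolding m_def using psi_grad_nonneg by (intro sum_mono2) auto
    finally have "- m - \<epsilon> * real (card (grad_support u)) \<le> (\<Sum>e\<in>grad_support u. - \<psi> (grad angle e))"
      by (simp add: sum_negf)
    also have "\<dots> \<le> energy angle u"
      unfolding energy_def
      by (intro sum_mono) (use psi_grad_nonneg in \<open>simp add: grad_add[symmetric]\<close>)
    finally show ?thesis by linarith
  qed
  then show ?thesis by blast
qed

end

lemma exists_near_infimum: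
  fixes F :: "'a \<Rightarrow> real"
  assumes "x \<in> A" "0 < \<epsilon>" "\<And>u. u \<in> A \<Longrightarrow> m \<le> F u"
  shows "\<exists>u\<in>A. F u \<le> F x \<and> (\<forall>w\<in>A. F u \<le> F w + \<epsilon>)"
proof -
  have Inf_le: "Inf (F ` A) \<le> F w" if "w \<in> A" for w
    using assms(3) that by (intro cInf_lower bdd_belowI) auto
  obtain u where near_inf: "u \<in> A" "F u < Inf (F ` A) + \<epsilon>"
    using cInf_lessD[of "F ` A" "Inf (F ` A) + \<epsilon>"] assms(1,2) by auto
  define z where "z = (if F u \<le> F x then u else x)"
  have "z \<in> A" "F z \<le> F x" "F z \<le> F u" using assms(1) near_inf(1) by (auto simp: z_def)
  moreover have "F z \<le> F w + \<epsilon>" if "w \<in> A" for w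
    using Inf_le[OF that] near_inf(2) \<open>F z \<le> F u\<close> by linarith
  ultimately show ?thesis by blast
qed

context potential
begin

lemma exists_near_minimiser:
  assumes "0 < \<epsilon>" shows "\<exists>y. competitor y \<and> near_minimiser \<epsilon> y"
proof -
  define F where "F u = energy angle u + \<epsilon> * real (card (grad_support u))" for u
  have zero: "grad_support (\<lambda>_. 0) = {}" by (simp add: grad_support_def grad_def)
  then have F_zero: "F (\<lambda>_. 0) = 0" by (simp add: F_def energy_def)
  obtain m where "\<And>u. finite (grad_support u) \<Longrightarrow> m \<le> F u"
    using penalised_energy_bounded_below[OF assms] unfolding F_def by blast
  then obtain u where minimiser: "finite (grad_support u)" "F u \<le> 0"
    and least: "\<And>w. finite (grad_support w) \<Longrightarrow> F u \<le> F w + \<epsilon>"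
    using exists_near_infimum[of "\<lambda>_. 0" "{u. finite (grad_support u)}" \<epsilon> m F] assms zero F_zero
    by auto
  have "near_minimiser \<epsilon> (\<lambda>x. angle x + u x)"
    unfolding near_minimiser_def
  proof (intro allI impI)
    fix v assume variation: "finite (grad_support v)"
    define w where "w = (\<lambda>x. u x + v x)"
    have support_w: "grad_support w \<subseteq> grad_support u \<union> grad_support v"
      unfolding w_def by (rule grad_support_add)
    then have "card (grad_support w) \<le> card (grad_support u) + card (grad_support v)"
      using card_mono[OF _ support_w] card_Un_le[of "grad_support u" "grad_support v"]
        minimiser(1) variation
      by simp
    then have "\<epsilon> * real (card (grad_support w))
        \<le> \<epsilon> * real (card (grad_support u) + card (grad_support v))"
      using assms by (intro mult_left_mono of_nat_mono) auto
    moreover have "F u \<le> F w + \<epsilon>"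
      using least finite_subset[OF support_w] minimiser(1) variation by simp
    ultimately show "- \<epsilon> * (1 + real (card (grad_support v))) \<le> energy (\<lambda>x. angle x + u x) v"
      unfolding energy_add[OF minimiser(1) variation] w_def[symmetric] F_def
      by (simp add: algebra_simps)
  qed
  moreover have "0 \<le> \<epsilon> * real (card (grad_support u))" using assms by simp
  then have "energy angle u \<le> 0" using minimiser(2) unfolding F_def by linarith
  then have "competitor (\<lambda>x. angle x + u x)"
    using minimiser(1) unfolding competitor_def by (intro exI[of _ 0] exI[of _ u]) simp
  ultimately show ?thesis by blast
qed

end

lemma exists_potential:
  assumes cont: "continuous_on UNIV \<psi>"
    and C4: "C4_on (- {x. \<exists>k::int. x = real_of_int k + 1/2}) \<psi>"
    and periodic: "\<forall>x. \<psi> (x + 1) = \<psi> x"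
    and zeros: "\<forall>r. \<psi> r = 0 \<longleftrightarrow> r \<in> \<int>"
    and second_deriv: "(deriv ^^ 2) \<psi> 0 = \<mu>" "0 < \<mu>"
    and lower: "\<forall>x\<in>{-1/2..1/2}. 1/2 * \<mu> * x\<^sup>2 \<le> \<psi> x"
  shows "\<exists>K\<^sub>2 K\<^sub>3. potential \<psi> \<mu> K\<^sub>2 K\<^sub>3"
proof -
  have quadratic_lower: "\<mu> / 2 * x\<^sup>2 \<le> \<psi> x" if "\<bar>x\<bar> \<le> 1/2" for x
  proof -
    have "x \<in> {-1/2..1/2}" using that by auto
    then show ?thesis using lower by force
  qed
  have nonneg: "0 \<le> \<psi> x" if "\<bar>x\<bar> \<le> 1/4" for x
    by (rule order_trans[OF _ quadratic_lower]) (use second_deriv(2) that in auto)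
  have "{-(1/4)..1/4} \<subseteq> - {x. \<exists>k::int. x = real_of_int k + 1/2}"
  proof
    fix x :: real assume near_0: "x \<in> {-(1/4)..1/4}"
    have False if "x = real_of_int k + 1/2" for k
    proof -
      have "k < 0" "- 1 < k" using near_0 that by auto
      then show False by simp
    qed
    then show "x \<in> - {x. \<exists>k::int. x = real_of_int k + 1/2}" by blast
  qed
  then obtain C where "0 < C" "\<And>x. \<bar>x\<bar> \<le> 1/4 \<Longrightarrow> \<psi> x \<le> \<mu> / 2 * x\<^sup>2 + C * \<bar>x\<bar> ^ 3"
    using cubic_upper_near_0[OF C4, of "1/4"] nonneg zeros second_deriv(1) by auto
  moreover have "continuous_on {-1/2..1/2} \<psi>" using cont by (rule continuous_on_subset) simp
  ultimately obtain K\<^sub>3 where K\<^sub>3: "0 < K\<^sub>3" and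
      cubic_upper: "\<And>x. \<bar>x\<bar> \<le> 1/2 \<Longrightarrow> \<psi> x \<le> \<mu> / 2 * x\<^sup>2 + K\<^sub>3 * \<bar>x\<bar> ^ 3"
    using cubic_upper_extend[of "1/2" \<psi> "\<mu> / 2" "1/4" C] second_deriv(2) by auto
  have "\<psi> x \<le> (\<mu> / 2 + K\<^sub>3) * x\<^sup>2" for x
    using periodic K\<^sub>3 second_deriv(2) cubic_upper by (intro quadratic_upper_if_periodic) auto
  then have "potential \<psi> \<mu> (\<mu> / 2 + K\<^sub>3) K\<^sub>3"
    by unfold_locales (use periodic cont second_deriv(2) K\<^sub>3 quadratic_lower cubic_upper in auto)
  then show ?thesis by blast
qed

section \<open>Energy concentration at cores\<close>

definition box_separated :: "nat \<Rightarrow> tri set \<Rightarrow> bool" where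
  "box_separated r Y \<longleftrightarrow> pairwise (\<lambda>T T'. 2 * int r < sup_norm (fst T - fst T')) Y"

lemma box_separated_shift: "box_separated r Y \<Longrightarrow> box_separated r (shift_tri p ` Y)"
  by (auto simp: box_separated_def pairwise_def shift_tri_def)

definition box_around :: "nat \<Rightarrow> tri \<Rightarrow> edge set" where
  "box_around r T = shift_edge (fst T) ` edges r"

lemma finite_box_around [simp]: "finite (box_around r T)"
  by (simp add: box_around_def)

lemma card_box_around: "card (box_around r T) = 3 * (2 * r + 1)\<^sup>2"
  by (simp add: box_around_def card_image[OF inj_shift_edge] card_edges)

lemma box_around_disjoint:
  assumes "2 * int r < sup_norm (fst T - fst T')" shows "box_around r T \<inter> box_around r T' = {}"
proof (rule ccontr)
  assume "box_around r T \<inter> box_around r T' \<noteq> {}"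
  then obtain e e'
    where common: "e \<in> edges r" "e' \<in> edges r" "shift_edge (fst T) e = shift_edge (fst T') e'"
    unfolding box_around_def by blast
  then have "fst T - fst T' = fst e' - fst e" by (simp add: shift_edge_def algebra_simps)
  then have "sup_norm (fst T - fst T') \<le> sup_norm (fst e') + sup_norm (fst e)"
    using sup_norm_triangle_diff by metis
  then show False using assms common by (simp add: mem_edges)
qed

lemma sum_angle_form_boxes_le:
  assumes size: "1 \<le> r" and finite_Y: "finite Y"
  shows "(\<Sum>e\<in>(\<Union>T\<in>Y. box_around r T). (angle_form e)\<^sup>2)
    \<le> (\<Sum>e\<in>edges (4 * r). (angle_form e)\<^sup>2) + real (card Y) * (27/4)"
proof -
  define U where "U = (\<Union>T\<in>Y. box_around r T)"
  have finite_U: "finite U" using finite_Y by (simp add: U_def)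
  have "card U \<le> card Y * (3 * (2 * r + 1)\<^sup>2)"
    unfolding U_def using card_UN_le[OF finite_Y, of "box_around r"] by (simp add: card_box_around)
  also have "\<dots> \<le> card Y * (3 * (3 * r)\<^sup>2)" using size by (intro mult_left_mono power_mono) auto
  finally have "real (card U) \<le> real (card Y * (3 * (3 * r)\<^sup>2))" by (rule of_nat_mono)
  then have "real (card U) * (1 / (4 * (real r)\<^sup>2))
      \<le> real (card Y * (3 * (3 * r)\<^sup>2)) * (1 / (4 * (real r)\<^sup>2))"
    by (rule mult_right_mono) simp
  also have "\<dots> = real (card Y) * (27/4)" using size by (simp add: power_mult_distrib)
  finally have card_U: "real (card U) * (1 / (4 * (real r)\<^sup>2)) \<le> real (card Y) * (27/4)" .
  have far: "(angle_form e)\<^sup>2 \<le> 1 / (4 * (real r)\<^sup>2)" if "e \<notin> edges (4 * r)" for e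
  proof -
    have "4 * real r \<le> radius e" using radius_gt_if_not_mem_edges[OF that] by simp
    then have "4 / (radius e)\<^sup>2 \<le> 4 / (4 * real r)\<^sup>2"
      using size by (intro divide_left_mono power_mono mult_pos_pos) auto
    then show ?thesis using angle_form_square_le[of e] by (simp add: power_mult_distrib)
  qed
  have "(\<Sum>e\<in>U - edges (4 * r). (angle_form e)\<^sup>2)
      \<le> real (card (U - edges (4 * r))) * (1 / (4 * (real r)\<^sup>2))"
    using far by (intro sum_bounded_above) auto
  also have "\<dots> \<le> real (card U) * (1 / (4 * (real r)\<^sup>2))"
    using finite_U by (intro mult_right_mono of_nat_mono card_mono) auto
  finally have "(\<Sum>e\<in>U - edges (4 * r). (angle_form e)\<^sup>2) \<le> real (card Y) * (27/4)"
    using card_U by linarith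
  moreover have "(\<Sum>e\<in>U \<inter> edges (4 * r). (angle_form e)\<^sup>2) \<le> (\<Sum>e\<in>edges (4 * r). (angle_form e)\<^sup>2)"
    by (intro sum_mono2) auto
  ultimately show ?thesis
    unfolding U_def[symmetric]
    using sum.Int_Diff[OF finite_U, of "\<lambda>e. (angle_form e)\<^sup>2" "edges (4 * r)"] by linarith
qed

context potential
begin

lemma exists_filling_variation:
  assumes boundary: "\<And>x. sup_norm x = int s \<Longrightarrow> P x - y x \<in> \<int>"
  shows "\<exists>v. grad_support v \<subseteq> inner_edges s \<and>
    energy y v \<le> K\<^sub>2 * (\<Sum>e\<in>inner_edges s. (grad P e)\<^sup>2) - \<mu> / 2 * (\<Sum>e\<in>inner_edges s. (strain y e)\<^sup>2)"
proof (intro exI conjI)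
  define v where "v x = (if sup_norm x < int s then P x - y x else 0)" for x
  define z where "z = (\<lambda>x. y x + v x)"
  show support: "grad_support v \<subseteq> inner_edges s"
  proof
    fix e assume "e \<in> grad_support v"
    then have "v (src e) \<noteq> 0 \<or> v (tgt e) \<noteq> 0" by (auto simp: grad_support_def grad_def)
    then have "sup_norm (src e) < int s \<or> sup_norm (tgt e) < int s"
      by (auto simp: v_def split: if_splits)
    then show "e \<in> inner_edges s"
      using sup_norm_diff_src_tgt[of e] by (auto simp: inner_edges_def)
  qed
  have z_congruent: "z x - P x \<in> \<int>" if "sup_norm x \<le> int s" for x
  proof (cases "sup_norm x < int s")
    case False
    then have "- (P x - y x) \<in> \<int>" using boundary[of x] that by (intro Ints_minus) simp
    then show ?thesis using False by (simp add: z_def v_def)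
  qed (simp add: z_def v_def)
  have "\<psi> (grad z e) \<le> K\<^sub>2 * (grad P e)\<^sup>2" if "e \<in> inner_edges s" for e
  proof -
    have "grad z e - grad P e = (z (tgt e) - P (tgt e)) - (z (src e) - P (src e))"
      by (simp add: grad_def)
    also have "\<dots> \<in> \<int>" using that by (intro Ints_diff z_congruent) (auto simp: inner_edges_def)
    finally have "\<psi> (grad z e) = \<psi> (grad P e)" by (rule psi_cong)
    then show ?thesis using quadratic_upper by simp
  qed
  then have "(\<Sum>e\<in>inner_edges s. \<psi> (grad z e)) \<le> K\<^sub>2 * (\<Sum>e\<in>inner_edges s. (grad P e)\<^sup>2)"
    unfolding sum_distrib_left by (intro sum_mono)
  moreover have "\<mu> / 2 * (\<Sum>e\<in>inner_edges s. (strain y e)\<^sup>2) \<le> (\<Sum>e\<in>inner_edges s. \<psi> (grad y e))"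
    unfolding sum_distrib_left by (intro sum_mono psi_grad_ge)
  ultimately show "energy y v
      \<le> K\<^sub>2 * (\<Sum>e\<in>inner_edges s. (grad P e)\<^sup>2) - \<mu> / 2 * (\<Sum>e\<in>inner_edges s. (strain y e)\<^sup>2)"
    unfolding energy_superset[OF finite_inner_edges support] z_def[symmetric] by linarith
qed

lemma core_strain_ge:
  assumes "curl (strain y) T \<noteq> 0" "fst T = 0" "1 \<le> s"
  shows "1/3 \<le> (\<Sum>e\<in>inner_edges s. (strain y e)\<^sup>2)"
proof -
  have "1 \<le> \<bar>curl (strain y) T\<bar>" by (rule Ints_nonzero_abs_ge1[OF curl_strain_Ints assms(1)])
  then have "1\<^sup>2 \<le> (curl (strain y) T)\<^sup>2" by (intro abs_le_square_iff[THEN iffD1]) simp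
  also have "\<dots> \<le> 3 * (\<Sum>e\<in>sides T. (strain y e)\<^sup>2)" by (rule square_curl_le)
  also have "(\<Sum>e\<in>sides T. (strain y e)\<^sup>2) \<le> (\<Sum>e\<in>inner_edges s. (strain y e)\<^sup>2)"
    using sides_subset_inner_edges[OF assms(2,3)] by (intro sum_mono2) auto
  finally show ?thesis by simp
qed

definition ring_energy :: real where
  "ring_energy = min (1/4) (\<mu> / (6 * 1224 * K\<^sub>2))"

lemma ring_energy_pos: "0 < ring_energy"
  using pos by (simp add: ring_energy_def)

text \<open>Below the threshold the boundary carries no circulation and its values lift to a real function
  of small oscillation; the Coons patch of this lift fills the box with less energy than a core
  costs.\<close>
lemma ring_edges_energy_ge:
  assumes near_min: "near_minimiser \<epsilon> y" "0 < \<epsilon>" and core: "curl (strain y) T \<noteq> 0" "fst T = 0"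
    and size: "1 \<le> s" and small: "\<epsilon> * (1 + real (card (edges s))) \<le> \<mu> / 24"
  shows "ring_energy \<le> 2 * real s * (\<Sum>e\<in>ring_edges s. (strain y e)\<^sup>2)"
proof (rule ccontr)
  define \<rho> where "\<rho> = real s * (\<Sum>e\<in>ring_edges s. (strain y e)\<^sup>2)"
  assume "\<not> ?thesis"
  then have below: "8 * \<rho> < 1" "2 * \<rho> < \<mu> / (6 * 1224 * K\<^sub>2)"
    by (simp_all add: \<rho>_def ring_energy_def)
  then obtain P where filling: "\<And>x. sup_norm x = int s \<Longrightarrow> P x - y x \<in> \<int>"
      and P_energy: "(\<Sum>e\<in>inner_edges s. (grad P e)\<^sup>2) \<le> 1224 * \<rho>"
    using exists_box_filling[OF size grad_strain_congruent, of y] unfolding \<rho>_def by auto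
  obtain v where variation: "grad_support v \<subseteq> inner_edges s" and
      v_energy: "energy y v \<le> K\<^sub>2 * (\<Sum>e\<in>inner_edges s. (grad P e)\<^sup>2)
        - \<mu> / 2 * (\<Sum>e\<in>inner_edges s. (strain y e)\<^sup>2)"
    using exists_filling_variation[of s P y] filling by blast
  have finite_v: "finite (grad_support v)" using finite_subset[OF variation] by simp
  have "card (grad_support v) \<le> card (edges s)"
    using order_trans[OF variation inner_edges_subset] by (intro card_mono) auto
  then have "\<epsilon> * (1 + real (card (grad_support v))) \<le> \<epsilon> * (1 + real (card (edges s)))"
    using near_min(2) by (intro mult_left_mono) auto
  moreover have "- \<epsilon> * (1 + real (card (grad_support v))) \<le> energy y v"
    using near_min(1) finite_v unfolding near_minimiser_def by blast
  ultimately have "- (\<mu> / 24) \<le> energy y v" using small by simp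
  moreover have "K\<^sub>2 * (\<Sum>e\<in>inner_edges s. (grad P e)\<^sup>2) \<le> K\<^sub>2 * (1224 * \<rho>)"
    using P_energy pos by (intro mult_left_mono) auto
  moreover have "K\<^sub>2 * (1224 * \<rho>) < \<mu> / 12"
    using below(2) pos by (simp add: field_simps)
  moreover have "\<mu> / 2 * (1/3) \<le> \<mu> / 2 * (\<Sum>e\<in>inner_edges s. (strain y e)\<^sup>2)"
    using core_strain_ge[OF core size] pos by (intro mult_left_mono) auto
  ultimately show False using v_energy pos by linarith
qed

definition core_energy :: "nat \<Rightarrow> real" where
  "core_energy r = ring_energy / 2 * harm r"

lemma core_energy_unbounded: "\<exists>r\<ge>1. C \<le> core_energy r"
proof -
  have "\<forall>\<^sub>F r in sequentially. 2 * C / ring_energy \<le> (harm r :: real)"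
    using harm_at_top by (simp add: filterlim_at_top)
  then have "\<forall>\<^sub>F r in sequentially. 1 \<le> r \<and> 2 * C / ring_energy \<le> (harm r :: real)"
    using eventually_ge_at_top by (rule eventually_conj[rotated])
  then obtain r where "1 \<le> r" "2 * C / ring_energy \<le> (harm r :: real)"
    by (auto dest: eventually_happens)
  then show ?thesis
    using ring_energy_pos by (intro exI[of _ r]) (simp add: core_energy_def field_simps)
qed

lemma box_energy_ge:
  assumes near_min: "near_minimiser \<epsilon> y" "0 < \<epsilon>" and core: "curl (strain y) T \<noteq> 0"
    and small: "\<epsilon> * (1 + real (card (edges r))) \<le> \<mu> / 24"
  shows "core_energy r \<le> (\<Sum>e\<in>box_around r T. (strain y e)\<^sup>2)"
proof -
  define y' where "y' = (\<lambda>x. y (x + fst T))"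
  have strain_y': "strain y' e = strain y (shift_edge (fst T) e)" for e
    unfolding y'_def strain_shift ..
  have core': "curl (strain y') (0, snd T) \<noteq> 0"
    using core unfolding y'_def strain_shift curl_shift by (simp add: shift_tri_def)
  have ring: "ring_energy / (2 * real s) \<le> (\<Sum>e\<in>ring_edges s. (strain y' e)\<^sup>2)" if "s \<in> {1..r}" for s
  proof -
    have "card (edges s) \<le> card (edges r)" using that by (intro card_mono edges_mono) auto
    then have "\<epsilon> * (1 + real (card (edges s))) \<le> \<epsilon> * (1 + real (card (edges r)))"
      using near_min(2) by (intro mult_left_mono) auto
    then have "\<epsilon> * (1 + real (card (edges s))) \<le> \<mu> / 24" using small by linarith
    then have "ring_energy \<le> 2 * real s * (\<Sum>e\<in>ring_edges s. (strain y' e)\<^sup>2)"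
      using near_min core' that unfolding y'_def
      by (intro ring_edges_energy_ge[OF near_minimiser_shift]) auto
    then show ?thesis using that by (simp add: field_simps)
  qed
  have "core_energy r = (\<Sum>s=1..r. ring_energy / (2 * real s))"
    by (simp add: core_energy_def harm_def sum_distrib_left divide_simps)
  also have "\<dots> \<le> (\<Sum>s=1..r. \<Sum>e\<in>ring_edges s. (strain y' e)\<^sup>2)"
    by (intro sum_mono ring)
  also have "\<dots> = (\<Sum>e\<in>(\<Union>s\<in>{1..r}. ring_edges s). (strain y' e)\<^sup>2)"
    by (rule sum.UNION_disjoint[symmetric]) (use finite_ring_edges in \<open>auto simp: ring_edges_def\<close>)
  also have "\<dots> \<le> (\<Sum>e\<in>edges r. (strain y' e)\<^sup>2)"
    using order_trans[OF order_trans[OF ring_edges_subset inner_edges_subset] edges_mono]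
    by (intro sum_mono2 UN_least) auto
  also have "\<dots> = (\<Sum>e\<in>box_around r T. (strain y e)\<^sup>2)"
    unfolding strain_y' box_around_def by (simp add: sum.reindex[OF inj_shift_edge])
  finally show ?thesis .
qed

lemma card_separated_cores_le:
  assumes near_min: "near_minimiser \<epsilon> y" "0 < \<epsilon>" and size: "1 \<le> r"
    and small: "\<epsilon> * (1 + real (card (edges r))) \<le> \<mu> / 24"
    and charged_cores: "finite Y" "Y \<subseteq> charged (strain y)"
    and separated: "box_separated r Y"
    and close: "l2_bounded (\<lambda>e. strain y e - angle_form e) G"
  shows "real (card Y) * (core_energy r / 2 - 27/4) \<le> G + (\<Sum>e\<in>edges (4 * r). (angle_form e)\<^sup>2)"
proof -
  define U where "U = (\<Union>T\<in>Y. box_around r T)"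
  have finite_U: "finite U" using charged_cores(1) by (simp add: U_def)
  have "(\<Sum>e\<in>U. (strain y e)\<^sup>2) = (\<Sum>T\<in>Y. \<Sum>e\<in>box_around r T. (strain y e)\<^sup>2)"
    unfolding U_def
    using charged_cores(1) box_around_disjoint pairwiseD[OF separated[unfolded box_separated_def]]
    by (intro sum.UNION_disjoint) auto
  moreover have "(\<Sum>T\<in>Y. core_energy r) \<le> (\<Sum>T\<in>Y. \<Sum>e\<in>box_around r T. (strain y e)\<^sup>2)"
    using charged_cores(2)
    by (intro sum_mono box_energy_ge[OF near_min _ small]) (auto simp: charged_def)
  ultimately have cores: "real (card Y) * core_energy r \<le> (\<Sum>e\<in>U. (strain y e)\<^sup>2)" by simp
  have "(strain y e)\<^sup>2 / 2 - (angle_form e)\<^sup>2 \<le> (strain y e - angle_form e)\<^sup>2" for e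
    using zero_le_power2[of "strain y e - 2 * angle_form e"]
    by (simp add: power2_eq_square algebra_simps)
  then have "(\<Sum>e\<in>U. (strain y e)\<^sup>2 / 2 - (angle_form e)\<^sup>2) \<le> (\<Sum>e\<in>U. (strain y e - angle_form e)\<^sup>2)"
    by (intro sum_mono)
  also have "\<dots> \<le> G" using close finite_U by (rule l2_boundedD)
  finally have "(\<Sum>e\<in>U. (strain y e)\<^sup>2) / 2 - (\<Sum>e\<in>U. (angle_form e)\<^sup>2) \<le> G"
    by (simp add: sum_subtractf sum_divide_distrib)
  moreover have "(\<Sum>e\<in>U. (angle_form e)\<^sup>2)
      \<le> (\<Sum>e\<in>edges (4 * r). (angle_form e)\<^sup>2) + real (card Y) * (27/4)"
    unfolding U_def using size charged_cores(1) by (rule sum_angle_form_boxes_le)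
  ultimately show ?thesis using cores by (simp add: algebra_simps)
qed

end

section \<open>Scales on which the charges are isolated\<close>

definition good_scale :: "(edge \<Rightarrow> real) \<Rightarrow> nat \<Rightarrow> bool" where
  "good_scale a k \<longleftrightarrow> isolates_charge centroid (curl a) (charged a) 0 (2 ^ k) (2 ^ Suc k)"

lemma good_scale_shift:
  assumes isolated: "isolates_charge centroid (curl a) (charged a) (centroid T)
      (3 * 2 ^ k / 4) (3 * 2 ^ k)"
    and large: "3 \<le> (2::real) ^ k"
  shows "good_scale (\<lambda>e. a (shift_edge (fst T) e)) k"
proof -
  define p where "p = fst T"
  obtain A where cluster: "A \<subseteq> charged a" "0 < sum (curl a) A"
    and inside: "\<And>S. S \<in> A \<Longrightarrow> dist (centroid S) (centroid T) \<le> 3 * 2 ^ k / 4"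
    and outside: "\<And>S. S \<in> charged a - A \<Longrightarrow> 3 * 2 ^ k < dist (centroid S) (centroid T)"
    using isolated unfolding isolates_charge_def by blast
  have norm_eq: "dist (centroid (shift_tri (- p) S)) 0 = dist (centroid S) (lattice_vec p)" for S
    using lattice_vec_diff[of 0 p] by (simp add: centroid_shift dist_norm)
  have close: "dist (centroid T) (lattice_vec p) \<le> 3/5"
    using cmod_centroid_diff_lattice_vec_le by (simp add: p_def dist_norm)
  have inside': "dist (centroid S) (lattice_vec p) \<le> 2 ^ k" if "S \<in> A" for S
    using inside[OF that] close large dist_triangle[of "centroid S" "lattice_vec p" "centroid T"]
    by linarith
  have outside': "2 ^ Suc k < dist (centroid S) (lattice_vec p)" if "S \<in> charged a - A" for S
    using outside[OF that] close large dist_triangle2[of "centroid S" "centroid T" "lattice_vec p"]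
    unfolding power_Suc by linarith
  show ?thesis
    unfolding good_scale_def isolates_charge_def p_def[symmetric] charged_shift
  proof (intro exI conjI ballI)
    show "shift_tri (- p) ` A \<subseteq> shift_tri (- p) ` charged a" using cluster(1) by (rule image_mono)
    show "0 < sum (curl (\<lambda>e. a (shift_edge p e))) (shift_tri (- p) ` A)"
      using cluster(2) by (simp add: sum_curl_shift)
    show "dist (centroid S) 0 \<le> 2 ^ k" if "S \<in> shift_tri (- p) ` A" for S
      using that inside' by (elim imageE) (simp only: norm_eq)
    show "2 ^ Suc k < dist (centroid S) 0"
      if outside_shifted: "S \<in> shift_tri (- p) ` charged a - shift_tri (- p) ` A" for S
    proof -
      obtain S' where "S' \<in> charged a - A" "S = shift_tri (- p) S'" using outside_shifted by blast
      then show ?thesis using outside' by (simp only: norm_eq)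
    qed
  qed
qed

context l2_perturbed_dislocation
begin

abbreviation deviation :: "edge \<Rightarrow> real" where
  "deviation e \<equiv> \<alpha> e - angle_form e"

text \<open>On a good scale no core is cut by the annulus, so the pairing with the layer only sees
  the total charge of the cluster inside, which is at least the net charge 1.\<close>
lemma good_scale_pairing_nonpos:
  assumes good: "good_scale \<alpha> k" and below: "k < M"
  shows "(\<Sum>e\<in>edges (Suc (2 * 2 ^ M)). deviation e * cograd (layer k) e) \<le> 0"
proof -
  obtain A where cluster: "A \<subseteq> charged \<alpha>" "0 < sum (curl \<alpha>) A"
    and inside: "\<And>T. T \<in> A \<Longrightarrow> dist (centroid T) 0 \<le> 2 ^ k"
    and outside: "\<And>T. T \<in> charged \<alpha> - A \<Longrightarrow> 2 ^ Suc k < dist (centroid T) 0"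
    using good unfolding good_scale_def isolates_charge_def by blast
  have "sum (curl \<alpha>) A \<in> \<int>" using curl_Ints by (rule Ints_sum)
  then have charge: "1 \<le> sum (curl \<alpha>) A"
    using cluster(2) Ints_nonzero_abs_ge1[of "sum (curl \<alpha>) A"] by simp
  have layer_k: "layers {k} = layer k" by (simp add: fun_eq_iff layers_def)
  have origin: "layer k (0, True) = 0" by (rule layer_inside) simp
  have "(\<Sum>e\<in>edges (Suc (2 * 2 ^ M)). deviation e * cograd (layer k) e)
      = (\<Sum>T\<in>charged deviation. (layer k T - ln 2) * curl deviation T)"
    using layers_summation_by_parts[of "{k}" M deviation] below finite_charged_diff
    by (simp add: layer_k)
  also have "\<dots> = (\<Sum>T\<in>charged \<alpha>. (layer k T - ln 2) * curl \<alpha> T) + ln 2"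
    unfolding sum_charged_diff origin by simp
  also have "(\<Sum>T\<in>charged \<alpha>. (layer k T - ln 2) * curl \<alpha> T) = (\<Sum>T\<in>A. (layer k T - ln 2) * curl \<alpha> T)"
  proof (rule sum.mono_neutral_right[OF finite_charged cluster(1)], rule ballI)
    fix T assume "T \<in> charged \<alpha> - A"
    then have "layer k T = ln 2"
      using outside[of T] by (intro layer_outside) (simp add: less_imp_le)
    then show "(layer k T - ln 2) * curl \<alpha> T = 0" by simp
  qed
  also have "\<dots> = (\<Sum>T\<in>A. - ln 2 * curl \<alpha> T)"
  proof (rule sum.cong[OF refl])
    fix T assume "T \<in> A"
    then have "layer k T = 0" using inside by (intro layer_inside) simp
    then show "(layer k T - ln 2) * curl \<alpha> T = - ln 2 * curl \<alpha> T" by simp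
  qed
  also have "\<dots> = - ln 2 * sum (curl \<alpha>) A" by (rule sum_distrib_left[symmetric])
  also have "\<dots> + ln 2 = ln 2 * (1 - sum (curl \<alpha>) A)" by (simp add: algebra_simps)
  also have "\<dots> \<le> 0" using charge by (intro mult_nonneg_nonpos) auto
  finally show ?thesis .
qed

lemma truncated_log_pairing_le:
  fixes M :: nat
  defines "E \<equiv> edges (Suc (2 * 2 ^ M))"
  assumes few_bad: "real (card {k. k < M \<and> \<not> good_scale \<alpha> k}) \<le> m"
  shows "conjugate_factor * (\<Sum>e\<in>E. deviation e * cograd (layers {..<M}) e)
    \<le> (\<Sum>e\<in>E. (deviation e)\<^sup>2) / 8 + layer_energy * m"
proof -
  define B where "B = {k. k < M \<and> \<not> good_scale \<alpha> k}"
  have finite_B: "finite B" by (simp add: B_def)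
  have expand: "(\<Sum>e\<in>E. deviation e * cograd (layers K) e)
      = (\<Sum>k\<in>K. \<Sum>e\<in>E. deviation e * cograd (layer k) e)"
    for K
    unfolding cograd_def layers_def sum_subtractf[symmetric] sum_distrib_left by (rule sum.swap)
  have "(\<Sum>e\<in>E. deviation e * cograd (layers {..<M}) e)
      = (\<Sum>k\<in>{..<M} - B. \<Sum>e\<in>E. deviation e * cograd (layer k) e) +
        (\<Sum>e\<in>E. deviation e * cograd (layers B) e)"
    unfolding expand by (rule sum.subset_diff) (auto simp: B_def)
  also have "(\<Sum>k\<in>{..<M} - B. \<Sum>e\<in>E. deviation e * cograd (layer k) e) \<le> 0"
    unfolding E_def by (intro sum_nonpos good_scale_pairing_nonpos) (auto simp: B_def)
  finally have "conjugate_factor * (\<Sum>e\<in>E. deviation e * cograd (layers {..<M}) e)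
      \<le> conjugate_factor * (\<Sum>e\<in>E. deviation e * cograd (layers B) e)"
    using conjugate_factor_bounds by (intro mult_left_mono) auto
  also have "\<dots> = (\<Sum>e\<in>E. deviation e * (conjugate_factor * cograd (layers B) e))"
    by (simp add: sum_distrib_left mult_ac)
  also have "\<dots> \<le> (\<Sum>e\<in>E. (deviation e)\<^sup>2 / 8 + 2 * (conjugate_factor * cograd (layers B) e)\<^sup>2)"
    by (intro sum_mono young_inequality_8)
  also have "\<dots> = (\<Sum>e\<in>E. (deviation e)\<^sup>2) / 8 + 2 * conjugate_factor\<^sup>2
      * (\<Sum>e\<in>E. (cograd (layers B) e)\<^sup>2)"
    by (simp add: sum.distrib sum_distrib_left sum_divide_distrib power_mult_distrib mult_ac)
  also have "2 * conjugate_factor\<^sup>2 * (\<Sum>e\<in>E. (cograd (layers B) e)\<^sup>2) \<le> 1 * (layer_energy * m)"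
  proof (intro mult_mono)
    show "2 * conjugate_factor\<^sup>2 \<le> 1"
      using power_mono[OF conjugate_factor_bounds(2,1), of 2] by (simp add: power_divide)
    have "(\<Sum>e\<in>E. (cograd (layers B) e)\<^sup>2) \<le> layer_energy * real (card B)"
      unfolding E_def using finite_B by (intro sum_square_cograd_layers_le) auto
    also have "\<dots> \<le> layer_energy * m"
      using few_bad by (intro mult_left_mono) (auto simp: B_def layer_energy_def)
    finally show "(\<Sum>e\<in>E. (cograd (layers B) e)\<^sup>2) \<le> layer_energy * m" .
  qed (auto intro: sum_nonneg)
  finally show ?thesis by simp
qed

end

lemma angle_form_plus_truncated_log_le:
  assumes "radius e \<le> 2 ^ M / 4"
  shows "\<bar>angle_form e + conjugate_factor * cograd (layers {..<M}) e\<bar> \<le> 36 / (radius e)\<^sup>2"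
proof -
  have "real_of_int (sup_norm (fst (left_tri e))) \<le> radius e"
    "real_of_int (sup_norm (fst (right_tri e))) \<le> radius e"
    using sup_norm_bordering_tri(3,4)[of e] unfolding radius_def by linarith+
  then have "cmod (centroid (left_tri e)) \<le> 2 ^ M" "cmod (centroid (right_tri e)) \<le> 2 ^ M"
    using cmod_centroid_le[of "left_tri e"] cmod_centroid_le[of "right_tri e"] radius_ge_1[of e]
      assms
    by linarith+
  then have "cograd (layers {..<M}) e = cograd log_dist e"
    using log_dist_le by (simp add: cograd_def layers_lessThan)
  then show ?thesis using angle_form_plus_cograd_log_dist_le by simp
qed

lemma angle_form_plus_truncated_log_le_inverse_radius:
  "\<bar>angle_form e + conjugate_factor * cograd (layers {..<M}) e\<bar> \<le> 4 / radius e"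
proof -
  have "\<bar>cograd (layers {..<M}) e\<bar> \<le> 6 / radius e"
    using abs_cograd_layers_le[of "{..<M}" e] sum_abs_cograd_layer_le[of "{..<M}" e]
      abs_cograd_log_dist_le_inverse_radius[of e] by simp
  then have "\<bar>conjugate_factor * cograd (layers {..<M}) e\<bar> \<le> 1/3 * (6 / radius e)"
    unfolding abs_mult using conjugate_factor_bounds by (intro mult_mono) auto
  then show ?thesis using abs_angle_form_le_inverse_radius[of e] by simp
qed

lemma truncation_error_pairing_le:
  assumes finite_S: "finite S" and decay: "\<And>e. \<bar>g e\<bar> \<le> C / (radius e)\<^sup>2" "0 < C"
    and large: "768 * C \<le> 2 ^ M"
  shows "(\<Sum>e\<in>S. - (angle_form e + conjugate_factor * cograd (layers {..<M}) e) * g e)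
    \<le> (\<Sum>e\<in>S. (g e)\<^sup>2) / 8 + 124417"
proof -
  define err where "err e = angle_form e + conjugate_factor * cograd (layers {..<M}) e" for e
  define F where "F = {e \<in> S. 2 ^ M / 4 \<le> radius e}"
  have near: "- err e * g e \<le> (g e)\<^sup>2 / 8 + 2592 * (1 / (radius e) ^ 3)" if "e \<in> S - F" for e
  proof -
    have "\<bar>err e\<bar> \<le> 36 / (radius e)\<^sup>2"
      using that unfolding err_def F_def by (intro angle_form_plus_truncated_log_le) auto
    then have "(err e)\<^sup>2 \<le> (36 / (radius e)\<^sup>2)\<^sup>2" by (intro abs_le_square_iff[THEN iffD1]) simp
    also have "\<dots> = 1296 * (1 / (radius e) ^ 4)" by (simp add: power_divide)
    also have "\<dots> \<le> 1296 * (1 / (radius e) ^ 3)"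
      using radius_ge_1[of e] by (intro mult_left_mono divide_left_mono power_increasing) auto
    finally show ?thesis using young_inequality_8[of "g e" "- err e"] by (simp add: mult.commute)
  qed
  have far: "- err e * g e \<le> 4 * C * (1 / (radius e) ^ 3)" for e
  proof -
    have "\<bar>err e\<bar> * \<bar>g e\<bar> \<le> 4 / radius e * (C / (radius e)\<^sup>2)"
      unfolding err_def using decay angle_form_plus_truncated_log_le_inverse_radius
      by (intro mult_mono) auto
    moreover have "- err e * g e \<le> \<bar>err e\<bar> * \<bar>g e\<bar>"
      using abs_ge_self[of "- err e * g e"] by (simp add: abs_mult)
    ultimately show ?thesis by (simp add: power2_eq_square power3_eq_cube)
  qed
  have "(\<Sum>e\<in>S. - err e * g e) = (\<Sum>e\<in>S - F. - err e * g e) + (\<Sum>e\<in>F. - err e * g e)"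
    using finite_S by (intro sum.subset_diff) (auto simp: F_def)
  also have "(\<Sum>e\<in>S - F. - err e * g e) \<le> (\<Sum>e\<in>S - F. (g e)\<^sup>2 / 8 + 2592 * (1 / (radius e) ^ 3))"
    by (intro sum_mono near)
  also have "\<dots> \<le> (\<Sum>e\<in>S. (g e)\<^sup>2 / 8 + 2592 * (1 / (radius e) ^ 3))"
    using finite_S by (intro sum_mono2) auto
  also have "\<dots> = (\<Sum>e\<in>S. (g e)\<^sup>2) / 8 + 2592 * (\<Sum>e\<in>S. 1 / (radius e) ^ 3)"
    by (simp add: sum.distrib sum_distrib_left sum_divide_distrib)
  also have "(\<Sum>e\<in>S. 1 / (radius e) ^ 3) \<le> 48 / 1"
    using finite_S radius_ge_1 by (intro sum_inverse_radius_cube_le) auto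
  also have "(\<Sum>e\<in>F. - err e * g e) \<le> 4 * C * (\<Sum>e\<in>F. 1 / (radius e) ^ 3)"
    unfolding sum_distrib_left by (intro sum_mono far)
  also have "\<dots> \<le> 4 * C * (48 / (2 ^ M / 4))"
    using finite_S decay(2) by (intro mult_left_mono sum_inverse_radius_cube_le) (auto simp: F_def)
  also have "\<dots> \<le> 1" using large by simp
  finally show ?thesis unfolding err_def by simp
qed

subsection \<open>A centre with few bad scales\<close>

lemma exists_maximal_pairwise_subset:
  assumes "finite X" "symp R"
  shows "\<exists>Y\<subseteq>X. pairwise R Y \<and> (\<forall>x\<in>X - Y. \<exists>y\<in>Y. \<not> R x y)"
proof -
  have "finite {Y. Y \<subseteq> X \<and> pairwise R Y}" "{} \<in> {Y. Y \<subseteq> X \<and> pairwise R Y}"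
    using assms(1) by (auto simp: pairwise_def)
  then obtain Y where maximal_pairwise: "Y \<subseteq> X" "pairwise R Y"
    and maximal: "\<And>Z. Z \<subseteq> X \<Longrightarrow> pairwise R Z \<Longrightarrow> Y \<subseteq> Z \<Longrightarrow> Y = Z"
    using finite_has_maximal2[of "{Y. Y \<subseteq> X \<and> pairwise R Y}" "{}"] by auto
  have "\<exists>y\<in>Y. \<not> R x y" if "x \<in> X - Y" for x
  proof (rule ccontr)
    assume "\<not> ?thesis"
    then have "pairwise R (insert x Y)"
      using maximal_pairwise(2) sympD[OF assms(2)] by (auto simp: pairwise_insert)
    then show False using maximal[of "insert x Y"] maximal_pairwise(1) that by auto
  qed
  then show ?thesis using maximal_pairwise by blast
qed

lemma partition_on_fibres:
  assumes "Y \<subseteq> X" "\<And>x. x \<in> X \<Longrightarrow> f x \<in> Y" "\<And>y. y \<in> Y \<Longrightarrow> f y = y"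
  shows "partition_on X ((\<lambda>y. {x \<in> X. f x = y}) ` Y)" "inj_on (\<lambda>y. {x \<in> X. f x = y}) Y"
proof -
  show "partition_on X ((\<lambda>y. {x \<in> X. f x = y}) ` Y)"
    using assms by (intro partition_onI) (fastforce simp: disjnt_def)+
  show "inj_on (\<lambda>y. {x \<in> X. f x = y}) Y"
  proof (rule inj_onI)
    fix y z assume y_in: "y \<in> Y" and fibres_eq: "{x \<in> X. f x = y} = {x \<in> X. f x = z}"
    have "y \<in> {x \<in> X. f x = y}" using assms y_in by auto
    then have "f y = z" unfolding fibres_eq by simp
    then show "y = z" using assms(3)[OF y_in] by simp
  qed
qed

lemma diameter_near_le:
  assumes "T \<in> A" "1 \<le> r" and near: "\<And>S. S \<in> A \<Longrightarrow> sup_norm (fst S - fst T) \<le> 2 * int r"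
  shows "diameter (centroid ` A) \<le> 10 * real r"
proof (rule diameter_image_le)
  show "A \<noteq> {}" using assms(1) by blast
  fix S S' assume "S \<in> A" "S' \<in> A"
  then have "sup_norm (fst S - fst S') \<le> 4 * int r"
    using sup_norm_triangle_diff[of "fst S - fst T" "fst S' - fst T"] near[of S] near[of S'] by simp
  then have "real_of_int (sup_norm (fst S - fst S')) \<le> 4 * real r" by linarith
  then show "dist (centroid S) (centroid S') \<le> 10 * real r"
    using dist_centroid_le[of S S'] assms(2) by (auto simp: field_simps)
qed

lemma exists_separated_net:
  fixes X :: "tri set"
  assumes "finite X" "1 \<le> r"
  shows "\<exists>Y\<subseteq>X. box_separated r Y \<and>
    (\<exists>P. partition_on X P \<and> card P = card Y \<and> spread centroid P \<le> 10 * real r * real (card P))"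
proof -
  define far where "far T T' \<longleftrightarrow> 2 * int r < sup_norm (fst T - fst T')" for T T' :: tri
  have "symp far" by (auto simp: symp_def far_def sup_norm_diff_commute)
  from exists_maximal_pairwise_subset[OF assms(1) this] obtain Y
    where "Y \<subseteq> X" "pairwise far Y" and net: "\<forall>T\<in>X - Y. \<exists>T'\<in>Y. \<not> far T T'"
    by (elim exE conjE)
  have "\<exists>T'\<in>Y. \<not> far T T' \<and> (T \<in> Y \<longrightarrow> T' = T)" if "T \<in> X" for T
  proof (cases "T \<in> Y")
    case True
    then show ?thesis by (intro bexI[of _ T]) (simp_all add: far_def)
  next
    case False
    then show ?thesis using net that by blast
  qed
  then obtain f where f_in: "\<And>T. T \<in> X \<Longrightarrow> f T \<in> Y" and f_near: "\<And>T. T \<in> X \<Longrightarrow> \<not> far T (f T)"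
    and f_fixed: "\<And>T. T \<in> Y \<Longrightarrow> f T = T"
    using \<open>Y \<subseteq> X\<close> by (metis subsetD)
  define fibre where "fibre T = {S \<in> X. f S = T}" for T
  note fibres = partition_on_fibres[OF \<open>Y \<subseteq> X\<close> f_in f_fixed, folded fibre_def]
  have "diameter (centroid ` fibre T) \<le> 10 * real r" if "T \<in> Y" for T
  proof (rule diameter_near_le)
    show "T \<in> fibre T" using that \<open>Y \<subseteq> X\<close> f_fixed by (auto simp: fibre_def)
    show "sup_norm (fst S - fst T) \<le> 2 * int r" if "S \<in> fibre T" for S
      using that f_near[of S] by (auto simp: fibre_def far_def)
  qed (rule assms(2))
  then have "(\<Sum>T\<in>Y. diameter (centroid ` fibre T)) \<le> real (card Y) * (10 * real r)"
    by (intro sum_bounded_above) auto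
  then have "spread centroid (fibre ` Y) \<le> 10 * real r * real (card (fibre ` Y))"
    unfolding spread_def by (simp add: sum.reindex[OF fibres(2)] card_image[OF fibres(2)] mult_ac)
  then show ?thesis
    using \<open>Y \<subseteq> X\<close> \<open>pairwise far Y\<close> fibres(1) card_image[OF fibres(2)]
    unfolding box_separated_def far_def by blast
qed

lemma card_bad_scales_le:
  fixes k\<^sub>0 :: nat
  defines "l \<equiv> 3 * (2::real) ^ k\<^sub>0"
  assumes large: "3 \<le> (2::real) ^ k\<^sub>0"
  shows "card {k. k < M \<and> \<not> good_scale (\<lambda>e. a (shift_edge (fst T) e)) k} \<le> k\<^sub>0 +
    card {k. k \<le> M \<and> \<not> isolates_charge centroid (curl a) (charged a) (centroid T)
      (l * 2 ^ k / 4) (l * 2 ^ k)}"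
    (is "card ?bad \<le> k\<^sub>0 + card ?not_isolated")
proof -
  have "k \<in> {..<k\<^sub>0} \<union> (\<lambda>j. k\<^sub>0 + j) ` ?not_isolated" if "k \<in> ?bad" for k
  proof (cases "k < k\<^sub>0")
    case False
    define j where "j = k - k\<^sub>0"
    have k_eq: "k = k\<^sub>0 + j" using False by (simp add: j_def)
    have "(1::real) \<le> 2 ^ j" by simp
    then have "3 * 1 \<le> (2::real) ^ k\<^sub>0 * 2 ^ j" using large by (intro mult_mono) auto
    then have "\<not> isolates_charge centroid (curl a) (charged a) (centroid T)
        (l * 2 ^ j / 4) (l * 2 ^ j)"
      using good_scale_shift[of a T k] that by (auto simp: k_eq l_def power_add mult.assoc)
    then show ?thesis using that by (auto simp: k_eq)
  qed simp
  then have "?bad \<subseteq> {..<k\<^sub>0} \<union> (\<lambda>j. k\<^sub>0 + j) ` ?not_isolated" by (rule subsetI)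
  then have "card ?bad \<le> card ({..<k\<^sub>0} \<union> (\<lambda>j. k\<^sub>0 + j) ` ?not_isolated)" by (intro card_mono) auto
  also have "\<dots> \<le> card {..<k\<^sub>0} + card ((\<lambda>j. k\<^sub>0 + j) ` ?not_isolated)" by (rule card_Un_le)
  also have "\<dots> = k\<^sub>0 + card ?not_isolated" by (subst card_image) (auto simp: inj_on_def)
  finally show ?thesis .
qed

lemma exists_centre_with_few_bad_scales:
  assumes charges: "finite (charged a)" "0 < net_charge a"
    and "1 \<le> r" and large: "12 * real r \<le> 2 ^ k\<^sub>0"
  shows "\<exists>p Y. Y \<subseteq> charged a \<and> box_separated r Y \<and>
    (\<forall>M. real (card {k. k < M \<and> \<not> good_scale (\<lambda>e. a (shift_edge p e)) k})
      \<le> real k\<^sub>0 + 16 * real (card Y))"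
proof -
  define l where "l = 3 * (2::real) ^ k\<^sub>0"
  obtain Y P where net: "Y \<subseteq> charged a" "box_separated r Y"
    and partition: "partition_on (charged a) P" and card_P: "card P = card Y"
    and spread: "spread centroid P \<le> 10 * real r * real (card P)"
    using exists_separated_net[OF charges(1) \<open>1 \<le> r\<close>] by blast
  have "10 * real r \<le> l" using large by (simp add: l_def)
  then have "spread centroid P \<le> l * real (card P)"
    using spread mult_right_mono[of "10 * real r" l "real (card P)"] by simp
  then obtain T where few: "\<And>M. real (card {k. k \<le> M \<and>
        \<not> isolates_charge centroid (curl a) (charged a) (centroid T) (l * 2 ^ k / 4) (l * 2 ^ k)})
      \<le> 16 * real (card P)"
    using exists_charge_isolated_at_most_scales[OF charges(1) _ partition, of "curl a" l centroid]
      charges(2)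
    by (auto simp: l_def net_charge_def)
  have "3 \<le> (2::real) ^ k\<^sub>0" using large \<open>1 \<le> r\<close> by linarith
  then have "real (card {k. k < M \<and> \<not> good_scale (\<lambda>e. a (shift_edge (fst T) e)) k})
      \<le> real k\<^sub>0 + 16 * real (card Y)" for M
    using card_bad_scales_le[of k\<^sub>0 M a T, folded l_def] few[of M] unfolding card_P by linarith
  then show ?thesis using net by blast
qed

section \<open>Near minimisers are close to the single dislocation\<close>

lemma sum_angle_form_shifted_box_le:
  assumes "sup_norm p \<le> int N"
  shows "(\<Sum>e\<in>shift_edge p ` edges N. (angle_form e)\<^sup>2) \<le> (\<Sum>e\<in>edges N. (angle_form e)\<^sup>2) + 384"
proof -
  define S where "S = shift_edge p ` edges N"
  have radius: "real N + 1 \<le> radius e \<and> radius e \<le> 2 * (real N + 1)"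
    if outside: "e \<in> S - edges N" for e
  proof -
    obtain e' where "e' \<in> edges N" "e = shift_edge p e'" using outside unfolding S_def by blast
    then have "sup_norm (fst e) \<le> 2 * int N"
      using sup_norm_triangle[of "fst e'" p] assms by (simp add: mem_edges)
    then show ?thesis using radius_gt_if_not_mem_edges[of e N] outside unfolding radius_def by auto
  qed
  have "(\<Sum>e\<in>S - edges N. (angle_form e)\<^sup>2) \<le> (\<Sum>e\<in>S - edges N. 4 * (1 / (radius e)\<^sup>2))"
    using angle_form_square_le by (intro sum_mono) simp
  also have "\<dots> = 4 * (\<Sum>e\<in>S - edges N. 1 / (radius e)\<^sup>2)" by (simp add: sum_distrib_left)
  also have "(\<Sum>e\<in>S - edges N. 1 / (radius e)\<^sup>2) \<le> 48 * (2 * (real N + 1)) / (real N + 1)"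
    using radius by (intro sum_inverse_radius_square_le) (auto simp: S_def)
  also have "\<dots> = 96" by (simp add: field_simps)
  finally have "(\<Sum>e\<in>S - edges N. (angle_form e)\<^sup>2) \<le> 384" by simp
  moreover have "(\<Sum>e\<in>S \<inter> edges N. (angle_form e)\<^sup>2) \<le> (\<Sum>e\<in>edges N. (angle_form e)\<^sup>2)"
    by (intro sum_mono2) auto
  ultimately show ?thesis
    using sum.Int_Diff[of S "\<lambda>e. (angle_form e)\<^sup>2" "edges N"] unfolding S_def[symmetric]
    by (simp add: S_def)
qed

context potential
begin

lemma competitor_deviation_decay:
  assumes "competitor y"
  shows "\<exists>C>0. \<forall>e. \<bar>strain y e - angle_form e\<bar> \<le> C / (radius e)\<^sup>2"
proof -
  obtain p u where finite_support: "finite (grad_support u)"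
    and y_eq: "y = (\<lambda>x. angle (x + p) + u (x + p))"
    using assms unfolding competitor_def by blast
  obtain C where decay: "0 < C" "\<And>e. \<bar>angle_form (shift_edge p e) - angle_form e\<bar> \<le> C / (radius e)\<^sup>2"
    using angle_form_shift_diff_le by blast
  from finite_subset_shifted_edges[OF finite_support] obtain N
    where support: "grad_support u \<subseteq> shift_edge p ` edges N"
    by (meson order_refl)
  define C' where "C' = C + (real N + 1)\<^sup>2"
  have "\<bar>strain y e - angle_form e\<bar> \<le> C' / (radius e)\<^sup>2" for e
  proof (cases "e \<in> edges N")
    case True
    then have "radius e \<le> real N + 1" unfolding mem_edges radius_def by linarith
    then have "1 \<le> (real N + 1)\<^sup>2 / (radius e)\<^sup>2" by (rule one_le_divide_radius_square)
    also have "\<dots> \<le> C' / (radius e)\<^sup>2" using decay(1) by (simp add: C'_def divide_right_mono)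
    finally show ?thesis
      using abs_wrap_le[of "grad y e"] abs_angle_form_le[of e] unfolding strain_def by linarith
  next
    case False
    then have "shift_edge p e \<notin> grad_support u"
      using support inj_image_mem_iff[OF inj_shift_edge] by blast
    then have "grad y e = grad angle (shift_edge p e)"
      unfolding y_eq by (simp add: grad_def grad_support_def)
    then have "strain y e = angle_form (shift_edge p e)" by (simp add: strain_def wrap_grad_angle)
    moreover have "C / (radius e)\<^sup>2 \<le> C' / (radius e)\<^sup>2" by (simp add: C'_def divide_right_mono)
    ultimately show ?thesis using decay(2)[of e] by simp
  qed
  moreover have "0 < C'" using decay(1) by (simp add: C'_def add_pos_nonneg)
  ultimately show ?thesis by blast
qed

lemma l2_perturbed_dislocation_if_decay:
  assumes "0 < C" "\<And>e. \<bar>strain y e - angle_form e\<bar> \<le> C / (radius e)\<^sup>2"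
  shows "l2_perturbed_dislocation (strain y) (48 * C\<^sup>2)"
  by standard (use assms curl_strain_Ints l2_bounded_if_inverse_square_decay in auto)

definition excess_bound :: real where
  "excess_bound = 768 * K\<^sub>3 / \<mu> + 384"

lemma competitor_excess_le:
  assumes "competitor y"
  shows "\<exists>N\<^sub>0. \<forall>N\<ge>N\<^sub>0. (\<Sum>e\<in>edges N. (strain y e)\<^sup>2) \<le> (\<Sum>e\<in>edges N. (angle_form e)\<^sup>2) + excess_bound"
proof -
  obtain p u where variation: "finite (grad_support u)" "energy angle u \<le> 0"
    and y_eq: "y = (\<lambda>x. angle (x + p) + u (x + p))"
    using assms unfolding competitor_def by blast
  obtain N\<^sub>0 where support: "\<And>N. N\<^sub>0 \<le> N \<Longrightarrow> grad_support u \<subseteq> shift_edge p ` edges N"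
    using finite_subset_shifted_edges[OF variation(1)] by blast
  have "(\<Sum>e\<in>edges N. (strain y e)\<^sup>2) \<le> (\<Sum>e\<in>edges N. (angle_form e)\<^sup>2) + excess_bound"
    if large: "max N\<^sub>0 (nat (sup_norm p)) \<le> N" for N
  proof -
    define S where "S = shift_edge p ` edges N"
    have "finite S" by (simp add: S_def)
    have "grad_support u \<subseteq> S" unfolding S_def using support[of N] large by simp
    have "\<mu> / 2 * (\<Sum>e\<in>edges N. (strain y e)\<^sup>2) \<le> (\<Sum>e\<in>edges N. \<psi> (grad y e))"
      unfolding sum_distrib_left by (intro sum_mono psi_grad_ge)
    also have "\<dots> = (\<Sum>e\<in>S. \<psi> (grad (\<lambda>x. angle x + u x) e))"
      unfolding S_def sum.reindex[OF inj_shift_edge] y_eq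
      using grad_shift[of "\<lambda>x. angle x + u x" p] by simp
    also have "\<dots> \<le> (\<Sum>e\<in>S. \<psi> (grad angle e))"
      using variation(2) energy_superset[OF \<open>finite S\<close> \<open>grad_support u \<subseteq> S\<close>] by simp
    also have "\<dots> = (\<Sum>e\<in>S. \<psi> (angle_form e))" by (simp add: psi_grad strain_angle)
    also have "\<dots> \<le> (\<Sum>e\<in>S. \<mu> / 2 * (angle_form e)\<^sup>2 + K\<^sub>3 * \<bar>angle_form e\<bar> ^ 3)"
      by (intro sum_mono cubic_upper) (rule order_trans[OF abs_angle_form_le], simp)
    also have "\<dots> = \<mu> / 2 * (\<Sum>e\<in>S. (angle_form e)\<^sup>2) + K\<^sub>3 * (\<Sum>e\<in>S. \<bar>angle_form e\<bar> ^ 3)"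
      by (simp add: sum.distrib sum_distrib_left)
    also have "\<dots> \<le> \<mu> / 2 * (\<Sum>e\<in>S. (angle_form e)\<^sup>2) + K\<^sub>3 * 384"
      using sum_abs_angle_form_cube_le[OF \<open>finite S\<close>] pos
      by (intro add_left_mono mult_left_mono) auto
    finally have "(\<Sum>e\<in>edges N. (strain y e)\<^sup>2) \<le> (\<Sum>e\<in>S. (angle_form e)\<^sup>2) + 768 * K\<^sub>3 / \<mu>"
      using pos(1) by (simp add: field_simps)
    moreover have "sup_norm p \<le> int N" using large by linarith
    ultimately show ?thesis
      using sum_angle_form_shifted_box_le[of p N] unfolding S_def excess_bound_def by simp
  qed
  then show ?thesis by blast
qed

definition deviation_bound :: "real \<Rightarrow> real" where
  "deviation_bound m = 2 * excess_bound + 4 * 124417 + 4 * layer_energy * m"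

text \<open>Expanding the excess energy around the single dislocation leaves twice the pairing of
  \<open>angle_form\<close> with the deviation. Up to an absorbable error \<open>angle_form\<close> is the gradient conjugate
  to the truncated logarithm, so the pairing is controlled by the bad scales.\<close>
lemma l2_bounded_deviation:
  assumes "competitor y" and few_bad: "\<And>M. real (card {k. k < M \<and> \<not> good_scale (strain y) k}) \<le> m"
  shows "l2_bounded (\<lambda>e. strain y e - angle_form e) (deviation_bound m)"
proof (rule l2_boundedI_edges)
  fix N\<^sub>0
  obtain C where decay: "0 < C" "\<And>e. \<bar>strain y e - angle_form e\<bar> \<le> C / (radius e)\<^sup>2"
    using competitor_deviation_decay[OF assms(1)] by blast
  interpret l2_perturbed_dislocation "strain y" "48 * C\<^sup>2"
    using decay by (rule l2_perturbed_dislocation_if_decay)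
  obtain N\<^sub>1 where excess: "\<And>N. N\<^sub>1 \<le> N \<Longrightarrow>
      (\<Sum>e\<in>edges N. (strain y e)\<^sup>2) \<le> (\<Sum>e\<in>edges N. (angle_form e)\<^sup>2) + excess_bound"
    using competitor_excess_le[OF assms(1)] by blast
  obtain M where "768 * C + real N\<^sub>0 + real N\<^sub>1 \<le> 2 ^ M" using exists_pow2_ge by blast
  then have large: "768 * C \<le> 2 ^ M" "real N\<^sub>0 \<le> 2 ^ M" "real N\<^sub>1 \<le> 2 ^ M" using decay(1) by linarith+
  define N where "N = Suc (2 * 2 ^ M)"
  have N_ge: "N\<^sub>0 \<le> N" "N\<^sub>1 \<le> N"
    using large(2,3) by (simp_all add: N_def numeral_power_le_of_nat_cancel_iff)
  define G where "G = (\<Sum>e\<in>edges N. (deviation e)\<^sup>2)"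
  define truncated where "truncated e = conjugate_factor * cograd (layers {..<M}) e" for e
  have "(strain y e)\<^sup>2 = (angle_form e)\<^sup>2 + (deviation e)\<^sup>2 + 2 * (angle_form e * deviation e)" for e
    by (simp add: power2_eq_square algebra_simps)
  then have "(\<Sum>e\<in>edges N. (strain y e)\<^sup>2)
      = (\<Sum>e\<in>edges N. (angle_form e)\<^sup>2) + G + 2 * (\<Sum>e\<in>edges N. angle_form e * deviation e)"
    by (simp add: sum.distrib G_def sum_distrib_left)
  then have "G \<le> excess_bound - 2 * (\<Sum>e\<in>edges N. angle_form e * deviation e)"
    using excess[OF N_ge(2)] by linarith
  moreover have "- (\<Sum>e\<in>edges N. angle_form e * deviation e)
      = (\<Sum>e\<in>edges N. - (angle_form e + truncated e) * deviation e) +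
        (\<Sum>e\<in>edges N. truncated e * deviation e)"
    unfolding sum.distrib[symmetric] sum_negf[symmetric] by (simp add: algebra_simps)
  moreover have "(\<Sum>e\<in>edges N. - (angle_form e + truncated e) * deviation e) \<le> G / 8 + 124417"
    unfolding truncated_def G_def by (rule truncation_error_pairing_le) (use decay large in auto)
  moreover have "(\<Sum>e\<in>edges N. truncated e * deviation e) \<le> G / 8 + layer_energy * m"
    using truncated_log_pairing_le[OF few_bad, of M]
    unfolding truncated_def G_def N_def by (simp add: sum_distrib_left mult_ac)
  ultimately have "G \<le> deviation_bound m" unfolding deviation_bound_def by argo
  then show "\<exists>N\<ge>N\<^sub>0. (\<Sum>e\<in>edges N. (deviation e)\<^sup>2) \<le> deviation_bound m"
    using N_ge(1) unfolding G_def by blast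
qed

lemma exists_near_minimiser_with_few_bad_scales:
  assumes size: "1 \<le> r" "2 * (27/4 + 64 * layer_energy + 1) \<le> core_energy r" "12 * real r \<le> 2 ^ k\<^sub>0"
    and small: "0 < \<epsilon>" "\<epsilon> * (1 + real (card (edges r))) \<le> \<mu> / 24"
  shows "\<exists>y. competitor y \<and> near_minimiser \<epsilon> y \<and>
    (\<forall>M. real (card {k. k < M \<and> \<not> good_scale (strain y) k})
      \<le> real k\<^sub>0 + 16 * (deviation_bound (real k\<^sub>0) + (\<Sum>e\<in>edges (4 * r). (angle_form e)\<^sup>2)))"
proof -
  obtain z where minimiser: "competitor z" "near_minimiser \<epsilon> z"
    using exists_near_minimiser[OF small(1)] by blast
  obtain C where "0 < C" "\<And>e. \<bar>strain z e - angle_form e\<bar> \<le> C / (radius e)\<^sup>2"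
    using competitor_deviation_decay[OF minimiser(1)] by blast
  then interpret z: l2_perturbed_dislocation "strain z" "48 * C\<^sup>2"
    by (rule l2_perturbed_dislocation_if_decay)
  obtain p Y where net: "Y \<subseteq> charged (strain z)" "box_separated r Y"
    and few_bad: "\<And>M. real (card {k. k < M \<and> \<not> good_scale (\<lambda>e. strain z (shift_edge p e)) k})
      \<le> real k\<^sub>0 + 16 * real (card Y)"
    using exists_centre_with_few_bad_scales[OF z.finite_charged _ size(1,3)] z.net_charge_eq_1
    by auto
  define y where "y = (\<lambda>x. z (x + p))"
  have shifted: "competitor y" "near_minimiser \<epsilon> y"
    unfolding y_def using minimiser competitor_shift near_minimiser_shift by blast+
  note bad_y = few_bad[folded strain_shift, folded y_def]
  have "real (card (shift_tri (- p) ` Y)) * (core_energy r / 2 - 27/4)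
      \<le> deviation_bound (real k\<^sub>0 + 16 * real (card Y)) + (\<Sum>e\<in>edges (4 * r). (angle_form e)\<^sup>2)"
  proof (rule card_separated_cores_le[OF shifted(2) small(1) size(1) small(2)])
    show "finite (shift_tri (- p) ` Y)" using finite_subset[OF net(1) z.finite_charged] by simp
    show "shift_tri (- p) ` Y \<subseteq> charged (strain y)"
      unfolding y_def strain_shift charged_shift using net(1) by (rule image_mono)
  qed (rule box_separated_shift[OF net(2)], rule l2_bounded_deviation[OF shifted(1) bad_y])
  moreover have "real (card Y) * (64 * layer_energy + 1)
      \<le> real (card Y) * (core_energy r / 2 - 27/4)"
    using size(2) by (intro mult_left_mono) auto
  ultimately have "real (card Y) \<le> deviation_bound (real k\<^sub>0) + (\<Sum>e\<in>edges (4 * r). (angle_form e)\<^sup>2)"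
    unfolding deviation_bound_def card_image[OF inj_shift_tri] by (simp add: algebra_simps)
  then have "real (card {k. k < M \<and> \<not> good_scale (strain y) k})
      \<le> real k\<^sub>0 + 16 * (deviation_bound (real k\<^sub>0) + (\<Sum>e\<in>edges (4 * r). (angle_form e)\<^sup>2))" for M
    by (intro order_trans[OF bad_y[of M]]) simp
  then show ?thesis using shifted by blast
qed

theorem exists_near_minimisers_l2_close:
  "\<exists>G \<epsilon>\<^sub>0. 0 < \<epsilon>\<^sub>0 \<and> (\<forall>\<epsilon>. 0 < \<epsilon> \<longrightarrow> \<epsilon> \<le> \<epsilon>\<^sub>0 \<longrightarrow>
     (\<exists>y. near_minimiser \<epsilon> y \<and> l2_bounded (\<lambda>e. strain y e - angle_form e) G))"
proof -
  obtain r where size: "1 \<le> r" "2 * (27/4 + 64 * layer_energy + 1) \<le> core_energy r"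
    using core_energy_unbounded by blast
  obtain k\<^sub>0 where scale: "12 * real r \<le> 2 ^ k\<^sub>0" using exists_pow2_ge by blast
  define bad_bound where "bad_bound =
    real k\<^sub>0 + 16 * (deviation_bound (real k\<^sub>0) + (\<Sum>e\<in>edges (4 * r). (angle_form e)\<^sup>2))"
  define \<epsilon>\<^sub>0 where "\<epsilon>\<^sub>0 = \<mu> / 24 / (1 + real (card (edges r)))"
  have "\<exists>y. near_minimiser \<epsilon> y \<and>
      l2_bounded (\<lambda>e. strain y e - angle_form e) (deviation_bound bad_bound)"
    if "0 < \<epsilon>" "\<epsilon> \<le> \<epsilon>\<^sub>0" for \<epsilon>
  proof -
    have "\<epsilon> * (1 + real (card (edges r))) \<le> \<mu> / 24"
      using that(2) unfolding \<epsilon>\<^sub>0_def by (subst (asm) pos_le_divide_eq) auto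
    then show ?thesis
      using exists_near_minimiser_with_few_bad_scales[OF size scale that(1)] l2_bounded_deviation
      unfolding bad_bound_def by blast
  qed
  moreover have "0 < \<epsilon>\<^sub>0" using pos(1) by (simp add: \<epsilon>\<^sub>0_def add_pos_nonneg)
  ultimately show ?thesis by blast
qed

end

section \<open>Passage to the limit\<close>

lemma exists_convergent_subsequence:
  fixes Y :: "nat \<Rightarrow> lpt \<Rightarrow> real"
  shows "\<exists>k y \<alpha>. strict_mono (k :: nat \<Rightarrow> nat) \<and> (\<forall>x. (\<lambda>n. frac (Y (k n) x)) \<longlonglongrightarrow> y x) \<and>
    (\<forall>e. (\<lambda>n. strain (Y (k n)) e) \<longlonglongrightarrow> \<alpha> e)"
proof -
  define f where "f n z = (case z of Inl x \<Rightarrow> frac (Y n x) | Inr e \<Rightarrow> strain (Y n) e)"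
    for n and z :: "lpt + edge"
  have "countable (UNIV :: edge set)"
    unfolding UNIV_Times_UNIV[symmetric] by (intro countable_SIGMA) (auto intro: countable_finite)
  then have count: "countable (UNIV :: (lpt + edge) set)"
    unfolding UNIV_Plus_UNIV[symmetric] by (intro countable_Plus) auto
  have bounded: "norm (f n z) \<le> 1" for n z
  proof (cases z)
    case (Inl x)
    then show ?thesis using frac_lt_1[of "Y n x"] frac_ge_0[of "Y n x"] by (simp add: f_def)
  next
    case (Inr e)
    then show ?thesis using abs_wrap_le[of "grad (Y n) e"] by (simp add: f_def strain_def)
  qed
  obtain k where subsequence: "strict_mono (k :: nat \<Rightarrow> nat)" "\<And>z. \<exists>l. (\<lambda>n. f (k n) z) \<longlonglongrightarrow> l"
    using function_convergent_subsequence[OF count, of f 1] bounded by (metis UNIV_I)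
  then obtain L where "\<And>z. (\<lambda>n. f (k n) z) \<longlonglongrightarrow> L z" by metis
  from this[of "Inl x" for x] this[of "Inr e" for e] show ?thesis
    using subsequence(1)
    by (intro exI[of _ k] exI[of _ "L \<circ> Inl"] exI[of _ "L \<circ> Inr"]) (simp add: f_def)
qed

lemma grad_frac_congruent: "grad y e - grad (\<lambda>x. frac (y x)) e \<in> \<int>"
proof -
  have "grad y e - grad (\<lambda>x. frac (y x)) e = of_int \<lfloor>y (tgt e)\<rfloor> - of_int \<lfloor>y (src e)\<rfloor>"
    by (simp add: grad_def frac_def)
  then show ?thesis by simp
qed

lemma grad_frac_tendsto:
  "(\<And>x. (\<lambda>n. frac (Y n x)) \<longlonglongrightarrow> y x) \<Longrightarrow> (\<lambda>n. grad (\<lambda>x. frac (Y n x)) e) \<longlonglongrightarrow> grad y e"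
  unfolding grad_def by (intro tendsto_diff)

lemma limit_strain:
  assumes "\<And>x. (\<lambda>n. frac (Y n x)) \<longlonglongrightarrow> y x" "\<And>e. (\<lambda>n. strain (Y n) e) \<longlonglongrightarrow> \<alpha> e"
  shows "\<bar>\<alpha> e\<bar> \<le> 1/2" "grad y e - \<alpha> e \<in> \<int>"
proof -
  show "\<bar>\<alpha> e\<bar> \<le> 1/2"
  proof (rule tendsto_upperbound)
    show "(\<lambda>n. \<bar>strain (Y n) e\<bar>) \<longlonglongrightarrow> \<bar>\<alpha> e\<bar>" by (intro tendsto_rabs assms(2))
    show "\<forall>\<^sub>F n in sequentially. \<bar>strain (Y n) e\<bar> \<le> 1/2"
      unfolding strain_def by (intro always_eventually allI abs_wrap_le)
  qed simp
  have "grad (\<lambda>x. frac (Y n x)) e - strain (Y n) e \<in> \<int>" for n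
    using Ints_diff[OF grad_strain_congruent[of "Y n" e] grad_frac_congruent[of "Y n" e]] by simp
  moreover have "(\<lambda>n. grad (\<lambda>x. frac (Y n x)) e - strain (Y n) e) \<longlonglongrightarrow> grad y e - \<alpha> e"
    by (intro tendsto_diff grad_frac_tendsto assms)
  ultimately show "grad y e - \<alpha> e \<in> \<int>"
    by (intro Lim_in_closed_set[OF closed_Ints always_eventually sequentially_bot]) auto
qed

context potential
begin

lemma energy_tendsto:
  assumes "\<And>x. (\<lambda>n. frac (Y n x)) \<longlonglongrightarrow> y x"
  shows "(\<lambda>n. energy (Y n) v) \<longlonglongrightarrow> energy y v"
proof -
  have psi_tendsto: "(\<lambda>n. \<psi> (grad (Y n) e + d)) \<longlonglongrightarrow> \<psi> (grad y e + d)" for e d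
  proof -
    have "(\<lambda>n. \<psi> (grad (\<lambda>x. frac (Y n x)) e + d)) \<longlonglongrightarrow> \<psi> (grad y e + d)"
      using continuous
      by (intro continuous_on_tendsto_compose[of UNIV \<psi>] tendsto_add tendsto_const grad_frac_tendsto
        assms) auto
    moreover have "\<psi> (grad (Y n) e + d) = \<psi> (grad (\<lambda>x. frac (Y n x)) e + d)" for n
      by (rule psi_cong) (use grad_frac_congruent[of "Y n" e] in simp)
    ultimately show ?thesis by simp
  qed
  show ?thesis
    unfolding energy_def using psi_tendsto psi_tendsto[where d = 0]
    by (intro tendsto_sum tendsto_diff) auto
qed

lemma energy_limit_nonneg:
  assumes "\<And>x. (\<lambda>n. frac (Y n x)) \<longlonglongrightarrow> y x" "\<And>n. near_minimiser (\<epsilon> n) (Y n)" "\<epsilon> \<longlonglongrightarrow> 0"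
    and "finite (grad_support v)"
  shows "0 \<le> energy y v"
proof (rule LIMSEQ_le)
  show "(\<lambda>n. energy (Y n) v) \<longlonglongrightarrow> energy y v" using assms(1) by (rule energy_tendsto)
  have "(\<lambda>n. - \<epsilon> n * (1 + real (card (grad_support v)))) \<longlonglongrightarrow> - 0 * (1 + real (card (grad_support v)))"
    by (intro tendsto_intros assms(3))
  then show "(\<lambda>n. - \<epsilon> n * (1 + real (card (grad_support v)))) \<longlonglongrightarrow> 0" by simp
  show "\<exists>N. \<forall>n\<ge>N. - \<epsilon> n * (1 + real (card (grad_support v))) \<le> energy (Y n) v"
    using assms(2,4) unfolding near_minimiser_def by blast
qed

theorem exists_stable_dislocation:
  "\<exists>G y \<alpha>. (\<forall>v. finite (grad_support v) \<longrightarrow> 0 \<le> energy y v) \<and> (\<forall>e. \<bar>\<alpha> e\<bar> \<le> 1/2) \<and>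
     (\<forall>e. grad y e - \<alpha> e \<in> \<int>) \<and> l2_bounded (\<lambda>e. \<alpha> e - angle_form e) G"
proof -
  obtain G \<epsilon>\<^sub>0 where \<epsilon>\<^sub>0_pos: "0 < \<epsilon>\<^sub>0" and close: "\<And>\<epsilon>. 0 < \<epsilon> \<Longrightarrow> \<epsilon> \<le> \<epsilon>\<^sub>0 \<Longrightarrow>
      \<exists>y. near_minimiser \<epsilon> y \<and> l2_bounded (\<lambda>e. strain y e - angle_form e) G"
    using exists_near_minimisers_l2_close by blast
  define \<epsilon> where "\<epsilon> n = \<epsilon>\<^sub>0 * inverse (real (Suc n))" for n
  have "0 < \<epsilon> n" "\<epsilon> n \<le> \<epsilon>\<^sub>0" for n using \<epsilon>\<^sub>0_pos by (auto simp: \<epsilon>_def field_simps)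
  then have "\<forall>n. \<exists>y. near_minimiser (\<epsilon> n) y \<and> l2_bounded (\<lambda>e. strain y e - angle_form e) G"
    using close by blast
  then obtain Y
    where minimisers: "\<And>n. near_minimiser (\<epsilon> n) (Y n)"
      "\<And>n. l2_bounded (\<lambda>e. strain (Y n) e - angle_form e) G"
    by metis
  have "(\<lambda>n. \<epsilon>\<^sub>0 * inverse (real (Suc n))) \<longlonglongrightarrow> \<epsilon>\<^sub>0 * 0"
    by (intro tendsto_intros LIMSEQ_inverse_real_of_nat)
  then have "\<epsilon> \<longlonglongrightarrow> 0" by (simp add: \<epsilon>_def[abs_def])
  obtain k y \<alpha> where subsequence: "strict_mono k" and y_lim: "\<And>x. (\<lambda>n. frac (Y (k n) x)) \<longlonglongrightarrow> y x"
    and strain_lim: "\<And>e. (\<lambda>n. strain (Y (k n)) e) \<longlonglongrightarrow> \<alpha> e"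
    using exists_convergent_subsequence[of Y] by blast
  have "(\<lambda>n. \<epsilon> (k n)) \<longlonglongrightarrow> 0" using LIMSEQ_subseq_LIMSEQ[OF \<open>\<epsilon> \<longlonglongrightarrow> 0\<close> subsequence] by (simp add: o_def)
  then have "\<forall>v. finite (grad_support v) \<longrightarrow> 0 \<le> energy y v"
    using energy_limit_nonneg[of "\<lambda>n. Y (k n)" y "\<lambda>n. \<epsilon> (k n)", OF y_lim minimisers(1)] by blast
  moreover have "\<forall>e. \<bar>\<alpha> e\<bar> \<le> 1/2" "\<forall>e. grad y e - \<alpha> e \<in> \<int>"
    using limit_strain[of "\<lambda>n. Y (k n)", OF y_lim strain_lim] by blast+
  moreover have "l2_bounded (\<lambda>e. \<alpha> e - angle_form e) G"
    using minimisers(2)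
    by (rule l2_bounded_tendsto[of "\<lambda>n e. strain (Y (k n)) e - angle_form e"])
      (intro tendsto_intros strain_lim)
  ultimately show ?thesis by blast
qed

end

section \<open>Bonds and cells of the lattice\<close>

definition unit_steps :: "lpt set" where
  "unit_steps = {(1, 0), (-1, 0), (0, 1), (0, -1), (-1, 1), (1, -1)}"

lemma quadratic_form_eq_1_iff:
  fixes m n :: int
  shows "m\<^sup>2 + m * n + n\<^sup>2 = 1 \<longleftrightarrow> (m, n) \<in> unit_steps"
proof
  assume norm_1: "m\<^sup>2 + m * n + n\<^sup>2 = 1"
  have "(2 * m + n)\<^sup>2 + 3 * n\<^sup>2 = 4 * 1" "(2 * n + m)\<^sup>2 + 3 * m\<^sup>2 = 4 * 1"
    unfolding norm_1[symmetric] by (simp_all add: power2_eq_square algebra_simps)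
  then have "3 * n\<^sup>2 \<le> 4" "3 * m\<^sup>2 \<le> 4"
    using zero_le_power2[of "2 * m + n"] zero_le_power2[of "2 * n + m"] by linarith+
  then have "n\<^sup>2 \<le> 1\<^sup>2" "m\<^sup>2 \<le> 1\<^sup>2" by simp_all
  then have "\<bar>n\<bar> \<le> 1" "\<bar>m\<bar> \<le> 1"
    using abs_le_square_iff[of n 1] abs_le_square_iff[of m 1] by simp_all
  then have "n = -1 \<or> n = 0 \<or> n = 1" "m = -1 \<or> m = 0 \<or> m = 1" by auto
  then show "(m, n) \<in> unit_steps" using norm_1 by (elim disjE) (auto simp: unit_steps_def)
qed (auto simp: unit_steps_def)

lemma dist_pos_square: "(dist (pos \<xi>) (pos \<eta>))\<^sup>2
    = of_int ((fst (\<eta> - \<xi>))\<^sup>2 + fst (\<eta> - \<xi>) * snd (\<eta> - \<xi>) + (snd (\<eta> - \<xi>))\<^sup>2)"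
proof -
  define m n where "m = real_of_int (fst (\<eta> - \<xi>))" and "n = real_of_int (snd (\<eta> - \<xi>))"
  have "(dist (pos \<xi>) (pos \<eta>))\<^sup>2
      = (fst (pos \<xi>) - fst (pos \<eta>))\<^sup>2 + (snd (pos \<xi>) - snd (pos \<eta>))\<^sup>2"
    by (simp add: dist_prod_def dist_real_def)
  also have "fst (pos \<xi>) - fst (pos \<eta>) = - (m + n / 2)"
    by (simp add: pos_def m_def n_def field_simps)
  also have "snd (pos \<xi>) - snd (pos \<eta>) = - (n * (sqrt 3 / 2))"
    by (simp add: pos_def n_def field_simps)
  also have "(- (m + n / 2))\<^sup>2 + (- (n * (sqrt 3 / 2)))\<^sup>2 = m\<^sup>2 + m * n + n\<^sup>2"
    unfolding power2_minus
    by (simp add: power_mult_distrib power_divide) (simp add: power2_eq_square field_simps)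
  finally show ?thesis by (simp add: m_def n_def)
qed

lemma is_bond_iff: "is_bond \<xi> \<eta> \<longleftrightarrow> \<eta> - \<xi> \<in> unit_steps"
proof -
  have "is_bond \<xi> \<eta> \<longleftrightarrow> (dist (pos \<xi>) (pos \<eta>))\<^sup>2 = 1"
    unfolding is_bond_def by (smt (verit) power2_eq_1_iff zero_le_dist)
  also have "\<dots> \<longleftrightarrow> (fst (\<eta> - \<xi>))\<^sup>2 + fst (\<eta> - \<xi>) * snd (\<eta> - \<xi>) + (snd (\<eta> - \<xi>))\<^sup>2 = 1"
    unfolding dist_pos_square by (simp only: of_int_eq_1_iff)
  finally show ?thesis unfolding quadratic_form_eq_1_iff prod.collapse .
qed

lemma is_bond_commute: "is_bond \<xi> \<eta> \<longleftrightarrow> is_bond \<eta> \<xi>"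
  by (simp add: is_bond_def dist_commute)

lemma is_bond_src_tgt: "is_bond (src e) (tgt e)"
  by (cases e rule: edge_cases) (auto simp: is_bond_iff unit_steps_def)

lemma bond_cases [consumes 1, case_names forward backward]:
  assumes "is_bond \<xi> \<eta>"
  obtains e where "\<xi> = src e" "\<eta> = tgt e" | e where "\<xi> = tgt e" "\<eta> = src e"
proof -
  obtain m n where \<xi>_eq: "\<xi> = (m, n)" by fastforce
  from assms consider "\<eta> = tgt (\<xi>, E0)" "\<xi> = src (\<xi>, E0)" | "\<xi> = tgt (\<eta>, E0)" "\<eta> = src (\<eta>, E0)"
    | "\<eta> = tgt (\<xi>, E1)" "\<xi> = src (\<xi>, E1)" | "\<xi> = tgt (\<eta>, E1)" "\<eta> = src (\<eta>, E1)"
    | "\<eta> = tgt (\<xi> - (1, 0), E2)" "\<xi> = src (\<xi> - (1, 0), E2)"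
    | "\<xi> = tgt (\<eta> - (1, 0), E2)" "\<eta> = src (\<eta> - (1, 0), E2)"
    unfolding is_bond_iff unit_steps_def \<xi>_eq by (cases \<eta>) (auto simp: algebra_simps)
  then show thesis using that by cases blast+
qed

lemma src_tgt_inject: "src e = src e' \<Longrightarrow> tgt e = tgt e' \<Longrightarrow> e = e'"
  and src_tgt_not_reversed: "src e = tgt e' \<Longrightarrow> tgt e \<noteq> src e'"
  by (cases e; cases e'; cases "snd e"; cases "snd e'"; cases "fst e"; cases "fst e'"; auto)+

lemma inj_src_tgt: "inj_on (\<lambda>e. (src e, tgt e)) S" "inj_on (\<lambda>e. (tgt e, src e)) S"
  by (rule inj_onI; erule Pair_inject; rule src_tgt_inject; assumption)+

lemma finite_norm_pos_le: "finite {\<xi>. norm (pos \<xi>) \<le> C}"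
proof -
  define N where "N = nat \<lceil>4 * C + 4\<rceil>"
  have "\<xi> \<in> lattice_box N" if bounded: "norm (pos \<xi>) \<le> C" for \<xi>
  proof -
    define m n where "m = real_of_int (fst \<xi>)" and "n = real_of_int (snd \<xi>)"
    have fst_le: "\<bar>1/2 + m + n / 2\<bar> \<le> C"
      using norm_fst_le[of "fst (pos \<xi>)" "snd (pos \<xi>)"] bounded by (simp add: pos_def m_def n_def)
    have "\<bar>sqrt 3 / 6 + n * sqrt 3 / 2\<bar> \<le> C"
      using norm_snd_le[of "snd (pos \<xi>)" "fst (pos \<xi>)"] bounded by (simp add: pos_def m_def n_def)
    then have "\<bar>sqrt 3 * (1/6 + n / 2)\<bar> \<le> C" by (simp add: algebra_simps)
    then have "sqrt 3 * \<bar>1/6 + n / 2\<bar> \<le> C" by (simp add: abs_mult)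
    moreover have "\<bar>1/6 + n / 2\<bar> \<le> sqrt 3 * \<bar>1/6 + n / 2\<bar>"
      using mult_right_mono[of 1 "sqrt 3" "\<bar>1/6 + n / 2\<bar>"] by simp
    ultimately have "\<bar>1/6 + n / 2\<bar> \<le> C" by (rule order_trans[rotated])
    then have "\<bar>n\<bar> \<le> 4 * C + 4" "\<bar>m\<bar> \<le> 4 * C + 4" using fst_le by (auto simp: abs_le_iff)
    then have "\<bar>fst \<xi>\<bar> \<le> \<lceil>4 * C + 4\<rceil>" "\<bar>snd \<xi>\<bar> \<le> \<lceil>4 * C + 4\<rceil>"
      unfolding m_def n_def by linarith+
    then show ?thesis unfolding mem_lattice_box sup_norm_def N_def by linarith
  qed
  then show ?thesis by (intro finite_subset[OF _ finite_lattice_box]) blast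
qed

lemma norm_pos_le_bond_dist:
  assumes "is_bond \<xi> \<eta>" shows "norm (pos \<xi>) \<le> bond_dist \<xi> \<eta> + 1"
proof -
  have "closed (closed_segment (pos \<xi>) (pos \<eta>))" "closed_segment (pos \<xi>) (pos \<eta>) \<noteq> {}" by auto
  then obtain z where nearest: "z \<in> closed_segment (pos \<xi>) (pos \<eta>)"
    "infdist 0 (closed_segment (pos \<xi>) (pos \<eta>)) = dist 0 z"
    using infdist_attains_inf by blast
  have "dist (pos \<xi>) z \<le> dist (pos \<xi>) (pos \<eta>)"
    using dist_in_closed_segment[OF nearest(1)] by (simp add: dist_commute)
  then show ?thesis
    using nearest(2) assms norm_triangle_sub[of "pos \<xi>" z]
    unfolding bond_dist_def is_bond_def by (simp add: dist_norm)
qed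

lemma bond_dist_commute: "bond_dist \<xi> \<eta> = bond_dist \<eta> \<xi>"
  by (simp add: bond_dist_def closed_segment_commute)

lemma D_src_tgt: "D y (src e) (tgt e) = grad y e" "D y (tgt e) (src e) = - grad y e"
  by (simp_all add: D_def grad_def)

lemma finite_grad_support_if_W0:
  assumes "v \<in> W0" shows "finite (grad_support v)"
proof -
  obtain R where support_bound: "\<And>\<xi> \<eta>. is_bond \<xi> \<eta> \<Longrightarrow> D v \<xi> \<eta> \<noteq> 0 \<Longrightarrow> bond_dist \<xi> \<eta> \<le> R"
    using assms unfolding W0_def by blast
  have "norm (pos (src e)) \<le> R + 1" "norm (pos (tgt e)) \<le> R + 1"
    if in_support: "e \<in> grad_support v" for e
  proof -
    have "D v (src e) (tgt e) \<noteq> 0" using in_support by (simp add: grad_support_def D_src_tgt)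
    then have "bond_dist (src e) (tgt e) \<le> R" by (rule support_bound[OF is_bond_src_tgt])
    then show "norm (pos (src e)) \<le> R + 1" "norm (pos (tgt e)) \<le> R + 1"
      using norm_pos_le_bond_dist[OF is_bond_src_tgt[of e]]
        norm_pos_le_bond_dist[OF is_bond_src_tgt[of e, unfolded is_bond_commute[of "src e"]]]
        bond_dist_commute[of "src e" "tgt e"] by linarith+
  qed
  then have "(\<lambda>e. (src e, tgt e)) ` grad_support v
      \<subseteq> {\<xi>. norm (pos \<xi>) \<le> R + 1} \<times> {\<xi>. norm (pos \<xi>) \<le> R + 1}"
    by blast
  then have "finite ((\<lambda>e. (src e, tgt e)) ` grad_support v)"
    using finite_norm_pos_le finite_subset by blast
  then show ?thesis by (rule finite_imageD[OF _ inj_src_tgt(1)])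
qed

lemma bonds_in_support_eq:
  "{(\<xi>, \<eta>). is_bond \<xi> \<eta> \<and> D v \<xi> \<eta> \<noteq> 0}
    = (\<lambda>e. (src e, tgt e)) ` grad_support v \<union> (\<lambda>e. (tgt e, src e)) ` grad_support v"
proof (intro equalityI subsetI)
  fix b assume "b \<in> {(\<xi>, \<eta>). is_bond \<xi> \<eta> \<and> D v \<xi> \<eta> \<noteq> 0}"
  then obtain \<xi> \<eta> where b_eq: "b = (\<xi>, \<eta>)" "D v \<xi> \<eta> \<noteq> 0" and bond: "is_bond \<xi> \<eta>" by auto
  from bond show "b \<in> (\<lambda>e. (src e, tgt e)) ` grad_support v \<union> (\<lambda>e. (tgt e, src e)) ` grad_support v"
    by (cases rule: bond_cases) (use b_eq in \<open>auto simp: D_src_tgt grad_support_def\<close>)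
qed (auto simp: D_src_tgt grad_support_def is_bond_src_tgt
    is_bond_src_tgt[unfolded is_bond_commute[of "src _"]])

lemma (in potential) energy_diff_eq_energy:
  assumes even: "\<And>x. \<psi> (- x) = \<psi> x" and finite_support: "finite (grad_support v)"
  shows "energy_diff \<psi> y v = 2 * energy y v"
proof -
  define fwd where "fwd = (\<lambda>e. (src e, tgt e)) ` grad_support v"
  define bwd where "bwd = (\<lambda>e. (tgt e, src e)) ` grad_support v"
  define g
    where "g b = \<psi> (D y (fst b) (snd b) + D v (fst b) (snd b)) - \<psi> (D y (fst b) (snd b))" for b
  have "fwd \<inter> bwd = {}" unfolding fwd_def bwd_def using src_tgt_not_reversed by auto
  then have "energy_diff \<psi> y v = sum g fwd + sum g bwd"
    unfolding energy_diff_def bonds_in_support_eq g_def fwd_def bwd_def using finite_support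
    by (intro sum.union_disjoint) auto
  also have "sum g fwd = energy y v"
    unfolding fwd_def energy_def by (simp add: sum.reindex[OF inj_src_tgt(1)] g_def D_src_tgt)
  also have "sum g bwd = energy y v"
  proof -
    have "\<psi> (- a - b) = \<psi> (a + b)" for a b using even[of "a + b"] by simp
    then show ?thesis
      unfolding bwd_def energy_def
      by (simp add: sum.reindex[OF inj_src_tgt(2)] g_def D_src_tgt even)
  qed
  finally show ?thesis by simp
qed

lemma (in potential) globally_stable_if_energy_nonneg:
  assumes "\<And>x. \<psi> (- x) = \<psi> x" "\<And>v. finite (grad_support v) \<Longrightarrow> 0 \<le> energy y v"
  shows "globally_stable \<psi> y"
  unfolding globally_stable_def using assms finite_grad_support_if_W0 energy_diff_eq_energy by simp

definition bond_form :: "(edge \<Rightarrow> real) \<Rightarrow> lpt \<Rightarrow> lpt \<Rightarrow> real" where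
  "bond_form a \<xi> \<eta> = (\<Sum>e | src e = \<xi> \<and> tgt e = \<eta>. a e) - (\<Sum>e | src e = \<eta> \<and> tgt e = \<xi>. a e)"

lemma bond_form_reverse: "bond_form a \<eta> \<xi> = - bond_form a \<xi> \<eta>"
  by (simp add: bond_form_def)

lemma bond_form_src_tgt: "bond_form a (src e) (tgt e) = a e"
proof -
  have "{e'. src e' = src e \<and> tgt e' = tgt e} = {e}" using src_tgt_inject by blast
  moreover have "{e'. src e' = tgt e \<and> tgt e' = src e} = {}" using src_tgt_not_reversed by blast
  ultimately show ?thesis by (simp only: bond_form_def) simp
qed

lemma bond_form_step:
  "bond_form a x (x + (1, 0)) = a (x, E0)" "bond_form a (x + (1, 0)) x = - a (x, E0)"
  "bond_form a x (x + (0, 1)) = a (x, E1)" "bond_form a (x + (0, 1)) x = - a (x, E1)"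
  "bond_form a (x + (1, 0)) (x + (0, 1)) = a (x, E2)"
  "bond_form a (x + (0, 1)) (x + (1, 0)) = - a (x, E2)"
  using bond_form_src_tgt[of a "(x, E0)"] bond_form_src_tgt[of a "(x, E1)"]
    bond_form_src_tgt[of a "(x, E2)"]
    bond_form_reverse[of a "x + (1, 0)" x] bond_form_reverse[of a "x + (0, 1)" x]
    bond_form_reverse[of a "x + (0, 1)" "x + (1, 0)"]
  by simp_all

fun vertices :: "tri \<Rightarrow> lpt \<times> lpt \<times> lpt" where
  "vertices (x, True) = (x, x + (1, 0), x + (0, 1))"
| "vertices (x, False) = (x + (1, 0), x + (0, 1) + (1, 0), x + (0, 1))"

fun rotations :: "'a \<times> 'a \<times> 'a \<Rightarrow> ('a \<times> 'a \<times> 'a) set" where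
  "rotations (x, y, z) = {(x, y, z), (y, z, x), (z, x, y)}"

fun set_triple :: "'a \<times> 'a \<times> 'a \<Rightarrow> 'a set" where
  "set_triple (x, y, z) = {x, y, z}"

lemma rotations_refl: "t \<in> rotations t"
  by (cases t) simp

lemma set_triple_rotation: "t \<in> rotations t' \<Longrightarrow> set_triple t = set_triple t'"
  by (cases t') auto

lemma circ_rotation:
  "(\<xi>, \<zeta>, \<eta>) \<in> rotations (\<xi>', \<zeta>', \<eta>') \<Longrightarrow> circ \<alpha> \<xi> \<zeta> \<eta> = circ \<alpha> \<xi>' \<zeta>' \<eta>'"
  by (auto simp: circ_def)

lemma circ_bond_form:
  assumes "(\<xi>, \<zeta>, \<eta>) \<in> rotations (vertices T)" shows "circ (bond_form a) \<xi> \<zeta> \<eta> = curl a T"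
proof (cases T rule: tri_cases)
  case (up x)
  have "circ (bond_form a) x (x + (1, 0)) (x + (0, 1)) = curl a T"
    unfolding circ_def bond_form_step up by simp
  then show ?thesis using circ_rotation assms unfolding up by (simp only: vertices.simps)
next
  case (down x)
  have corner: "x + (1, 0) + (0, 1) = x + (0, 1) + (1, 0)" by (simp add: add_ac)
  have vertical: "bond_form a (x + (1, 0)) (x + (0, 1) + (1, 0)) = a (x + (1, 0), E1)"
    using bond_form_step(3)[of a "x + (1, 0)"] unfolding corner .
  have "circ (bond_form a) (x + (1, 0)) (x + (0, 1) + (1, 0)) (x + (0, 1)) = curl a T"
    unfolding circ_def vertical bond_form_step down by simp
  then show ?thesis using circ_rotation assms unfolding down by (simp only: vertices.simps)
qed

lemma pos_oriented_iff:
  "pos_oriented \<xi> \<zeta> \<eta> \<longleftrightarrow> 0 < fst (\<zeta> - \<xi>) * snd (\<eta> - \<xi>) - snd (\<zeta> - \<xi>) * fst (\<eta> - \<xi>)"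
proof -
  define a b c d where "a = real_of_int (fst (\<zeta> - \<xi>))" and "b = real_of_int (snd (\<zeta> - \<xi>))"
    and "c = real_of_int (fst (\<eta> - \<xi>))" and "d = real_of_int (snd (\<eta> - \<xi>))"
  have coordinates: "fst (pos \<zeta>) - fst (pos \<xi>) = a + b / 2" "fst (pos \<eta>) - fst (pos \<xi>) = c + d / 2"
    "snd (pos \<zeta>) - snd (pos \<xi>) = b * (sqrt 3 / 2)" "snd (pos \<eta>) - snd (pos \<xi>) = d * (sqrt 3 / 2)"
    by (simp_all add: pos_def a_def b_def c_def d_def field_simps)
  have det: "(a + b / 2) * (d * (sqrt 3 / 2)) - b * (sqrt 3 / 2) * (c + d / 2)
      = (sqrt 3 / 2) * (a * d - b * c)"
    by (simp add: field_simps)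
  have "pos_oriented \<xi> \<zeta> \<eta> \<longleftrightarrow> 0 < (sqrt 3 / 2) * (a * d - b * c)"
    unfolding pos_oriented_def coordinates det ..
  also have "\<dots> \<longleftrightarrow> 0 < a * d - b * c" by (simp add: zero_less_mult_iff)
  also have "a * d - b * c = of_int (fst (\<zeta> - \<xi>) * snd (\<eta> - \<xi>) - snd (\<zeta> - \<xi>) * fst (\<eta> - \<xi>))"
    by (simp add: a_def b_def c_def d_def)
  finally show ?thesis by (simp only: of_int_0_less_iff)
qed

definition consecutive_steps :: "(lpt \<times> lpt) set" where
  "consecutive_steps = {((1, 0), (0, 1)), ((0, 1), (-1, 1)), ((-1, 1), (-1, 0)), ((-1, 0), (0, -1)),
    ((0, -1), (1, -1)), ((1, -1), (1, 0))}"

lemma oriented_steps_consecutive: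
  assumes "d \<in> unit_steps" "d' \<in> unit_steps" "d' - d \<in> unit_steps"
    "0 < fst d * snd d' - snd d * fst d'"
  shows "(d, d') \<in> consecutive_steps"
proof -
  have "\<forall>d\<in>unit_steps. \<forall>d'\<in>unit_steps. d' - d \<in> unit_steps \<longrightarrow>
    0 < fst d * snd d' - snd d * fst d' \<longrightarrow> (d, d') \<in> consecutive_steps"
    by (simp add: unit_steps_def consecutive_steps_def)
  then show ?thesis using assms by metis
qed

lemma oriented_cell_iff:
  "is_cell \<xi> \<zeta> \<eta> \<and> pos_oriented \<xi> \<zeta> \<eta> \<longleftrightarrow> (\<exists>T. (\<xi>, \<zeta>, \<eta>) \<in> rotations (vertices T))"
proof
  assume cell: "is_cell \<xi> \<zeta> \<eta> \<and> pos_oriented \<xi> \<zeta> \<eta>"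
  define d d' where "d = \<zeta> - \<xi>" and "d' = \<eta> - \<xi>"
  have neighbours: "\<zeta> = \<xi> + d" "\<eta> = \<xi> + d'" by (simp_all add: d_def d'_def)
  have "is_bond \<xi> \<zeta>" "is_bond \<xi> \<eta>" "is_bond \<zeta> \<eta>"
    using cell by (simp_all add: is_cell_def is_bond_commute)
  then have "d \<in> unit_steps" "d' \<in> unit_steps" "d' - d \<in> unit_steps"
    by (simp_all add: is_bond_iff d_def d'_def)
  moreover have "0 < fst d * snd d' - snd d * fst d'"
    using cell by (simp add: pos_oriented_iff d_def d'_def)
  ultimately have "(d, d') \<in> consecutive_steps" by (rule oriented_steps_consecutive)
  then have "(\<xi>, \<zeta>, \<eta>) \<in> rotations (vertices (\<xi>, True))
    \<or> (\<xi>, \<zeta>, \<eta>) \<in> rotations (vertices (\<xi> - (1, 0), False))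
    \<or> (\<xi>, \<zeta>, \<eta>) \<in> rotations (vertices (\<xi> - (1, 0), True))
    \<or> (\<xi>, \<zeta>, \<eta>) \<in> rotations (vertices (\<xi> - (1, 1), False))
    \<or> (\<xi>, \<zeta>, \<eta>) \<in> rotations (vertices (\<xi> - (0, 1), True))
    \<or> (\<xi>, \<zeta>, \<eta>) \<in> rotations (vertices (\<xi> - (0, 1), False))"
    unfolding neighbours consecutive_steps_def by (cases \<xi>) (elim insertE emptyE; simp)
  then show "\<exists>T. (\<xi>, \<zeta>, \<eta>) \<in> rotations (vertices T)" by blast
next
  assume "\<exists>T. (\<xi>, \<zeta>, \<eta>) \<in> rotations (vertices T)"
  then obtain T where rotation: "(\<xi>, \<zeta>, \<eta>) \<in> rotations (vertices T)" ..
  obtain m n b where "T = ((m, n), b)" by (metis prod.exhaust)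
  then show "is_cell \<xi> \<zeta> \<eta> \<and> pos_oriented \<xi> \<zeta> \<eta>"
    using rotation by (cases b) (auto simp: is_cell_def is_bond_iff unit_steps_def pos_oriented_iff)
qed

lemma inj_set_vertices: "inj (\<lambda>T. set_triple (vertices T))"
proof (rule injI)
  fix T T' assume same_vertices: "set_triple (vertices T) = set_triple (vertices T')"
  have coordinate_sums: "sum fst (set_triple (vertices T))
      = 3 * fst (fst T) + (if snd T then 1 else 2)"
    "sum snd (set_triple (vertices T)) = 3 * snd (fst T) + (if snd T then 1 else 2)" for T
    by (cases T rule: tri_cases; cases "fst T"; auto)+
  have sums_eq: "3 * fst (fst T) + (if snd T then 1 else 2)
      = 3 * fst (fst T') + (if snd T' then 1 else 2)"
    "3 * snd (fst T) + (if snd T then 1 else 2)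
      = 3 * snd (fst T') + (if snd T' then 1 else (2::int))"
    unfolding coordinate_sums[symmetric] same_vertices by simp_all
  then have "snd T = snd T'" by (auto split: if_splits) presburger+
  then show "T = T'" using sums_eq by (auto simp: prod_eq_iff split: if_splits)
qed

lemma tri_circ_bond_form: "tri_circ (bond_form a) (set_triple (vertices T)) = curl a T"
proof -
  define labelling where "labelling C \<longleftrightarrow> (case C of (\<xi>, \<zeta>, \<eta>) \<Rightarrow>
    set_triple (vertices T) = {\<xi>, \<zeta>, \<eta>} \<and> is_cell \<xi> \<zeta> \<eta> \<and> pos_oriented \<xi> \<zeta> \<eta>)" for C
  obtain \<xi>' \<zeta>' \<eta>' where "vertices T = (\<xi>', \<zeta>', \<eta>')" by (metis prod.exhaust)
  moreover from this have "is_cell \<xi>' \<zeta>' \<eta>' \<and> pos_oriented \<xi>' \<zeta>' \<eta>'"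
    using rotations_refl[of "vertices T"] unfolding oriented_cell_iff by (intro exI[of _ T]) simp
  ultimately have "labelling (vertices T)" by (simp add: labelling_def)
  then have "labelling (SOME C. labelling C)" by (rule someI)
  then obtain \<xi> \<zeta> \<eta>
    where chosen: "(SOME C. labelling C) = (\<xi>, \<zeta>, \<eta>)"
      "set_triple (vertices T) = set_triple (\<xi>, \<zeta>, \<eta>)"
      "is_cell \<xi> \<zeta> \<eta> \<and> pos_oriented \<xi> \<zeta> \<eta>"
    unfolding labelling_def by (cases "SOME C. labelling C") (auto simp: labelling_def)
  then obtain T' where rotation: "(\<xi>, \<zeta>, \<eta>) \<in> rotations (vertices T')"
    using oriented_cell_iff by blast
  then have "T' = T"
    using set_triple_rotation[OF rotation] chosen(2) injD[OF inj_set_vertices] by metis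
  then have "circ (bond_form a) \<xi> \<zeta> \<eta> = curl a T" using circ_bond_form rotation by blast
  then show ?thesis unfolding tri_circ_def labelling_def[symmetric] chosen(1) by simp
qed

lemma cores_bond_form: "cores (bond_form a) = (\<lambda>T. set_triple (vertices T)) ` charged a"
proof (intro equalityI subsetI)
  fix X assume "X \<in> cores (bond_form a)"
  then obtain \<xi> \<zeta> \<eta> where core: "X = set_triple (\<xi>, \<zeta>, \<eta>)" "is_cell \<xi> \<zeta> \<eta> \<and> pos_oriented \<xi> \<zeta> \<eta>"
      "circ (bond_form a) \<xi> \<zeta> \<eta> \<noteq> 0"
    unfolding cores_def by auto
  then obtain T where rotation: "(\<xi>, \<zeta>, \<eta>) \<in> rotations (vertices T)"
    using oriented_cell_iff by blast
  then show "X \<in> (\<lambda>T. set_triple (vertices T)) ` charged a"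
    using core circ_bond_form[OF rotation] set_triple_rotation[OF rotation]
    by (auto simp: charged_def)
next
  fix X assume "X \<in> (\<lambda>T. set_triple (vertices T)) ` charged a"
  then obtain T where charged_tri: "X = set_triple (vertices T)" "curl a T \<noteq> 0"
    by (auto simp: charged_def)
  obtain \<xi> \<zeta> \<eta> where vertices: "vertices T = (\<xi>, \<zeta>, \<eta>)" by (metis prod.exhaust)
  then have labelling: "(\<xi>, \<zeta>, \<eta>) \<in> rotations (vertices T)" using rotations_refl by metis
  then have "is_cell \<xi> \<zeta> \<eta> \<and> pos_oriented \<xi> \<zeta> \<eta>" using oriented_cell_iff by blast
  then show "X \<in> cores (bond_form a)"
    using circ_bond_form[OF labelling, of a] charged_tri vertices
    unfolding cores_def by (intro CollectI exI[of _ \<xi>] exI[of _ \<zeta>] exI[of _ \<eta>]) simp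
qed

lemma sum_tri_circ_bond_form: "(\<Sum>X\<in>cores (bond_form a). tri_circ (bond_form a) X) = net_charge a"
  unfolding cores_bond_form net_charge_def
  by (simp add: sum.reindex[OF inj_on_subset[OF inj_set_vertices]] tri_circ_bond_form)

lemma bond_form_Dclass:
  assumes "\<And>e. \<bar>a e\<bar> \<le> 1/2" "\<And>e. grad y e - a e \<in> \<int>" shows "bond_form a \<in> Dclass y"
proof -
  have "bond_form a \<xi> \<eta> \<in> {-1/2..1/2} \<and> bond_form a \<eta> \<xi> = - bond_form a \<xi> \<eta> \<and>
      D y \<xi> \<eta> - bond_form a \<xi> \<eta> \<in> \<int>"
    if "is_bond \<xi> \<eta>" for \<xi> \<eta>
    using that
  proof (cases rule: bond_cases)
    case (forward e)
    moreover have "a e \<in> {-1/2..1/2}" using assms(1)[of e] by auto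
    ultimately show ?thesis
      using assms(2)[of e] bond_form_reverse[of a \<eta> \<xi>] by (simp only: bond_form_src_tgt D_src_tgt)
  next
    case (backward e)
    moreover have "- a e \<in> {-1/2..1/2}" using assms(1)[of e] by auto
    moreover have "- (grad y e - a e) \<in> \<int>" using assms(2) by (rule Ints_minus)
    ultimately show ?thesis
      using bond_form_reverse[of a \<eta> \<xi>] bond_form_reverse[of a \<xi> \<eta>]
      by (simp only: bond_form_src_tgt D_src_tgt) simp
  qed
  then show ?thesis unfolding Dclass_def by blast
qed

lemma decays_bond_form:
  assumes "\<And>\<delta>. 0 < \<delta> \<Longrightarrow> finite {e. \<delta> \<le> \<bar>a e\<bar>}" shows "decays (bond_form a)"
  unfolding decays_def
proof (intro allI impI)
  fix \<epsilon> :: real assume "0 < \<epsilon>"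
  then have finite_dists: "finite ((\<lambda>e. bond_dist (src e) (tgt e)) ` {e. \<epsilon> \<le> \<bar>a e\<bar>})"
    by (intro finite_imageI assms)
  define R where "R = Max (insert 0 ((\<lambda>e. bond_dist (src e) (tgt e)) ` {e. \<epsilon> \<le> \<bar>a e\<bar>}))"
  have far: "\<bar>a e\<bar> < \<epsilon>" if "R < bond_dist (src e) (tgt e)" for e
  proof (rule ccontr)
    assume "\<not> ?thesis"
    then have "bond_dist (src e) (tgt e) \<le> R"
      unfolding R_def using finite_dists by (intro Max_ge) auto
    then show False using that by simp
  qed
  have "\<bar>bond_form a \<xi> \<eta>\<bar> < \<epsilon>" if "is_bond \<xi> \<eta> \<and> R < bond_dist \<xi> \<eta>" for \<xi> \<eta>
    using that[THEN conjunct1]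
  proof (cases rule: bond_cases)
    case (forward e)
    then show ?thesis using far[of e] that by (simp add: bond_form_src_tgt)
  next
    case (backward e)
    then show ?thesis
      using far[of e] that bond_form_reverse[of a \<xi> \<eta>] bond_dist_commute[of \<xi> \<eta>]
      by (simp add: bond_form_src_tgt)
  qed
  then show "\<exists>R. \<forall>\<xi> \<eta>. is_bond \<xi> \<eta> \<and> R < bond_dist \<xi> \<eta> \<longrightarrow> \<bar>bond_form a \<xi> \<eta>\<bar> < \<epsilon>" by blast
qed

lemma has_burgers_net_charge:
  assumes "\<And>e. \<bar>a e\<bar> \<le> 1/2" "\<And>e. grad y e - a e \<in> \<int>"
    and "\<And>\<delta>. 0 < \<delta> \<Longrightarrow> finite {e. \<delta> \<le> \<bar>a e\<bar>}" "finite (charged a)"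
  shows "has_burgers y (net_charge a)"
  unfolding has_burgers_def
  using bond_form_Dclass[OF assms(1,2)] decays_bond_form[OF assms(3)] assms(4)
    sum_tri_circ_bond_form[of a]
  by (intro exI[of _ "bond_form a"]) (simp add: cores_bond_form)

theorem theorem3p3:
  fixes \<psi> :: "real \<Rightarrow> real" and \<mu> :: real
  assumes cont: "continuous_on UNIV \<psi>"
    and C4: "C4_on (- {x. \<exists>k::int. x = real_of_int k + 1/2}) \<psi>"
    and psi1: "\<forall>x. \<psi> (x + 1) = \<psi> x"
    and psi2a: "\<forall>x. \<psi> (- x) = \<psi> x"
    and psi2b: "\<forall>x. \<psi> (1/2 + (- x)) = \<psi> (1/2 + x)"
    and psi3: "\<forall>r. \<psi> r = 0 \<longleftrightarrow> r \<in> \<int>"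
    and psi4: "(deriv ^^ 2) \<psi> 0 = \<mu>" "\<mu> > 0"
    and psi5: "\<forall>x\<in>{-1/2..1/2}. \<psi> x \<ge> 1/2 * \<mu> * x\<^sup>2"
  shows "\<exists>y :: lpt \<Rightarrow> real. globally_stable \<psi> y \<and> has_burgers y 1"
proof -
  obtain K\<^sub>2 K\<^sub>3 where "potential \<psi> \<mu> K\<^sub>2 K\<^sub>3"
    using exists_potential[OF cont C4 psi1 psi3 psi4 psi5] by blast
  then interpret potential \<psi> \<mu> K\<^sub>2 K\<^sub>3 .
  obtain G y \<alpha> where stable: "\<And>v. finite (grad_support v) \<Longrightarrow> 0 \<le> energy y v"
    and lift: "\<And>e. \<bar>\<alpha> e\<bar> \<le> 1/2" "\<And>e. grad y e - \<alpha> e \<in> \<int>"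
    and close: "l2_bounded (\<lambda>e. \<alpha> e - angle_form e) G"
    using exists_stable_dislocation by blast
  interpret l2_perturbed_dislocation \<alpha> G
    using curl_Ints_congruent[OF lift(2)] close by unfold_locales
  have "globally_stable \<psi> y"
    using psi2a stable by (intro globally_stable_if_energy_nonneg) auto
  moreover have "has_burgers y 1"
    using has_burgers_net_charge[OF lift finite_large finite_charged] by (simp add: net_charge_eq_1)
  ultimately show ?thesis by blast
qed

end
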